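(* Let $d\ge c\ge 2$ be integers with $d\neq 2$, and fix $\varepsilon>0$. Let $\mathbf{X}_n$ be a uniformly random signing of a uniformly random $n$-lift of $K_{d,c}$, and let $\mathbf{A}_n$ be its adjacency matrix. Then $$\Pr\big[\mathrm{PS}(\mathbf{A}_n)\not\subset[\underline{\lambda}-\varepsilon,\overline{\lambda}+\varepsilon]\big]=o_{n\to\infty}(1),$$ where $\underline{\lambda}=\sqrt{d-1}-\sqrt{c-1}$ and $\overline{\lambda}=\sqrt{d-1}+\sqrt{c-1}$.
   Context: $K_{d,c}$ is the complete bipartite graph with parts of sizes $d$ and $c$. An $n$-lift of a graph $(V,E)$ has vertex set $V\times[n]$ and, for each edge $\{u,v\}$, a perfect matching between $\{u\}\times[n]$ and $\{v\}\times[n]$. In a uniformly random $n$-lift these matchings are independent and uniform. A random signing labels each edge independently and uniformly with $\pm1$. The adjacency matrix $A$ of an edge-signed graph has $A[i,j]$ equal to the sum of the signs of the edges joining $i$ and $j$. For an edge-signed bipartite graph with parts of sizes $m\ge n'$, the spectrum of $A$ consists of $0$ with multiplicity $m-n'$ together with $\{\pm\lambda:\lambda\in\mathrm{PS}(A)\}$. Here $\mathrm{PS}(A)\subset\mathbb{R}_{\ge0}$ is a multiset of size $n'$; equivalently, it is the multiset of singular values of the $n'\times m$ biadjacency block. It may contain $0$. *)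

theory Defs
  imports
    "HOL-Probability.Probability"
    "HOL-Library.Landau_Symbols"
    "Jordan_Normal_Form.Char_Poly"
begin

text \<open>Graphs are given by their set of edges, an edge being a two-element set of vertices.
  The two parts of \<open>K\<^bsub>d,c\<^esub>\<close> are told apart by the injections of the sum type.\<close>

definition complete_bipartite_vertices :: "nat \<Rightarrow> nat \<Rightarrow> (nat + nat) list" where
  "complete_bipartite_vertices d c = map Inl [0..<d] @ map Inr [0..<c]"

definition complete_bipartite_edges :: "nat \<Rightarrow> nat \<Rightarrow> (nat + nat) set set" where
  "complete_bipartite_edges d c = {{Inl i, Inr j} | i j. i < d \<and> j < c}"

text \<open>For an edge \<open>e = {u, v}\<close>, the perfect matchings between \<open>{u} \<times> [n]\<close> and \<open>{v} \<times> [n]\<close>.\<close>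

definition fibre_matchings :: "nat \<Rightarrow> 'a set \<Rightarrow> ('a \<times> nat) set set set" where
  "fibre_matchings n e =
     {M. M \<subseteq> {{(u, k), (v, l)} | u v k l. e = {u, v} \<and> u \<noteq> v \<and> k < n \<and> l < n} \<and>
         (\<forall>x \<in> e \<times> {..<n}. \<exists>!f. f \<in> M \<and> x \<in> f)}"

definition random_lift :: "'a set set \<Rightarrow> nat \<Rightarrow> ('a \<times> nat) set set pmf" where
  "random_lift E n =
     map_pmf (\<lambda>M. \<Union>e\<in>E. M e) (Pi_pmf E {} (\<lambda>e. pmf_of_set (fibre_matchings n e)))"

definition random_signing :: "'a set set \<Rightarrow> ('a set \<Rightarrow> real) pmf" where
  "random_signing F = Pi_pmf F 0 (\<lambda>_. pmf_of_set {-1, 1})"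

text \<open>A pair \<open>(F, s)\<close> consists of the edges of the lift and their signs.\<close>

definition random_signed_lift ::
    "'a set set \<Rightarrow> nat \<Rightarrow> (('a \<times> nat) set set \<times> (('a \<times> nat) set \<Rightarrow> real)) pmf" where
  "random_signed_lift E n =
     bind_pmf (random_lift E n) (\<lambda>F. map_pmf (\<lambda>s. (F, s)) (random_signing F))"

definition signed_adjacency_matrix ::
    "'v list \<Rightarrow> 'v set set \<Rightarrow> ('v set \<Rightarrow> real) \<Rightarrow> real mat" where
  "signed_adjacency_matrix vs F s =
     Matrix.mat (length vs) (length vs)
       (\<lambda>(a, b). \<Sum>e \<in> {e \<in> F. e = {vs ! a, vs ! b}}. s e)"

definition lift_vertices :: "'a list \<Rightarrow> nat \<Rightarrow> ('a \<times> nat) list" where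
  "lift_vertices vs n = List.product vs [0..<n]"

text \<open>The spectrum, with multiplicities, is the multiset of roots of the characteristic
  polynomial.\<close>

definition is_PS :: "nat \<Rightarrow> nat \<Rightarrow> real mat \<Rightarrow> real multiset \<Rightarrow> bool" where
  "is_PS m n' A P \<longleftrightarrow> size P = n' \<and> (\<forall>x \<in># P. 0 \<le> x) \<and>
     proots (char_poly A) = replicate_mset (m - n') 0 + P + image_mset uminus P"

definition PS :: "nat \<Rightarrow> nat \<Rightarrow> real mat \<Rightarrow> real multiset" where
  "PS m n' A = (THE P. is_PS m n' A P)"

text \<open>Well-definedness: \<open>is_PS\<close> determines \<open>P\<close>, and for a bipartite block matrix it is satisfied
  by the singular values of the block. Hence the definite description above denotes on every
  outcome of \<open>random_signed_lift\<close>, and the uniform distributions on \<open>fibre_matchings\<close>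
  are distributions on finite nonempty sets.\<close>

lemma is_PS_unique:
  assumes "is_PS m n' A P" "is_PS m n' A Q"
  shows "P = Q"
proof (rule multiset_eqI)
  fix x
  have cnt: "count (image_mset uminus R) y = count R (- y)" for R :: "real multiset" and y
    by (induction R) auto
  have eq: "count P y + count P (- y) = count Q y + count Q (- y)" for y
  proof -
    have "count (replicate_mset (m - n') 0 + P + image_mset uminus P) y
        = count (replicate_mset (m - n') 0 + Q + image_mset uminus Q) y"
      using assms unfolding is_PS_def by metis
    thus ?thesis by (simp only: count_union cnt)
  qed
  have neg: "count P y = 0 \<and> count Q y = 0" if "y < 0" for y
    using assms that unfolding is_PS_def by (metis count_inI not_less)
  show "count P x = count Q x"
    using eq[of x] neg[of x] neg[of "- x"] by (cases x "0 :: real" rule: linorder_cases) auto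
qed

lemma PS_eq: "is_PS m n' A P \<Longrightarrow> PS m n' A = P"
  unfolding PS_def using is_PS_unique by blast

lemma fibre_matchings_wf:
  assumes "u \<noteq> v"
  shows "finite (fibre_matchings n {u, v})" "fibre_matchings n {u, v} \<noteq> {}"
proof -
  have "fibre_matchings n {u, v} \<subseteq> Pow (Pow ({u, v} \<times> {..<n}))"
    unfolding fibre_matchings_def by (auto simp: doubleton_eq_iff)
  thus "finite (fibre_matchings n {u, v})"
    by (rule finite_subset) auto
  let ?M = "(\<lambda>k. {(u, k), (v, k)}) ` {..<n}"
  have "?M \<in> fibre_matchings n {u, v}"
    unfolding fibre_matchings_def using assms by blast
  thus "fibre_matchings n {u, v} \<noteq> {}" by blast
qed

lemma gram_char_poly_splits:
  fixes B :: "real mat"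
  assumes B: "B \<in> carrier_mat m k"
  shows "\<exists>rs. char_poly (transpose_mat B * B) = (\<Prod>r\<leftarrow>rs. [:- r, 1:]) \<and> length rs = k
           \<and> (\<forall>r\<in>set rs. 0 \<le> r)"
proof -
  let ?c = "map_mat complex_of_real"
  let ?G = "transpose_mat B * B"
  have G: "?G \<in> carrier_mat k k" using B by simp
  have cG: "?c ?G = transpose_mat (?c B) * ?c B"
    using B by (subst of_real_hom.mat_hom_mult[of _ k m]) (auto simp: map_mat_transpose)
  obtain as where as: "char_poly (?c ?G) = (\<Prod>a\<leftarrow>as. [:- a, 1:])" "length as = k"
    using char_poly_factorized[of "?c ?G" k] G by auto
  have real: "\<exists>r\<ge>0. a = complex_of_real r" if "a \<in> set as" for a
  proof -
    have "poly (char_poly (?c ?G)) a = 0"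
      using that by (auto simp: as poly_prod_list prod_list_zero_iff)
    hence "eigenvalue (?c ?G) a"
      by (subst eigenvalue_root_char_poly[of _ k]) (use G in auto)
    then obtain v where v: "v \<in> carrier_vec k" "v \<noteq> 0\<^sub>v k" "?c ?G *\<^sub>v v = a \<cdot>\<^sub>v v"
      using G unfolding eigenvalue_def eigenvector_def by auto
    let ?w = "?c B *\<^sub>v v"
    have w: "?w \<in> carrier_vec m" using B v by auto
    have "?w \<bullet>c ?w = (transpose_mat (?c B) *\<^sub>v ?w) \<bullet>c v"
    proof -
      have cw: "conjugate ?w = ?c B *\<^sub>v conjugate v"
        using B v by (intro eq_vecI) (auto simp: scalar_prod_def conjugate_complex_def)
      show ?thesis unfolding cw
        using transpose_vec_mult_scalar[of "?c B" m k "conjugate v" ?w] B v w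
        by (metis carrier_vec_conjugate carrier_matI comm_scalar_prod map_carrier_mat mult_mat_vec_carrier transpose_carrier_mat)
    qed
    also have "transpose_mat (?c B) *\<^sub>v ?w = a \<cdot>\<^sub>v v"
      using v(3) B v(1) unfolding cG by (subst (asm) assoc_mult_mat_vec[of _ k m _ k]) auto
    also have "(a \<cdot>\<^sub>v v) \<bullet>c v = a * (v \<bullet>c v)"
      using v by simp
    finally have eq: "?w \<bullet>c ?w = a * (v \<bullet>c v)" .
    have "v \<bullet>c v > 0" using v by simp
    moreover have "?w \<bullet>c ?w \<ge> 0" by (rule conjugate_square_ge_0_vec)
    ultimately have a: "a = complex_of_real (Re (?w \<bullet>c ?w) / Re (v \<bullet>c v))"
      and "0 \<le> Re (?w \<bullet>c ?w) / Re (v \<bullet>c v)"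
      using eq by (auto simp: less_complex_def less_eq_complex_def complex_eq_iff zero_le_mult_iff)
    thus ?thesis by blast
  qed
  define rs where "rs = map Re as"
  have as_rs: "as = map complex_of_real rs" unfolding rs_def
  proof -
    have "complex_of_real (Re a) = a" if "a \<in> set as" for a
      using real[OF that] by auto
    thus "as = map complex_of_real (map Re as)" by (simp add: map_idI)
  qed
  have "poly (char_poly ?G) x = poly (\<Prod>r\<leftarrow>rs. [:- r, 1:]) x" for x
  proof -
    have "complex_of_real (poly (char_poly ?G) x) = poly (char_poly (?c ?G)) (complex_of_real x)"
      unfolding of_real_hom.char_poly_hom[OF G] by simp
    also have "\<dots> = complex_of_real (poly (\<Prod>r\<leftarrow>rs. [:- r, 1:]) x)"
      unfolding as(1) as_rs by (induction rs) (auto simp: algebra_simps)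
    finally show ?thesis by (simp only: of_real_eq_iff)
  qed
  hence "char_poly ?G = (\<Prod>r\<leftarrow>rs. [:- r, 1:])"
    by (intro poly_ext)
  moreover have "length rs = k" using as by (simp add: rs_def)
  moreover have "0 \<le> Re a" if "a \<in> set as" for a
    using real[OF that] by auto
  hence "\<forall>r\<in>set rs. 0 \<le> r" by (simp add: rs_def)
  ultimately show ?thesis by blast
qed

lemma char_poly_bipartite:
  fixes B :: "real mat"
  assumes B: "B \<in> carrier_mat m k" and km: "k \<le> m"
  defines "A \<equiv> four_block_mat (0\<^sub>m m m) B (transpose_mat B) (0\<^sub>m k k)"
  shows "poly (char_poly A) x * x ^ k = x ^ m * poly (char_poly (transpose_mat B * B)) (x ^ 2)"
proof -
  let ?M = "four_block_mat (x \<cdot>\<^sub>m 1\<^sub>m m) (- B) (- transpose_mat B) (x \<cdot>\<^sub>m 1\<^sub>m k)"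
  let ?N = "four_block_mat (1\<^sub>m m) B (0\<^sub>m k m) (x \<cdot>\<^sub>m 1\<^sub>m k)"
  let ?K = "x^2 \<cdot>\<^sub>m 1\<^sub>m k - transpose_mat B * B"
  have A: "A \<in> carrier_mat (m + k) (m + k)" unfolding A_def using B by auto
  have "poly (char_poly A) x = det ?M"
    unfolding char_poly_matrix[OF A]
    by (rule arg_cong[of _ _ det], rule eq_matI) (use B in \<open>auto simp: A_def char_matrix_def\<close>)
  moreover have "poly (char_poly (transpose_mat B * B)) (x^2) = det ?K"
    by (subst char_poly_matrix[of _ k], use B in simp, rule arg_cong[of _ _ det], rule eq_matI)
      (use B in \<open>auto simp: char_matrix_def\<close>)
  moreover have "det ?N = x ^ k"
    using B by (subst det_four_block_mat_lower_left_zero[of _ m _ k]) auto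
  moreover have "?M * ?N = four_block_mat (x \<cdot>\<^sub>m 1\<^sub>m m) (0\<^sub>m m k) (- transpose_mat B) ?K"
  proof -
    have e1: "x \<cdot>\<^sub>m 1\<^sub>m m * B + - B * (x \<cdot>\<^sub>m 1\<^sub>m k) = 0\<^sub>m m k"
      using B by (intro eq_matI) auto
    have e2: "- transpose_mat B * B + x \<cdot>\<^sub>m 1\<^sub>m k * (x \<cdot>\<^sub>m 1\<^sub>m k) = ?K"
      using B by (intro eq_matI) (auto simp: power2_eq_square)
    have e0: "x \<cdot>\<^sub>m 1\<^sub>m m * 1\<^sub>m m + - B * 0\<^sub>m k m = x \<cdot>\<^sub>m 1\<^sub>m m"
      "- transpose_mat B * 1\<^sub>m m + x \<cdot>\<^sub>m 1\<^sub>m k * 0\<^sub>m k m = - transpose_mat B"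
      using B by auto
    have "?M * ?N = four_block_mat
      (x \<cdot>\<^sub>m 1\<^sub>m m * 1\<^sub>m m + - B * 0\<^sub>m k m) (x \<cdot>\<^sub>m 1\<^sub>m m * B + - B * (x \<cdot>\<^sub>m 1\<^sub>m k))
      (- transpose_mat B * 1\<^sub>m m + x \<cdot>\<^sub>m 1\<^sub>m k * 0\<^sub>m k m)
      (- transpose_mat B * B + x \<cdot>\<^sub>m 1\<^sub>m k * (x \<cdot>\<^sub>m 1\<^sub>m k))"
      by (rule mult_four_block_mat[of _ m m _ k _ k _ _ m _ k]) (use B in auto)
    thus ?thesis unfolding e0 e1 e2 .
  qed
  moreover have "det (four_block_mat (x \<cdot>\<^sub>m 1\<^sub>m m) (0\<^sub>m m k) (- transpose_mat B) ?K) = x ^ m * det ?K"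
    using B by (subst det_four_block_mat_upper_right_zero[of _ m _ k]) auto
  moreover have "det (?M * ?N) = det ?M * det ?N"
    using B by (intro det_mult[of _ "m + k"]) auto
  ultimately show ?thesis by simp
qed

lemma PS_bipartite:
  fixes B :: "real mat"
  assumes B: "B \<in> carrier_mat m k" and km: "k \<le> m"
  defines "A \<equiv> four_block_mat (0\<^sub>m m m) B (transpose_mat B) (0\<^sub>m k k)"
  shows "is_PS m k A (image_mset sqrt (proots (char_poly (transpose_mat B * B))))"
proof -
  obtain rs where rs: "char_poly (transpose_mat B * B) = (\<Prod>r\<leftarrow>rs. [:- r, 1:])" "length rs = k"
      "\<forall>r\<in>set rs. 0 \<le> r"
    using gram_char_poly_splits[OF B] by blast
  let ?q = "(\<Prod>r\<leftarrow>rs. [:- sqrt r, 1:] * [:sqrt r, 1:]) :: real poly"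
  let ?X = "[:0, 1:] :: real poly"
  have q: "poly (char_poly (transpose_mat B * B)) (x ^ 2) = poly ?q x" for x
    using rs(3) unfolding rs(1)
    by (induction rs) (auto simp: algebra_simps power2_eq_square)
  have "char_poly A * ?X ^ k = ?X ^ m * ?q"
    using char_poly_bipartite[OF B km] unfolding q A_def[symmetric]
    by (intro poly_ext) (simp add: poly_power)
  also have "?X ^ m = ?X ^ (m - k) * ?X ^ k"
    using km by (simp flip: power_add)
  finally have cA: "char_poly A = ?X ^ (m - k) * ?q" by simp
  have X: "proots (?X ^ j) = replicate_mset j 0" for j
    by (induction j) (simp_all add: proots_mult del: mult_pCons_left mult_pCons_right)
  have q0: "(\<Prod>r\<leftarrow>rs. [:- sqrt r, 1:] * [:sqrt r, 1:] :: real poly) \<noteq> 0" for rs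
    by (induction rs) (simp_all del: mult_pCons_left mult_pCons_right)
  have pq: "proots ?q = image_mset sqrt (mset rs) + image_mset uminus (image_mset sqrt (mset rs))"
  proof (induction rs)
    case (Cons r rs)
    show ?case using Cons q0[of rs] by (simp only: list.map prod_list.Cons, subst proots_mult) (auto simp del: mult_pCons_left mult_pCons_right simp: proots_mult)
  qed auto
  have lin: "(\<Prod>r\<leftarrow>rs. [:- r, 1:] :: real poly) \<noteq> 0" for rs
    by (induction rs) (simp_all del: mult_pCons_left mult_pCons_right)
  have "proots (\<Prod>r\<leftarrow>rs. [:- r, 1:] :: real poly) = mset rs" for rs
  proof (induction rs)
    case (Cons r rs)
    show ?case using Cons lin[of rs]
      by (simp only: list.map prod_list.Cons, subst proots_mult)
        (auto simp del: mult_pCons_left mult_pCons_right)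
  qed auto
  hence G: "proots (char_poly (transpose_mat B * B)) = mset rs"
    unfolding rs(1) .
  show ?thesis
    unfolding is_PS_def G cA using rs q0
    by (subst proots_mult) (auto simp: X pq add.assoc simp del: mult_pCons_left mult_pCons_right)
qed


lemma PS_signed_adjacency_matrix:
  assumes "k \<le> m" "length us = m" "length vs = k"
    and "\<And>e. e \<in> F \<Longrightarrow> \<exists>u v. u \<in> set us \<and> v \<in> set vs \<and> e = {u, v}"
    and "set us \<inter> set vs = {}"
  shows "is_PS m k (signed_adjacency_matrix (us @ vs) F s)
           (PS m k (signed_adjacency_matrix (us @ vs) F s))"
proof -
  let ?A = "signed_adjacency_matrix (us @ vs) F s"
  define B where "B = Matrix.mat m k (\<lambda>(a, b). \<Sum>e \<in> {e \<in> F. e = {us ! a, vs ! b}}. s e)"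
  have uu: "{e \<in> F. e = {us ! a, us ! b}} = {}" if "a < m" "b < m" for a b
    using assms that by (auto simp: doubleton_eq_iff) (metis IntI doubleton_eq_iff empty_iff nth_mem)
  have vv: "{e \<in> F. e = {vs ! a, vs ! b}} = {}" if "a < k" "b < k" for a b
    using assms that by (auto simp: doubleton_eq_iff) (metis IntI doubleton_eq_iff empty_iff nth_mem)
  have uu': "(\<Sum>e \<in> {e \<in> F. e = {us ! a, us ! b}}. s e) = 0" if "a < m" "b < m" for a b
    by (subst uu[OF that]) simp
  have vv': "(\<Sum>e \<in> {e \<in> F. e = {vs ! a, vs ! b}}. s e) = 0" if "a < k" "b < k" for a b
    by (subst vv[OF that]) simp
  have "?A = four_block_mat (0\<^sub>m m m) B (transpose_mat B) (0\<^sub>m k k)"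
    unfolding signed_adjacency_matrix_def B_def using assms(2,3) uu' vv'
    by (intro eq_matI) (auto simp: nth_append insert_commute cong: conj_cong)
  hence "\<exists>P. is_PS m k ?A P"
    using PS_bipartite[of B m k] assms(1) unfolding B_def by (metis mat_carrier)
  thus ?thesis using PS_eq by metis
qed

lemma PS_random_signed_lift:
  assumes "c \<le> d" and "(F, s) \<in> set_pmf (random_signed_lift (complete_bipartite_edges d c) n)"
  defines "A \<equiv> signed_adjacency_matrix (lift_vertices (complete_bipartite_vertices d c) n) F s"
  shows "is_PS (d * n) (c * n) A (PS (d * n) (c * n) A)"
proof -
  let ?E = "complete_bipartite_edges d c"
  let ?us = "List.product (map Inl [0..<d]) [0..<n] :: ((nat + nat) \<times> nat) list"
  let ?vs = "List.product (map Inr [0..<c]) [0..<n] :: ((nat + nat) \<times> nat) list"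
  have app: "List.product (xs @ ys) zs = List.product xs zs @ List.product ys zs"
    for xs ys :: "(nat + nat) list" and zs :: "nat list"
    by (induction xs) auto
  have fin: "finite ?E"
    by (rule finite_subset[of _ "Pow (Inl ` {..<d} \<union> Inr ` {..<c})"])
      (auto simp: complete_bipartite_edges_def)
  have "F \<in> set_pmf (random_lift ?E n)"
    using assms(2) by (auto simp: random_signed_lift_def)
  then obtain M where M: "F = (\<Union>e\<in>?E. M e)"
      "M \<in> PiE_dflt ?E {} (\<lambda>e. set_pmf (pmf_of_set (fibre_matchings n e)))"
    by (auto simp: random_lift_def set_Pi_pmf[OF fin] o_def)
  have F: "\<exists>u v. u \<in> set ?us \<and> v \<in> set ?vs \<and> f = {u, v}" if fF: "f \<in> F" for f
  proof -
    obtain e where e: "e \<in> ?E" "f \<in> M e" using fF M(1) by blast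
    obtain i j where ij: "e = {Inl i, Inr j}" "i < d" "j < c"
      using e(1) by (auto simp: complete_bipartite_edges_def)
    have "M e \<in> fibre_matchings n e"
    proof -
      have "M e \<in> set_pmf (pmf_of_set (fibre_matchings n e))"
        using M(2) e(1) by (auto simp: PiE_dflt_def)
      thus ?thesis
        using fibre_matchings_wf[of "Inl i" "Inr j" n] unfolding ij(1)
        by (subst (asm) set_pmf_of_set) auto
    qed
    then obtain u v k l where uv: "f = {(u, k), (v, l)}" "e = {u, v}" "k < n" "l < n"
      using e(2) unfolding fibre_matchings_def by blast
    from uv(2) ij(1) consider "u = Inl i" "v = Inr j" | "v = Inl i" "u = Inr j"
      by (auto simp: doubleton_eq_iff)
    thus ?thesis
    proof cases
      case 1
      have "(u, k) \<in> set ?us" "(v, l) \<in> set ?vs" using 1 uv(3,4) ij(2,3) by auto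
      thus ?thesis using uv(1) by blast
    next
      case 2
      have "(v, l) \<in> set ?us" "(u, k) \<in> set ?vs" using 2 uv(3,4) ij(2,3) by auto
      moreover have "f = {(v, l), (u, k)}" using uv(1) by (simp add: insert_commute)
      ultimately show ?thesis by blast
    qed
  qed
  show ?thesis
    unfolding A_def lift_vertices_def complete_bipartite_vertices_def app
  proof (rule PS_signed_adjacency_matrix)
    show "c * n \<le> d * n" using assms(1) by simp
    show "set ?us \<inter> set ?vs = {}" by auto
    show "\<exists>u v. u \<in> set ?us \<and> v \<in> set ?vs \<and> e = {u, v}" if "e \<in> F" for e
      using that by (rule F)
  qed simp_all
qed

end

(* The nonbacktracking walks of 2k steps starting in the part of degree d form a symmetric matrix
   which is a polynomial in the squared adjacency matrix. A singular value outside the interval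
   makes an eigenvalue of this matrix grow like (sqrt ((d-1)(c-1)) (1 + eta))^k, and hence the
   trace of its 2m-th power is large. The expectation of this trace over the signs counts
   closed walks of 2m nonbacktracking segments that use no edge exactly once, so at most half of
   the steps use a new edge. With l = floor (sqrt (ln n)), k = l and m = K l, a first moment
   computation shows that in a random lift, with high probability, walks as long as three segments
   close at most one cycle and walks of the full length 4 K l^2 = O(ln n) close only boundedly many.
   Then a stretch of already used edges within a segment has polynomially many choices in l, and
   the number of walks is at most n ((d-1)(c-1))^(km) exp (O (l ln l)). For large K this is much
   smaller than ((d-1)(c-1))^(km) (1 + eta)^(2km), and Markov's inequality applies. *)

theory Submission
  imports Defs "HOL-Combinatorics.Transposition" "HOL-Real_Asymp.Real_Asymp"
begin

subsection \<open>Walks and their excess\<close>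

text \<open>Two length scales compete. To beat the factor \<open>n\<close> of the trace, the total
  length must be a large multiple of ln n, and at that length a random lift only has bounded excess.
  The count of stale stretches needs excess at most one, which is available only for lengths o(ln
  n); hence the cut into segments. Each segment costs a factor \<open>Q\<close> polynomial in the
  total length, so the number of segments must be o(ln n / ln ln n). Segments of length about sqrt
  (ln n) meet both demands.

  The choice of the starting part matters. The part of degree \<open>d\<close> is the smaller one,
  and on it the squared adjacency operator has exactly the squares of PS as its spectrum. On the
  other part it has in addition the eigenvalue 0 with multiplicity (d - c) n, which for c < d and
  small \<epsilon> lies below the interval and would spoil the trace.

  Since c and d may differ, it does not suffice that a walk makes few fresh steps: fresh steps from
  the two parts have different numbers of choices, and only their near balance gives
  ((d-1)(c-1))^(km) instead of (d-1)^(2km).\<close>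

fun edge_list :: "'v list \<Rightarrow> 'v set list" where
  "edge_list (y # x # xs) = {x, y} # edge_list (x # xs)"
| "edge_list _ = []"

abbreviation wedges :: "'v list \<Rightarrow> 'v set set" where
  "wedges h \<equiv> set (edge_list h)"

text \<open>The cyclomatic number of the graph traced by the walk, as \<open>card_wedges\<close>
  shows, in a form that can be updated step by step. Lists are read backwards in time, the head
  being the current vertex.\<close>

fun excess :: "'v list \<Rightarrow> nat" where
  "excess (y # x # xs) = excess (x # xs) +
     (if {x, y} \<notin> wedges (x # xs) \<and> y \<in> set (x # xs) then 1 else 0)"
| "excess _ = 0"

lemma wedges_subset: "e \<in> wedges h \<Longrightarrow> e \<subseteq> set h"
  by (induction h rule: edge_list.induct) auto

lemma length_edge_list: "length (edge_list h) = length h - 1"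
  by (induction h rule: edge_list.induct) auto

lemma card_wedges: "h \<noteq> [] \<Longrightarrow> card (wedges h) + 1 = card (set h) + excess h"
proof (induction h rule: edge_list.induct)
  case (1 y x xs)
  have "y \<in> set (x # xs)" if "{x, y} \<in> wedges (x # xs)"
    using wedges_subset[OF that] by blast
  with 1 show ?case by (auto simp: card_insert_if simp del: edge_list.simps(1)) (auto simp: card_insert_if insert_absorb)
qed auto

lemma edge_list_append: "edge_list (xs @ y # ys) = edge_list (xs @ [y]) @ edge_list (y # ys)"
  by (induction xs rule: edge_list.induct) auto

lemma wedges_rev: "wedges (rev h) = wedges h"
proof (induction h rule: edge_list.induct)
  case (1 y x xs)
  have "wedges (rev (y # x # xs)) = wedges (rev xs @ [x]) \<union> wedges [x, y]"
    by (simp add: edge_list_append[of "rev xs" x "[y]"])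
  with 1 show ?case by (auto simp: insert_commute)
qed auto

subsection \<open>Nonbacktracking walks in graphs with at most one cycle\<close>

fun nonbacktracking :: "'v set set \<Rightarrow> 'v list \<Rightarrow> bool" where
  "nonbacktracking F [] = False"
| "nonbacktracking F [x] = True"
| "nonbacktracking F [y, x] = ({x, y} \<in> F)"
| "nonbacktracking F (y # x # z # zs) = ({x, y} \<in> F \<and> y \<noteq> z \<and> nonbacktracking F (x # z # zs))"

lemma nonbacktracking_wedges: "nonbacktracking F h \<Longrightarrow> wedges h \<subseteq> F"
  by (induction F h rule: nonbacktracking.induct) (auto simp: insert_commute)

lemma nonbacktracking_tl: "nonbacktracking F (y # g) \<Longrightarrow> g \<noteq> [] \<Longrightarrow> nonbacktracking F g"
  by (cases "(F, y # g)" rule: nonbacktracking.cases) auto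

lemma nonbacktracking_butlast: "nonbacktracking F (g @ [a]) \<Longrightarrow> g \<noteq> [] \<Longrightarrow> nonbacktracking F g"
proof (induction F g rule: nonbacktracking.induct)
  case (3 F y x) thus ?case by simp
qed auto

lemma nonbacktracking_nth: "nonbacktracking F h \<Longrightarrow> i + 2 < length h \<Longrightarrow> h ! i \<noteq> h ! (i + 2)"
proof (induction F h arbitrary: i rule: nonbacktracking.induct)
  case (4 F y x z zs)
  thus ?case by (cases i) auto
qed auto

lemma nth_wedges: "i + 1 < length h \<Longrightarrow> {h ! i, h ! (i + 1)} \<in> wedges h"
proof (induction h arbitrary: i rule: edge_list.induct)
  case (1 y x xs)
  thus ?case by (cases i) (auto simp: insert_commute)
qed auto

lemma card_ge_2I: "finite A \<Longrightarrow> a \<in> A \<Longrightarrow> b \<in> A \<Longrightarrow> a \<noteq> b \<Longrightarrow> 2 \<le> card A"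
  by (metis One_nat_def Suc_1 Suc_leI card_le_Suc0_iff_eq linorder_not_le)

text \<open>Where at most two edges meet in each vertex, a walk that may not turn back has no choice
  left after its first step.\<close>

lemma nonbacktracking_determined:
  assumes U: "finite U" "\<And>v. v \<in> W \<Longrightarrow> card {e \<in> U. v \<in> e} \<le> 2"
  shows "nonbacktracking F g \<Longrightarrow> nonbacktracking F h \<Longrightarrow> wedges g \<subseteq> U \<Longrightarrow> wedges h \<subseteq> U \<Longrightarrow> set g \<subseteq> W \<Longrightarrow>
    length g = length h \<Longrightarrow> take 2 g = take 2 h \<Longrightarrow> g = h"
proof (induction F g arbitrary: h rule: nonbacktracking.induct)
  case (2 F x) thus ?case by (cases h) auto
next
  case (3 F y x) thus ?case by (cases h; cases "tl h") auto
next
  case (4 F y x z zs)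
  from 4 obtain z' zs' where h: "h = y # x # z' # zs'"
    by (cases h; cases "tl h"; cases "tl (tl h)") auto
  have "z = z'"
  proof (rule ccontr)
    assume "z \<noteq> z'"
    moreover have "{{x, y}, {x, z}, {x, z'}} \<subseteq> {e \<in> U. x \<in> e}"
      using 4 h by (auto simp: insert_commute)
    hence "card {{x, y}, {x, z}, {x, z'}} \<le> card {e \<in> U. x \<in> e}"
      using U by (intro card_mono) auto
    moreover have "y \<noteq> z" "y \<noteq> z'" using 4 h by auto
    hence "card {{x, y}, {x, z}, {x, z'}} = 3"
      using \<open>z \<noteq> z'\<close> by (subst card_insert_disjoint; (auto simp: doubleton_eq_iff)?)+ 
    moreover have "x \<in> W" using 4 by auto
    ultimately show False using U(2)[of x] by simp
  qed
  moreover have "x # z # zs = x # z' # zs'"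
    using "4.IH"[of "x # z' # zs'"] "4.prems" h \<open>z = z'\<close> by auto
  ultimately show ?case using h by simp
qed auto

text \<open>In a counterexample with \<open>j\<close> minimal, every vertex of the union of the three walks has degree at least
  two, as otherwise all three walks could be shortened at an end. Since the union has at most one
  independent cycle, all degrees are equal to two; then a nonbacktracking walk is determined by
  its first step, for which there are only two choices.\<close>

lemma nonbacktracking_no_three:
  fixes F :: "'v set set"
  assumes F: "\<And>e. e \<in> F \<Longrightarrow> card e = 2"
  shows "(\<And>g. wedges g \<subseteq> F \<Longrightarrow> length g \<le> 3 * j + 1 \<Longrightarrow> excess g \<le> 1) \<Longrightarrow>
    (\<And>h. h \<in> H \<Longrightarrow> nonbacktracking F h \<and> length h = j + 1 \<and> hd h = y \<and> last h = x) \<Longrightarrow>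
    card H \<noteq> 3"
proof (induction j arbitrary: H x y)
  case 0
  have "H \<subseteq> {[x]}"
  proof
    fix h assume "h \<in> H"
    hence "length h = 1" "last h = x" using 0 by (metis add_0, metis)
    thus "h \<in> {[x]}" by (cases h) auto
  qed
  hence "card H \<le> card {[x]}" by (rule card_mono[rotated]) simp
  thus ?case by simp
next
  case (Suc j)
  show ?case
  proof
    assume H3: "card H = 3"
    then obtain h1 h2 h3 where H: "H = {h1, h2, h3}" by (auto simp: card_3_iff)
    have finH: "finite H" and Hne: "H \<noteq> {}" using H by auto
    have h: "nonbacktracking F h" "length h = Suc (Suc j)" "hd h = y" "last h = x" "h \<noteq> []" "h ! 0 = y" "h ! Suc j = x"
      if "h \<in> H" for h
    proof -
      show "nonbacktracking F h" "length h = Suc (Suc j)" "hd h = y" "last h = x"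
        using Suc.prems(2)[OF that] by auto
      thus "h \<noteq> []" by auto
      thus "h ! 0 = y" "h ! Suc j = x"
        using \<open>hd h = y\<close> \<open>last h = x\<close> \<open>length h = Suc (Suc j)\<close> by (auto simp: hd_conv_nth last_conv_nth)
    qed
    have TF: "excess g \<le> 1" if "wedges g \<subseteq> F" "length g \<le> 3 * j + 1" for g
      using Suc.prems(1)[of g] that by simp
    \<comment> \<open>If the three walks agree next to \<open>y\<close>, deleting \<open>y\<close>
      from each gives a counterexample that is one step shorter. \<open>penult\<close> is the same
      argument at \<open>x\<close>.\<close>
    have second: "\<exists>h\<in>H. \<exists>h'\<in>H. h ! 1 \<noteq> h' ! 1"
    proof (rule ccontr)
      assume "\<not> ?thesis"
      then obtain z where z: "\<And>h. h \<in> H \<Longrightarrow> h ! 1 = z" using Hne by (metis all_not_in_conv)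
      have sp: "h = y # tl h" "tl h \<noteq> []" if "h \<in> H" for h
        using h[OF that] by (cases h; auto)+
      have "card (tl ` H) \<noteq> 3"
      proof (rule Suc.IH[OF TF])
        fix g assume "g \<in> tl ` H"
        then obtain h where hg: "h \<in> H" "g = tl h" by auto
        have "nonbacktracking F (y # tl h)" using h(1)[OF hg(1)] sp(1)[OF hg(1)] by simp
        hence "nonbacktracking F (tl h)" by (rule nonbacktracking_tl) (rule sp(2)[OF hg(1)])
        moreover have "hd (tl h) = z" using sp[OF hg(1)] z[OF hg(1)]
          by (metis One_nat_def hd_conv_nth nth_Cons_Suc)
        moreover have "last (tl h) = x" using sp[OF hg(1)] h(4)[OF hg(1)] by (metis last_ConsR)
        ultimately show "nonbacktracking F g \<and> length g = j + 1 \<and> hd g = z \<and> last g = x"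
          using h(2)[OF hg(1)] hg by auto
      qed
      moreover have "inj_on tl H" by (rule inj_onI) (metis sp(1))
      ultimately show False using H3 by (simp add: card_image)
    qed
    have penult: "\<exists>h\<in>H. \<exists>h'\<in>H. h ! j \<noteq> h' ! j"
    proof (rule ccontr)
      assume "\<not> ?thesis"
      then obtain z where z: "\<And>h. h \<in> H \<Longrightarrow> h ! j = z" using Hne by (metis all_not_in_conv)
      have sp: "h = butlast h @ [x]" "butlast h \<noteq> []" if "h \<in> H" for h
      proof -
        show "h = butlast h @ [x]" using h[OF that] by (metis append_butlast_last_id)
        show "butlast h \<noteq> []" using h(2)[OF that]
          by (metis One_nat_def diff_Suc_1 length_butlast list.size(3) nat.simps(3))
      qed
      have "card (butlast ` H) \<noteq> 3"
      proof (rule Suc.IH[OF TF])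
        fix g assume "g \<in> butlast ` H"
        then obtain h where hg: "h \<in> H" "g = butlast h" by auto
        have "nonbacktracking F (butlast h @ [x])" using h(1)[OF hg(1)] sp(1)[OF hg(1)] by simp
        hence "nonbacktracking F g" unfolding hg(2)
          by (rule nonbacktracking_butlast) (rule sp(2)[OF hg(1)])
        moreover have len: "length g = j + 1" using h(2)[OF hg(1)] hg by simp
        moreover have "hd g = y" using sp[OF hg(1)] h(3)[OF hg(1)] hg(2) by (metis hd_append2)
        moreover have "last g = z"
        proof -
          have "last g = g ! j" using len last_conv_nth[of g] by fastforce
          also have "\<dots> = h ! j" using len hg(2) by (simp add: nth_butlast)
          finally show ?thesis using z[OF hg(1)] by simp
        qed
        ultimately show "nonbacktracking F g \<and> length g = j + 1 \<and> hd g = y \<and> last g = z" by blast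
      qed
      moreover have "inj_on butlast H" by (rule inj_onI) (metis sp(1))
      ultimately show False using H3 by (simp add: card_image)
    qed
    define U where "U = (\<Union>h\<in>H. wedges h)"
    define W where "W = (\<Union>h\<in>H. set h)"
    have finU: "finite U" and finW: "finite W" using finH by (auto simp: U_def W_def)
    have UF: "U \<subseteq> F" using h(1) nonbacktracking_wedges by (fastforce simp: U_def)
    \<comment> \<open>A single walk through the whole union: along one walk, back along the second,
      along the third. This is the origin of the factor 3 in the length up to which excess at most
      one is required.\<close>
    define g where "g = h1 @ tl (rev h2) @ tl h3"
    have hh: "h1 \<in> H" "h2 \<in> H" "h3 \<in> H" using H by auto
    obtain a1 where a1: "h1 = a1 @ [x]" using h[OF hh(1)] by (metis append_butlast_last_id)
    obtain a2 where a2: "h2 = y # a2" using h[OF hh(2)] by (cases h2) auto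
    obtain a2' where a2': "h2 = a2' @ [x]" using h[OF hh(2)] by (metis append_butlast_last_id)
    obtain a3 where a3: "h3 = y # a3" using h[OF hh(3)] by (cases h3) auto
    have a2ne: "a2 \<noteq> []" using h(2)[OF hh(2)] a2 by auto
    have "rev h2 = x # rev a2'" by (simp add: a2')
    moreover have "rev h2 = rev a2 @ [y]" by (simp add: a2)
    ultimately have "x # rev a2' = rev a2 @ [y]" by simp
    with a2ne obtain b2 where "rev a2 = x # b2" by (cases "rev a2") auto
    hence b2: "rev h2 = x # b2 @ [y]" by (simp add: a2)
    have "set h2 = set (rev h2)" by simp
    hence sh2: "set h2 = {x, y} \<union> set b2" unfolding b2 by auto
    have g: "g = a1 @ x # b2 @ y # a3" unfolding g_def b2 by (simp add: a1 a3)
    have "edge_list g = edge_list h1 @ edge_list (rev h2) @ edge_list h3"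
      unfolding g b2 using edge_list_append[of a1 x "b2 @ y # a3"] edge_list_append[of "x # b2" y a3]
      by (simp add: a1 a3)
    hence wg: "wedges g = U" by (simp add: wedges_rev U_def H Un_assoc)
    have sg: "set g = W" using sh2 by (auto simp: g W_def H a1 a3)
    have "length g \<le> 3 * Suc j + 1" using h(2)[OF hh(1)] h(2)[OF hh(2)] h(2)[OF hh(3)]
      by (simp add: g_def)
    hence "excess g \<le> 1" using Suc.prems(1)[of g] wg UF by blast
    hence cU: "card U \<le> card W" using card_wedges[of g] wg sg g by simp
    have deg2: "2 \<le> card {e \<in> U. v \<in> e}" if "v \<in> W" for v
    proof -
      have fin: "finite {e \<in> U. v \<in> e}" using finU by auto
      obtain h0 where h0: "h0 \<in> H" "v \<in> set h0" using \<open>v \<in> W\<close> W_def by auto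
      then obtain i where i: "v = h0 ! i" "i < Suc (Suc j)" using h(2) by (metis in_set_conv_nth)
      consider "i = 0" | "i = Suc j" | "0 < i" "i < Suc j" using i by linarith
      thus ?thesis
      proof cases
        case 1
        hence v: "v = y" using i h(6) h0 by auto
        obtain h h' where hh': "h \<in> H" "h' \<in> H" "h ! 1 \<noteq> h' ! 1" using second by auto
        have "{h ! 0, h ! 1} \<in> U" "{h' ! 0, h' ! 1} \<in> U"
          using nth_wedges[of 0 h] nth_wedges[of 0 h'] h(2) hh' by (auto simp: U_def)
        thus ?thesis using h(6) hh' v
          by (intro card_ge_2I[OF fin, of "{h ! 0, h ! 1}" "{h' ! 0, h' ! 1}"]) (auto simp: doubleton_eq_iff)
      next
        case 2
        hence v: "v = x" using i h(7) h0 by auto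
        obtain h h' where hh': "h \<in> H" "h' \<in> H" "h ! j \<noteq> h' ! j" using penult by auto
        have "{h ! j, h ! (j + 1)} \<in> U" "{h' ! j, h' ! (j + 1)} \<in> U"
          using nth_wedges[of j h] nth_wedges[of j h'] h(2) hh' by (auto simp: U_def)
        thus ?thesis using h(7) hh' v
          by (intro card_ge_2I[OF fin, of "{h ! j, h ! (j+1)}" "{h' ! j, h' ! (j+1)}"]) (auto simp: doubleton_eq_iff)
      next
        case 3
        then obtain k where k: "i = Suc k" by (cases i) auto
        have "{h0 ! k, h0 ! (k + 1)} \<in> U" "{h0 ! (k + 1), h0 ! (k + 1 + 1)} \<in> U"
          using nth_wedges[of k h0] nth_wedges[of "k + 1" h0] h(2) h0 3 k by (auto simp: U_def)
        moreover have "h0 ! k \<noteq> h0 ! (k + 2)"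
          using nonbacktracking_nth[OF h(1)[OF h0(1)], of k] h(2)[OF h0(1)] 3 k by simp
        ultimately show ?thesis using i k
          by (intro card_ge_2I[OF fin, of "{h0 ! k, h0 ! (k+1)}" "{h0 ! (k+1), h0 ! (k+1+1)}"]) (auto simp: doubleton_eq_iff)
      qed
    qed
    have card2: "\<forall>e\<in>U. card {v \<in> W. v \<in> e} = 2"
    proof
      fix e assume e: "e \<in> U"
      hence "e \<subseteq> W" using wedges_subset unfolding U_def W_def by fastforce
      hence "{v \<in> W. v \<in> e} = e" by auto
      thus "card {v \<in> W. v \<in> e} = 2" using F e UF by auto
    qed
    have hs: "(\<Sum>v\<in>W. card {e \<in> U. v \<in> e}) = 2 * card U"
      by (rule sum_multicount[OF finW finU card2])
    \<comment> \<open>All degrees are at least 2, and by \<open>hs\<close> and \<open>cU\<close>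
      they add up to at most twice the number of vertices, so none can exceed 2.\<close>
    have le2: "card {e \<in> U. v \<in> e} \<le> 2" if "v \<in> W" for v
    proof (rule ccontr)
      assume "\<not> ?thesis"
      hence "(\<Sum>v\<in>W. 2) < (\<Sum>v\<in>W. card {e \<in> U. v \<in> e})"
        using deg2 that finW by (intro sum_strict_mono_ex1 bexI[of _ v]) auto
      thus False using hs cU by simp
    qed
    have yW: "y \<in> W" using h(6)[OF hh(1)] h(2)[OF hh(1)] hh unfolding W_def
      by (metis UN_I nth_mem zero_less_Suc)
    have "(\<lambda>h. {y, h ! 1}) ` H \<subseteq> {e \<in> U. y \<in> e}"
    proof
      fix e assume "e \<in> (\<lambda>h. {y, h ! 1}) ` H"
      then obtain h0 where "h0 \<in> H" "e = {h0 ! 0, h0 ! 1}" using h(6) by auto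
      thus "e \<in> {e \<in> U. y \<in> e}" using nth_wedges[of 0 h0] h(2,6) by (auto simp: U_def)
    qed
    hence "card ((\<lambda>h. {y, h ! 1}) ` H) \<le> 2"
      by (intro order.trans[OF card_mono le2[OF yW]]) (use finU in auto)
    hence "\<not> inj_on (\<lambda>h. {y, h ! 1}) H" using H3 by (intro pigeonhole) simp
    then obtain h h' where hh': "h \<in> H" "h' \<in> H" "h \<noteq> h'" "h ! 1 = h' ! 1"
      unfolding inj_on_def by (auto simp: doubleton_eq_iff)
    have tk: "take 2 k = [y, k ! 1]" if "k \<in> H" for k
      using h(2,6)[OF that] by (cases k; cases "tl k") auto
    have "h = h'"
    proof (rule nonbacktracking_determined[OF finU le2, of W F])
      show "nonbacktracking F h" "nonbacktracking F h'" "length h = length h'" using h(1,2) hh'(1,2)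
        by simp_all
      show "take 2 h = take 2 h'" using tk[OF hh'(1)] tk[OF hh'(2)] hh'(4) by simp
      show "wedges h \<subseteq> U" "wedges h' \<subseteq> U" "set h \<subseteq> W" using hh'(1,2) by (auto simp: U_def W_def)
    qed
    with hh' show False by simp
  qed
qed

lemma card_nonbacktracking_le_2:
  fixes F :: "'v set set"
  assumes F: "\<And>e. e \<in> F \<Longrightarrow> card e = 2"
    and "\<And>g. wedges g \<subseteq> F \<Longrightarrow> length g \<le> 3 * j + 1 \<Longrightarrow> excess g \<le> 1"
  shows "card {h. nonbacktracking F h \<and> length h = j + 1 \<and> hd h = y \<and> last h = x} \<le> 2" (is "card ?A \<le> 2")
proof (rule ccontr)
  assume "\<not> ?thesis"
  hence "3 \<le> card ?A" by simp
  then obtain H where "H \<subseteq> ?A" "card H = 3" by (rule obtain_subset_with_card_n)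
  have "card H \<noteq> 3"
    by (rule nonbacktracking_no_three[OF assms, where y = y and x = x]) (use \<open>H \<subseteq> ?A\<close> in auto)
  with \<open>card H = 3\<close> show False by simp
qed

subsection \<open>Weighted extensions of segmented walks\<close>

locale biregular =
  fixes F :: "'v set set" and R L :: "'v set" and c d :: nat
  assumes finR: "finite R" and finL: "finite L" and RL: "R \<inter> L = {}"
    and F_cases: "\<And>e. e \<in> F \<Longrightarrow> \<exists>x\<in>R. \<exists>y\<in>L. e = {x, y}"
    and degR: "\<And>x. x \<in> R \<Longrightarrow> card {y. {x, y} \<in> F} = d"
    and degL: "\<And>x. x \<in> L \<Longrightarrow> card {y. {x, y} \<in> F} = c"
    and cd: "2 \<le> c" "c \<le> d"
begin

definition N :: "'v \<Rightarrow> 'v set" where "N x = {y. {x, y} \<in> F}"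

text \<open>The number of ways in which a nonbacktracking walk can be continued at \<open>x\<close>.
  Being total, it is at least 1 everywhere and can always be divided by.\<close>

definition r :: "'v \<Rightarrow> real" where "r x = (if x \<in> R then real d - 1 else real c - 1)"

lemma N_sym: "y \<in> N x \<longleftrightarrow> x \<in> N y"
  by (simp add: N_def insert_commute)

lemma F_card: "e \<in> F \<Longrightarrow> card e = 2"
proof -
  assume "e \<in> F"
  then obtain x y where "x \<in> R" "y \<in> L" "e = {x, y}" using F_cases by blast
  moreover from this have "x \<noteq> y" using RL by blast
  ultimately show ?thesis by simp
qed

lemma N_side: "y \<in> N x \<Longrightarrow> (x \<in> R \<and> y \<in> L \<and> y \<notin> R) \<or> (x \<in> L \<and> x \<notin> R \<and> y \<in> R)"
  using F_cases[of "{x, y}"] RL unfolding N_def by (auto simp: doubleton_eq_iff)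

lemma N_RL: "N x \<subseteq> R \<union> L"
  using N_side by blast

lemma finite_N [simp]: "finite (N x)"
  by (rule finite_subset[OF N_RL]) (auto simp: finR finL)

lemma finF: "finite F"
proof (rule finite_subset)
  show "F \<subseteq> Pow (R \<union> L)" using F_cases by blast
qed (auto simp: finR finL)

lemma card_N: "x \<in> R \<union> L \<Longrightarrow> real (card (N x)) = r x + 1"
  using degR degL unfolding N_def r_def by auto

lemma r_ge_1: "1 \<le> r x"
  using cd by (auto simp: r_def)

lemma card_N_le: "real (card (N x)) \<le> r x + 1"
proof (cases "x \<in> R \<union> L")
  case False
  hence "N x = {}" using N_side by blast
  thus ?thesis using r_ge_1[of x] by simp
qed (simp add: card_N)

end

text \<open>A history lists the vertices of a walk of at most \<open>T\<close> steps, the current one first. A walk may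
  backtrack only at the times divisible by \<open>per\<close>. A step along an edge that has not been used
  before carries the inverse of the number of choices, with a penalty \<open>\<theta>\<close> when it closes a cycle.\<close>

locale segmented_walks = biregular F R L c d for F :: "'v set set" and R L c d +
  fixes per T :: nat
  assumes per: "0 < per" "per dvd T"
    and tangle_free: "\<And>g. wedges g \<subseteq> F \<Longrightarrow> length g \<le> 3 * per + 1 \<Longrightarrow> excess g \<le> 1"
begin

text \<open>\<open>h ! 1\<close> is the previous vertex. At the start of the walk it does not exist,
  but then \<open>length h - 1\<close> is 0, a multiple of \<open>per\<close>, and the first
  alternative applies.\<close>

definition allowed :: "'v list \<Rightarrow> 'v set" where
  "allowed h = {y \<in> N (hd h). per dvd (length h - 1) \<or> y \<noteq> h ! 1}"

text \<open>The price of one stale stretch: at most \<open>per + 1\<close> lengths, at most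
  \<open>T + 1\<close> end points and two walks to each; the remaining factor 2 is for the fresh
  step that follows, which at a segment boundary can have \<open>r + 1 <= 2 * r\<close> choices of
  weight \<open>1 / r\<close>.\<close>

definition Q :: real where "Q = 4 * real (per + 1) * real (T + 1)"

definition \<theta> :: real where "\<theta> = 1 / Q"

definition step_weight :: "'v list \<Rightarrow> 'v \<Rightarrow> real" where
  "step_weight h y = (if {hd h, y} \<in> wedges h then 1 else (if y \<in> set h then \<theta> else 1) / r (hd h))"

fun ext_weight :: "nat \<Rightarrow> 'v list \<Rightarrow> real" where
  "ext_weight 0 h = 1"
| "ext_weight (Suc s) h = (\<Sum>y\<in>allowed h. step_weight h y * ext_weight s (y # h))"

fun stale_exts :: "nat \<Rightarrow> 'v list \<Rightarrow> 'v list set" where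
  "stale_exts 0 h = {h}"
| "stale_exts (Suc i) h = (\<Union>g\<in>stale_exts i h. (\<lambda>y. y # g) ` {y \<in> allowed g. {hd g, y} \<in> wedges g})"

lemma finite_allowed [simp]: "finite (allowed h)"
  by (rule finite_subset[of _ "N (hd h)"]) (auto simp: allowed_def)

lemma Q_ge: "4 \<le> Q"
proof -
  have "4 * (1::real) * 1 \<le> 4 * real (per + 1) * real (T + 1)" by (intro mult_mono) auto
  thus ?thesis by (simp add: Q_def)
qed

lemma theta: "0 < \<theta>" "\<theta> * Q = 1"
  using Q_ge by (auto simp: \<theta>_def)

lemma step_weight_nonneg: "0 \<le> step_weight h y"
  using theta r_ge_1[of "hd h"] by (auto simp: step_weight_def)

text \<open>Unfolds at the first step instead of the last, to match the recursion of
  \<open>ext_weight\<close>.\<close>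

lemma stale_exts_Suc': "stale_exts (Suc i) h = (\<Union>y\<in>{y \<in> allowed h. {hd h, y} \<in> wedges h}. stale_exts i (y # h))"
proof (induction i)
  case (Suc i)
  show ?case by (subst stale_exts.simps(2), subst Suc) auto
qed auto

lemma finite_stale_exts: "finite (stale_exts i h)"
  by (induction i) auto

lemma stale_exts_drop: "g \<in> stale_exts i h \<Longrightarrow> drop i g = h \<and> length g = i + length h"
  by (induction i arbitrary: g) auto

lemma card_stale_exts_Suc: "card (stale_exts (Suc i) h) = (\<Sum>y\<in>{y \<in> allowed h. {hd h, y} \<in> wedges h}. card (stale_exts i (y # h)))"
  unfolding stale_exts_Suc'
proof (rule card_UN_disjoint)
  show "\<forall>y\<in>{y \<in> allowed h. {hd h, y} \<in> wedges h}. \<forall>z\<in>{y \<in> allowed h. {hd h, y} \<in> wedges h}.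
     y \<noteq> z \<longrightarrow> stale_exts i (y # h) \<inter> stale_exts i (z # h) = {}"
    using stale_exts_drop by (metis disjoint_iff list.inject)
qed (auto simp: finite_stale_exts)

lemma stale_exts_wedges: "h \<noteq> [] \<Longrightarrow> g \<in> stale_exts i h \<Longrightarrow> g \<noteq> [] \<and> wedges g = wedges h \<and> hd g \<in> set h"
proof (induction i arbitrary: g)
  case (Suc i)
  then obtain g' y where g: "g = y # g'" "g' \<in> stale_exts i h" "{hd g', y} \<in> wedges g'" by auto
  with Suc have "g' \<noteq> []" "wedges g' = wedges h" by auto
  moreover have "y \<in> set h" using wedges_subset[OF g(3)[unfolded \<open>wedges g' = wedges h\<close>]] by auto
  ultimately show ?case using g by (cases g') auto
qed auto

lemma stale_exts_nonbacktracking: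
  "h \<noteq> [] \<Longrightarrow> g \<in> stale_exts i h \<Longrightarrow> (\<And>k. 0 < k \<Longrightarrow> k < i \<Longrightarrow> \<not> per dvd (length h - 1 + k)) \<Longrightarrow>
   nonbacktracking F (take (Suc i) g) \<and> last (take (Suc i) g) = hd h"
proof (induction i arbitrary: g)
  case 0
  thus ?case by (cases h) auto
next
  case (Suc i)
  from Suc.prems obtain g' y where g: "g = y # g'" "g' \<in> stale_exts i h" "y \<in> allowed g'" by auto
  have len: "length g' = i + length h" using stale_exts_drop[OF g(2)] by simp
  have IH: "nonbacktracking F (take (Suc i) g') \<and> last (take (Suc i) g') = hd h"
    by (rule Suc.IH) (use Suc.prems g in auto)
  have yN: "{hd g', y} \<in> F" using g(3) by (auto simp: allowed_def N_def)
  show ?case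
  proof (cases i)
    case 0
    then show ?thesis using IH g yN Suc.prems(1) by (cases h) auto
  next
    case (Suc k)
    obtain a b t where abt: "g' = a # b # t"
      using len Suc Suc.prems(1) by (cases g'; cases "tl g'"; cases h) auto
    have "\<not> per dvd (length h - 1 + i)" using Suc.prems(3)[of i] Suc by auto
    moreover have "length g' - 1 = length h - 1 + i" using len Suc.prems(1) by (cases h) auto
    ultimately have "y \<noteq> b" using g(3) abt by (auto simp: allowed_def)
    thus ?thesis using IH yN g(1) abt Suc by auto
  qed
qed

text \<open>A stale stretch stays in the graph already traced, so it ends at an old vertex, and
  between two given end points there are at most two nonbacktracking walks. The third assumption
  keeps segment boundaries, where backtracking is allowed, out of the interior of the
  stretch.\<close>

lemma card_stale_exts:
  assumes h: "h \<noteq> []" and iper: "i \<le> per"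
    and "\<And>k. 0 < k \<Longrightarrow> k < i \<Longrightarrow> \<not> per dvd (length h - 1 + k)"
  shows "card (stale_exts i h) \<le> 2 * card (set h)"
proof -
  let ?A = "\<lambda>y. {g. nonbacktracking F g \<and> length g = i + 1 \<and> hd g = y \<and> last g = hd h}"
  have sub: "take (Suc i) ` stale_exts i h \<subseteq> (\<Union>y\<in>set h. ?A y)"
  proof
    fix t assume "t \<in> take (Suc i) ` stale_exts i h"
    then obtain g where g: "g \<in> stale_exts i h" "t = take (Suc i) g" by auto
    have "length t = i + 1" "hd t = hd g" using g stale_exts_drop[OF g(1)] h by (cases h; auto)+
    moreover have "hd g \<in> set h" using stale_exts_wedges[OF h g(1)] by auto
    ultimately show "t \<in> (\<Union>y\<in>set h. ?A y)" using stale_exts_nonbacktracking[OF h g(1) assms(3)] g by auto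
  qed
  have fin: "finite (?A y)" for y
  proof (rule finite_subset)
    show "?A y \<subseteq> {g. set g \<subseteq> insert y (R \<union> L) \<and> length g = i + 1}"
    proof (intro subsetI CollectI conjI)
      fix g z assume "g \<in> ?A y" and z: "z \<in> set g"
      hence g: "nonbacktracking F g" "y = hd g" by auto
      obtain k where k: "z = g ! k" "k < length g" using z by (metis in_set_conv_nth)
      show "z \<in> insert y (R \<union> L)"
      proof (cases k)
        case 0 thus ?thesis using k g by (cases g) auto
      next
        case (Suc k')
        hence "{g ! k', z} \<in> F" using nth_wedges[of k' g] k nonbacktracking_wedges[OF g(1)] by auto
        hence "z \<in> R \<union> L" using N_RL by (auto simp: N_def)
        thus ?thesis by blast
      qed
    qed auto
    show "finite {g. set g \<subseteq> insert y (R \<union> L) \<and> length g = i + 1}"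
      by (rule finite_lists_length_eq) (auto simp: finR finL)
  qed
  have inj: "inj_on (take (Suc i)) (stale_exts i h)"
  proof (rule inj_onI)
    fix g g' assume "g \<in> stale_exts i h" "g' \<in> stale_exts i h" "take (Suc i) g = take (Suc i) g'"
    moreover from this have "take i g = take i g'" by (metis le_SucI min.absorb1 order_refl take_take)
    ultimately show "g = g'" using stale_exts_drop by (metis append_take_drop_id)
  qed
  have "card (stale_exts i h) = card (take (Suc i) ` stale_exts i h)" using inj by (simp add: card_image)
  also have "\<dots> \<le> card (\<Union>y\<in>set h. ?A y)" by (rule card_mono[OF _ sub]) (use fin in auto)
  also have "\<dots> \<le> (\<Sum>y\<in>set h. card (?A y))" by (rule card_UN_le) auto
  also have "\<dots> \<le> (\<Sum>y\<in>set h. 2)"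
    by (intro sum_mono card_nonbacktracking_le_2 F_card tangle_free) (use iper in auto)
  finally show ?thesis by simp
qed

section \<open>The inductive bound on the total weight of all extensions\<close>

definition history_at :: "nat \<Rightarrow> 'v list \<Rightarrow> bool" where
  "history_at s h \<longleftrightarrow> h \<noteq> [] \<and> wedges h \<subseteq> F \<and> length h + s = T + 1"

text \<open>A segment costs a factor \<open>Q\<close>, paid for the choice of its stale initial stretch. Once a segment has
  reached a new vertex, nonbacktracking forces fresh steps until a cycle is closed, and then
  the penalty \<open>\<theta> = 1 / Q\<close> pays for another stale stretch.\<close>

definition general_bound :: "nat \<Rightarrow> bool" where
  "general_bound s \<longleftrightarrow> (\<forall>h. history_at s h \<longrightarrow> ext_weight s h \<le> Q ^ ((s + per - 1) div per))"

definition new_bound :: "nat \<Rightarrow> bool" where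
  "new_bound s \<longleftrightarrow> (\<forall>h. history_at s h \<longrightarrow> 2 \<le> length h \<longrightarrow> hd h \<notin> set (tl h) \<longrightarrow> ext_weight s h \<le> Q ^ (s div per))"

lemma history_at_Cons: "history_at (Suc s) h \<Longrightarrow> y \<in> allowed h \<Longrightarrow> history_at s (y # h)"
  by (cases h) (auto simp: history_at_def allowed_def N_def)

lemma ceil_div_le: "(s + per - 1) div per \<le> s div per + 1"
proof -
  have "(s + per - 1) div per \<le> (s + per) div per" by (rule div_le_mono) simp
  thus ?thesis using per by simp
qed

text \<open>Both outcomes of a fresh step lead to the rounded-down exponent: at a new vertex this is
  \<open>new_bound\<close>, and on closing a cycle the general bound has at most one more factor
  \<open>Q\<close>, which \<theta> cancels.\<close>

lemma fresh_term:
  assumes "general_bound s" "new_bound s" "history_at (Suc s) h" "y \<in> allowed h" "{hd h, y} \<notin> wedges h"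
  shows "step_weight h y * ext_weight s (y # h) \<le> Q ^ (s div per) / r (hd h)"
proof -
  have ok: "history_at s (y # h)" using history_at_Cons assms by blast
  have r: "0 < r (hd h)" using r_ge_1[of "hd h"] by simp
  show ?thesis
  proof (cases "y \<in> set h")
    case True
    have "ext_weight s (y # h) \<le> Q ^ ((s + per - 1) div per)" using assms(1) ok
      unfolding general_bound_def by blast
    also have "\<dots> \<le> Q ^ (s div per + 1)" using Q_ge by (intro power_increasing ceil_div_le) auto
    finally have "ext_weight s (y # h) \<le> Q ^ (s div per) * Q" by (simp add: mult.commute)
    hence "\<theta> * ext_weight s (y # h) \<le> \<theta> * (Q ^ (s div per) * Q)" using theta
      by (intro mult_left_mono) auto
    also have "\<dots> = Q ^ (s div per)" using theta(2) by (simp add: mult_ac)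
    finally have "\<theta> * ext_weight s (y # h) \<le> Q ^ (s div per)" .
    thus ?thesis using True assms(5) r by (simp add: step_weight_def divide_right_mono)
  next
    case False
    hence "ext_weight s (y # h) \<le> Q ^ (s div per)" using assms(2,3) ok
      unfolding new_bound_def history_at_def by (cases h) auto
    thus ?thesis using False assms(5) r by (simp add: step_weight_def divide_right_mono)
  qed
qed

lemma fresh_sum:
  assumes "general_bound s" "new_bound s" "history_at (Suc s) h"
  shows "(\<Sum>y\<in>{y \<in> allowed h. {hd h, y} \<notin> wedges h}. step_weight h y * ext_weight s (y # h)) \<le> 2 * Q ^ (s div per)"
proof -
  let ?A = "{y \<in> allowed h. {hd h, y} \<notin> wedges h}"
  have r: "1 \<le> r (hd h)" by (rule r_ge_1)
  have "card ?A \<le> card (N (hd h))" by (rule card_mono) (auto simp: allowed_def)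
  hence "real (card ?A) \<le> 2 * r (hd h)" using card_N_le[of "hd h"] r by linarith
  hence A: "real (card ?A) / r (hd h) \<le> 2" using r by (simp add: divide_simps)
  have "(\<Sum>y\<in>?A. step_weight h y * ext_weight s (y # h)) \<le> (\<Sum>y\<in>?A. Q ^ (s div per) / r (hd h))"
    by (rule sum_mono) (use fresh_term[OF assms] in auto)
  also have "\<dots> = real (card ?A) / r (hd h) * Q ^ (s div per)" by simp
  also have "\<dots> \<le> 2 * Q ^ (s div per)" using A Q_ge by (intro mult_right_mono) auto
  finally show ?thesis .
qed

text \<open>Sorts the extensions by the length \<open>i\<close> of their initial stale stretch. The
  stretch either ends with a fresh step, after which everything together is worth at most
  \<open>2 * Q ^ a\<close> by \<open>fresh_sum\<close>, or it fills the rest of the segment and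
  leaves \<open>a\<close> full segments, worth \<open>Q\<close> each.\<close>

lemma stale_decomp:
  assumes IH: "\<And>s. s < a * per + J \<Longrightarrow> general_bound s \<and> new_bound s" and J: "0 < J" "J \<le> per"
  shows "j \<le> J \<Longrightarrow> history_at (a * per + j) h \<Longrightarrow> ext_weight (a * per + j) h \<le> 2 * Q ^ a * (\<Sum>i\<le>j. real (card (stale_exts i h)))"
proof (induction j arbitrary: h)
  case 0
  have "a * per + per - 1 = (per - 1) + a * per" using per by simp
  also have "\<dots> div per = a" using per by (subst div_mult_self1) auto
  finally have "(a * per + per - 1) div per = a" .
  hence "ext_weight (a * per) h \<le> Q ^ a" using IH[of "a * per"] J 0 unfolding general_bound_def by force
  moreover have "0 \<le> Q ^ a" using Q_ge by simp
  ultimately show ?case by simp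
next
  case (Suc j)
  let ?s = "a * per + j"
  let ?A = "{y \<in> allowed h. {hd h, y} \<in> wedges h}" and ?B = "{y \<in> allowed h. {hd h, y} \<notin> wedges h}"
  have gn: "general_bound ?s" "new_bound ?s" using IH[of ?s] Suc.prems by auto
  have dv: "?s div per = a" using Suc.prems J per by simp
  have ok: "history_at (Suc ?s) h" using Suc.prems by simp
  have split: "allowed h = ?A \<union> ?B" by auto
  have "ext_weight (Suc ?s) h = (\<Sum>y\<in>?A. step_weight h y * ext_weight ?s (y # h)) + (\<Sum>y\<in>?B. step_weight h y * ext_weight ?s (y # h))"
    unfolding ext_weight.simps by (subst split, rule sum.union_disjoint) auto
  also have "(\<Sum>y\<in>?B. step_weight h y * ext_weight ?s (y # h)) \<le> 2 * Q ^ a"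
    using fresh_sum[OF gn ok] dv by simp
  also have "(\<Sum>y\<in>?A. step_weight h y * ext_weight ?s (y # h)) \<le> (\<Sum>y\<in>?A. 2 * Q ^ a * (\<Sum>i\<le>j. real (card (stale_exts i (y # h)))))"
  proof (rule sum_mono)
    fix y assume y: "y \<in> ?A"
    hence "history_at ?s (y # h)" using history_at_Cons[OF ok] by auto
    thus "step_weight h y * ext_weight ?s (y # h) \<le> 2 * Q ^ a * (\<Sum>i\<le>j. real (card (stale_exts i (y # h))))"
      using Suc.IH[of "y # h"] Suc.prems y by (simp add: step_weight_def)
  qed
  also have "\<dots> = 2 * Q ^ a * (\<Sum>i\<le>j. \<Sum>y\<in>?A. real (card (stale_exts i (y # h))))"
    unfolding sum_distrib_left[symmetric] by (subst sum.swap) simp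
  also have "\<dots> = 2 * Q ^ a * (\<Sum>i\<le>j. real (card (stale_exts (Suc i) h)))"
    unfolding card_stale_exts_Suc by simp
  also have "2 * Q ^ a * (\<Sum>i\<le>j. real (card (stale_exts (Suc i) h))) + 2 * Q ^ a
      = 2 * Q ^ a * (\<Sum>i\<le>Suc j. real (card (stale_exts i h)))"
    by (subst sum.atMost_Suc_shift) (simp add: algebra_simps)
  finally show ?case by simp
qed

lemma bounds: "general_bound s \<and> new_bound s"
proof (induction s rule: less_induct)
  case (less s)
  show ?case
  proof (cases "s = 0")
    case True
    have "Q ^ n \<ge> 1" for n using Q_ge by (simp add: one_le_power)
    thus ?thesis using True by (simp add: general_bound_def new_bound_def)
  next
    case False
    \<comment> \<open>The shift makes the remainder \<open>J\<close> run through 1, ...,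
      \<open>per\<close>: at a boundary a whole segment lies ahead, not an empty one, and the
      rounded-up quotient of \<open>s\<close> by \<open>per\<close> is always
      \<open>a + 1\<close>.\<close>
    define a where "a = (s - 1) div per"
    define J where "J = (s - 1) mod per + 1"
    have s: "s = a * per + J" using False by (simp add: a_def J_def)
    have J: "0 < J" "J \<le> per" using per by (auto simp: J_def Suc_leI)
    have ceil: "(s + per - 1) div per = a + 1"
    proof -
      have "s + per - 1 = (s - 1) + per" using False by simp
      also have "\<dots> div per = a + 1" unfolding a_def using per by (subst div_add_self2) auto
      finally show ?thesis .
    qed
    have G: "ext_weight s h \<le> Q ^ (a + 1)" if ok: "history_at s h" for h
    proof -
      have h: "h \<noteq> []" "length h + s = T + 1" using ok by (auto simp: history_at_def)
      have st_le: "real (card (stale_exts i h)) \<le> 2 * real (T + 1)" if i: "i \<le> J" for i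
      proof -
        have "card (stale_exts i h) \<le> 2 * card (set h)"
        proof (rule card_stale_exts[OF h(1)])
          fix k assume k: "0 < k" "k < i"
          \<comment> \<open>As \<open>per\<close> divides \<open>T\<close>, boundaries can be
            recognised by the number of steps that remain. Here this number is \<open>J - k\<close>
            modulo \<open>per\<close>, strictly between 0 and \<open>per\<close>.\<close>
          show "\<not> per dvd (length h - 1 + k)"
          proof
            assume "per dvd (length h - 1 + k)"
            moreover have "length h - 1 + k = T - (a * per + (J - k))" using h s k i by (cases h) auto
            moreover have "a * per + (J - k) \<le> T" using h s k i by (cases h) auto
            ultimately have "per dvd (a * per + (J - k))"
              using per(2) by (metis dvd_diffD1)
            hence "per dvd (J - k)" by (simp add: dvd_add_right_iff)
            moreover have "0 < J - k" "J - k < per" using k i J by auto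
            ultimately show False by (simp add: nat_dvd_not_less)
          qed
        qed (use i J in auto)
        also have "card (set h) \<le> T + 1" using h card_length[of h] by simp
        finally show ?thesis by simp
      qed
      have "ext_weight s h \<le> 2 * Q ^ a * (\<Sum>i\<le>J. real (card (stale_exts i h)))"
        using stale_decomp[of a J J h] less J ok s by auto
      also have "\<dots> \<le> 2 * Q ^ a * (\<Sum>i\<le>J. 2 * real (T + 1))"
        using Q_ge by (intro mult_left_mono sum_mono st_le) auto
      also have "\<dots> = Q ^ a * (4 * real (J + 1) * real (T + 1))" by (simp add: algebra_simps)
      also have "\<dots> \<le> Q ^ a * Q"
        using J Q_ge by (intro mult_left_mono) (auto simp: Q_def intro!: mult_right_mono)
      finally show ?thesis by (simp add: mult.commute)
    qed
    have "general_bound s" using G unfolding general_bound_def ceil by blast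
    moreover have "new_bound s" unfolding new_bound_def
    proof (intro allI impI)
      fix h assume ok: "history_at s h" and len: "2 \<le> length h" and new: "hd h \<notin> set (tl h)"
      show "ext_weight s h \<le> Q ^ (s div per)"
      proof (cases "J = per")
        case True
        hence "s div per = a + 1" using s per by simp
        thus ?thesis using G[OF ok] by simp
      next
        case False
        hence "J < per" using J by simp
        have dv: "s div per = a" by (subst s) (use \<open>J < per\<close> in simp)
        have dv': "(s - 1) div per = a" by (simp add: a_def)
        obtain x z zs where h: "h = x # z # zs" using len by (cases h; cases "tl h") auto
        have nd: "\<not> per dvd (length h - 1)"
        proof
          assume "per dvd (length h - 1)"
          moreover have "length h - 1 = T - s" "s \<le> T" using ok h by (auto simp: history_at_def)
          ultimately have "per dvd s" using per(2) by (metis dvd_diffD1)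
          hence "per dvd J" using s by (simp add: dvd_add_right_iff)
          thus False using J False by (simp add: nat_dvd_not_less)
        qed
        obtain s' where s': "s = Suc s'" using \<open>s \<noteq> 0\<close> by (cases s) auto
        have zN: "z \<in> N x" using ok h by (auto simp: history_at_def N_def insert_commute)
        \<comment> \<open>A vertex that has just been reached for the first time has only one used
          edge, the one by which it was entered, and inside a segment this edge may not be taken
          back. So all steps are fresh, and there are at most \<open>r x\<close> of them, which
          their weights compensate exactly.\<close>
        have fresh: "{hd h, y} \<notin> wedges h" if "y \<in> allowed h" for y
        proof
          assume e: "{hd h, y} \<in> wedges h"
          have "y \<noteq> z" using that nd h by (auto simp: allowed_def)
          hence "{x, y} \<in> wedges (z # zs)" using e h by (auto simp: doubleton_eq_iff)
          hence "{x, y} \<subseteq> set (z # zs)" by (rule wedges_subset)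
          thus False using new h by auto
        qed
        have A: "allowed h \<subseteq> N x - {z}" using nd h by (auto simp: allowed_def)
        have "card (allowed h) \<le> card (N x - {z})" by (rule card_mono[OF _ A]) simp
        also have "\<dots> = card (N x) - 1" using zN by simp
        finally have "card (allowed h) \<le> card (N x) - 1" .
        moreover have "card (N x) \<ge> 1" using zN
          by (metis One_nat_def Suc_leI card_gt_0_iff empty_iff finite_N)
        ultimately have cA: "real (card (allowed h)) \<le> r x" using card_N_le[of x] by linarith
        have "ext_weight s h \<le> (\<Sum>y\<in>allowed h. Q ^ a / r x)"
          unfolding s' ext_weight.simps
        proof (rule sum_mono)
          fix y assume y: "y \<in> allowed h"
          have "general_bound s'" "new_bound s'" using less[of s'] s' by auto
          from fresh_term[OF this _ y fresh[OF y]] ok s' dv' h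
          show "step_weight h y * ext_weight s' (y # h) \<le> Q ^ a / r x" by simp
        qed
        also have "\<dots> = real (card (allowed h)) / r x * Q ^ a" by simp
        also have "\<dots> \<le> 1 * Q ^ a"
          using cA r_ge_1[of x] Q_ge by (intro mult_right_mono) (auto simp: divide_simps)
        finally show ?thesis using dv by simp
      qed
    qed
    ultimately show ?thesis by blast
  qed
qed

lemma ext_weight_bound: "ext_weight T [v] \<le> Q ^ (T div per)"
proof -
  obtain k where k: "T = per * k" using per(2) by (auto elim: dvdE)
  have "(T + per - 1) div per \<le> T div per"
  proof -
    have "T + per - 1 = (per - 1) + per * k" using k per by simp
    also have "\<dots> div per = k" using per by (subst div_mult_self2) auto
    finally show ?thesis using k per by simp
  qed
  moreover have "ext_weight T [v] \<le> Q ^ ((T + per - 1) div per)"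
    using bounds[of T] unfolding general_bound_def history_at_def by simp
  moreover have "Q ^ ((T + per - 1) div per) \<le> Q ^ (T div per)"
    using Q_ge calculation(1) by (intro power_increasing) auto
  ultimately show ?thesis by linarith
qed

end

subsection \<open>Counting walks without singly covered edges\<close>

context segmented_walks
begin

fun exts :: "nat \<Rightarrow> 'v list \<Rightarrow> 'v list set" where
  "exts 0 h = {h}"
| "exts (Suc s) h = (\<Union>y\<in>allowed h. exts s (y # h))"

fun walk_weight :: "'v list \<Rightarrow> real" where
  "walk_weight (y # x # xs) = step_weight (x # xs) y * walk_weight (x # xs)"
| "walk_weight _ = 1"

inductive hike :: "'v list \<Rightarrow> bool" where
  hike_start: "v \<in> R \<Longrightarrow> hike [v]"
| hike_step: "hike g \<Longrightarrow> y \<in> allowed g \<Longrightarrow> hike (y # g)"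

fun nfresh :: "('v \<Rightarrow> bool) \<Rightarrow> 'v list \<Rightarrow> nat" where
  "nfresh P (y # x # xs) = nfresh P (x # xs) + (if {x, y} \<notin> wedges (x # xs) \<and> P x then 1 else 0)"
| "nfresh P _ = 0"

lemma finite_exts [simp]: "finite (exts s h)"
  by (induction s arbitrary: h) auto

lemma exts_drop: "g \<in> exts s h \<Longrightarrow> drop s g = h \<and> length g = s + length h"
proof (induction s arbitrary: h)
  case (Suc s)
  then obtain y where "g \<in> exts s (y # h)" by auto
  from Suc.IH[OF this] show ?case by (metis add_Suc_shift drop_Suc drop_tl length_Cons list.sel(3))
qed auto

lemma sum_exts_Suc: "(\<Sum>g\<in>exts (Suc s) h. \<phi> g) = (\<Sum>y\<in>allowed h. \<Sum>g\<in>exts s (y # h). \<phi> g)"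
  unfolding exts.simps
proof (rule sum.UNION_disjoint)
  show "\<forall>y\<in>allowed h. \<forall>z\<in>allowed h. y \<noteq> z \<longrightarrow> exts s (y # h) \<inter> exts s (z # h) = {}"
    using exts_drop by (metis disjoint_iff list.inject)
qed auto

lemma exts_hike: "hike h \<Longrightarrow> g \<in> exts s h \<Longrightarrow> hike g"
  by (induction s arbitrary: h) (auto intro: hike_step)

lemma sum_walk_weight: "h \<noteq> [] \<Longrightarrow> (\<Sum>g\<in>exts s h. walk_weight g) = walk_weight h * ext_weight s h"
proof (induction s arbitrary: h)
  case (Suc s)
  have "(\<Sum>g\<in>exts (Suc s) h. walk_weight g) = (\<Sum>y\<in>allowed h. walk_weight (y # h) * ext_weight s (y # h))"
    unfolding sum_exts_Suc using Suc by simp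
  also have "\<dots> = (\<Sum>y\<in>allowed h. walk_weight h * (step_weight h y * ext_weight s (y # h)))"
    using Suc.prems by (cases h) (auto simp: mult_ac)
  finally show ?case by (simp add: sum_distrib_left)
qed auto

lemma hike_ne: "hike g \<Longrightarrow> g \<noteq> []"
  by (induction rule: hike.induct) auto

lemma hike_F: "hike g \<Longrightarrow> wedges g \<subseteq> F"
proof (induction rule: hike.induct)
  case (hike_step g y)
  thus ?case by (cases g) (auto simp: allowed_def N_def)
qed auto

lemma hike_parity: "hike g \<Longrightarrow> (hd g \<in> R \<longleftrightarrow> odd (length g))"
proof (induction rule: hike.induct)
  case (hike_step g y)
  have "y \<in> N (hd g)" using hike_step by (auto simp: allowed_def)
  thus ?case using hike_step N_side[of y "hd g"] by auto
qed auto

lemma walk_weight_eq: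
  assumes "wedges g \<subseteq> F"
  shows "walk_weight g * ((real d - 1) ^ nfresh (\<lambda>x. x \<in> R) g * (real c - 1) ^ nfresh (\<lambda>x. x \<notin> R) g) = \<theta> ^ excess g"
  using assms
proof (induction g rule: walk_weight.induct)
  case (1 y x xs)
  have "r x \<noteq> 0" using r_ge_1[of x] by simp
  moreover have "r x = (if x \<in> R then real d - 1 else real c - 1)" by (simp add: r_def)
  moreover note 1
  ultimately show ?case by (auto simp: step_weight_def field_simps)
qed auto

lemma nfresh_wedges: "nfresh P g + nfresh (\<lambda>x. \<not> P x) g = card (wedges g)"
  by (induction P g rule: nfresh.induct) (auto simp: insert_absorb)

text \<open>A fresh step from \<open>R\<close> to a new vertex of \<open>L\<close> is followed by a fresh step from \<open>L\<close>, because the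
  segments have even length and so never end in \<open>L\<close>. This is why both degrees enter symmetrically.\<close>

lemma hike_balance:
  assumes "even per"
  shows "hike g \<Longrightarrow> nfresh (\<lambda>x. x \<in> R) g \<le> nfresh (\<lambda>x. x \<notin> R) g + excess g +
     (if hd g \<notin> R \<and> hd g \<notin> set (tl g) then 1 else 0)"
proof (induction rule: hike.induct)
  case (hike_step g y)
  obtain x xs where g: "g = x # xs" using hike_ne[OF hike_step(1)] by (cases g) auto
  have yN: "y \<in> N x" using hike_step g by (auto simp: allowed_def)
  show ?case
  proof (cases "x \<in> R")
    case True
    hence "y \<notin> R" using N_side[OF yN] by auto
    moreover have "y \<in> set (x # xs)" if "{x, y} \<in> wedges (x # xs)" using wedges_subset[OF that] by auto
    ultimately show ?thesis using True hike_step.IH g by auto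
  next
    case False
    hence y: "y \<in> R" using N_side[OF yN] by auto
    show ?thesis
    proof (cases "x \<in> set xs")
      case True
      thus ?thesis using False y hike_step.IH g by auto
    next
      case new: False
      have ev: "even (length g)" using hike_parity[OF hike_step(1)] g False by auto
      then obtain z zs where xs: "xs = z # zs" using g by (cases xs) auto
      have "\<not> per dvd (length g - 1)"
      proof
        assume "per dvd (length g - 1)"
        hence "even (length g - 1)" using assms dvd_trans by blast
        thus False using ev g by auto
      qed
      hence "y \<noteq> z" using hike_step(2) g xs by (auto simp: allowed_def)
      moreover have "{x, y} \<notin> wedges (z # zs)" using wedges_subset[of "{x, y}" "z # zs"] new xs by auto
      ultimately have "{x, y} \<notin> wedges g" using g xs by (auto simp: doubleton_eq_iff)
      thus ?thesis using False y hike_step.IH g new by auto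
    qed
  qed
qed auto

text \<open>The balanced case is \<open>f1 = f2 = k\<close>. If \<open>f1\<close> is smaller,
  factors \<open>q\<close> are traded for factors \<open>p\<close>, which are no larger. If it is
  larger, then \<open>f2 < k\<close>, and the surplus of \<open>f1\<close> over \<open>k\<close> is
  at most \<open>x\<close>. Without the third assumption only \<open>q ^ (2 * k)\<close> would
  follow.\<close>

lemma nfresh_power_bound:
  fixes p q :: real
  assumes "1 \<le> p" "p \<le> q" "f1 \<le> f2 + x" "2 * (f1 + f2) \<le> 4 * k"
  shows "q ^ f1 * p ^ f2 \<le> (p * q) ^ k * q ^ x"
proof -
  have q: "1 \<le> q" using assms by simp
  show ?thesis
  proof (cases "f1 \<le> k")
    case True
    have "q ^ f1 * p ^ f2 \<le> q ^ f1 * (p ^ (f2 - (k - f1) ) * p ^ (k - f1))"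
      using assms q True by (intro mult_left_mono) (auto simp flip: power_add intro!: power_increasing)
    also have "\<dots> \<le> q ^ f1 * (p ^ k * q ^ (k - f1))"
      using assms q True by (intro mult_left_mono mult_mono power_increasing power_mono) auto
    also have "\<dots> = p ^ k * q ^ (f1 + (k - f1))" by (simp add: power_add)
    also have "\<dots> = (p * q) ^ k * 1" using True by (simp add: power_mult_distrib)
    also have "\<dots> \<le> (p * q) ^ k * q ^ x" using assms q by (intro mult_left_mono) (auto simp: one_le_power)
    finally show ?thesis .
  next
    case False
    have "q ^ f1 \<le> q ^ (k + x)" using assms q False by (intro power_increasing) auto
    moreover have "p ^ f2 \<le> p ^ k" using assms q False by (intro power_increasing) auto
    ultimately have "q ^ f1 * p ^ f2 \<le> q ^ (k + x) * p ^ k" using assms q by (intro mult_mono) auto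
    thus ?thesis by (simp add: power_add power_mult_distrib mult_ac)
  qed
qed

text \<open>All walks from \<open>v\<close> together weigh at most \<open>Q ^ (T div per)\<close>,
  and a walk without singly covered edges weighs at least \<open>1 / W\<close>: it has at most
  \<open>T / 2\<close> edges, nearly balanced between the two sides. The factor
  \<open>((d - 1) * Q) ^ X\<close> pays for the imbalance and for the penalties \<theta>, one for
  each unit of excess.\<close>

lemma card_good_hikes:
  assumes ev: "even per" and T4: "T = 4 * k" and v: "v \<in> R"
    and excX: "\<And>g. wedges g \<subseteq> F \<Longrightarrow> length g \<le> T + 1 \<Longrightarrow> excess g \<le> X"
  shows "real (card {g \<in> exts T [v]. \<forall>e\<in>wedges g. 2 \<le> count_list (edge_list g) e})
    \<le> Q ^ (T div per) * ((real d - 1) * (real c - 1)) ^ k * ((real d - 1) * Q) ^ X" (is "real (card ?A) \<le> _")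
proof -
  define q where "q = real d - 1"
  define p where "p = real c - 1"
  have pq: "1 \<le> p" "p \<le> q" using cd by (auto simp: p_def q_def)
  define W where "W = (p * q) ^ k * (q * Q) ^ X"
  have W0: "0 < W" using pq Q_ge by (auto simp: W_def)
  have low: "1 \<le> W * walk_weight g" if g: "g \<in> ?A" for g
  proof -
    have hk: "hike g" using g exts_hike[of "[v]" g T] v by (auto intro: hike_start)
    have len: "length g = T + 1" using g exts_drop by fastforce
    define f1 where "f1 = nfresh (\<lambda>x. x \<in> R) g"
    define f2 where "f2 = nfresh (\<lambda>x. x \<notin> R) g"
    \<comment> \<open>\<open>T\<close> is even, so the walk ends in \<open>R\<close> and the last
      summand of \<open>hike_balance\<close> vanishes.\<close>
    have "hd g \<in> R" using hike_parity[OF hk] len T4 by auto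
    hence f12: "f1 \<le> f2 + excess g" using hike_balance[OF ev hk] by (auto simp: f1_def f2_def)
    have "2 * card (wedges g) = (\<Sum>e\<in>wedges g. 2)" by simp
    also have "\<dots> \<le> (\<Sum>e\<in>wedges g. count_list (edge_list g) e)" using g by (intro sum_mono) auto
    also have "\<dots> = length (edge_list g)" by (rule sum_count_set) auto
    finally have "2 * (f1 + f2) \<le> 4 * k"
      using nfresh_wedges[of "\<lambda>x. x \<in> R" g] len T4 by (simp add: length_edge_list f1_def f2_def)
    hence bd: "q ^ f1 * p ^ f2 \<le> (p * q) ^ k * q ^ excess g" using pq f12
      by (intro nfresh_power_bound) auto
    have eX: "excess g \<le> X" using excX[OF hike_F[OF hk]] len by simp
    have eq: "walk_weight g * (q ^ f1 * p ^ f2) = \<theta> ^ excess g"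
      using walk_weight_eq[OF hike_F[OF hk]] by (simp add: q_def p_def f1_def f2_def)
    have pos: "0 < q ^ f1 * p ^ f2" using pq by simp
    have th: "\<theta> ^ excess g * Q ^ excess g = 1" using theta(2) by (simp flip: power_mult_distrib)
    have wtg: "walk_weight g = \<theta> ^ excess g / (q ^ f1 * p ^ f2)" using eq pos
      by (metis less_irrefl nonzero_eq_divide_eq)
    have "0 \<le> walk_weight g" unfolding wtg using pos theta by simp
    have "1 = walk_weight g * (q ^ f1 * p ^ f2) * Q ^ excess g" using eq th by simp
    also have "\<dots> \<le> walk_weight g * ((p * q) ^ k * q ^ excess g) * Q ^ excess g"
      using bd \<open>0 \<le> walk_weight g\<close> Q_ge by (intro mult_right_mono mult_left_mono) auto
    also have "\<dots> = walk_weight g * ((p * q) ^ k * (q * Q) ^ excess g)" by (simp add: power_mult_distrib)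
    also have "\<dots> \<le> walk_weight g * ((p * q) ^ k * (q * Q) ^ X)"
    proof -
      have "1 * 1 \<le> q * Q" using pq Q_ge by (intro mult_mono) auto
      thus ?thesis using \<open>0 \<le> walk_weight g\<close> pq eX by (intro mult_left_mono power_increasing) auto
    qed
    finally show ?thesis by (simp add: W_def mult.commute)
  qed
  have wt0: "0 \<le> walk_weight g" if "g \<in> exts T [v]" for g
  proof -
    have "wedges g \<subseteq> F" using that exts_hike[of "[v]" g T] v by (auto intro: hike_start dest: hike_F)
    show ?thesis by (induction g rule: walk_weight.induct) (auto intro: mult_nonneg_nonneg step_weight_nonneg)
  qed
  have "real (card ?A) = (\<Sum>g\<in>?A. 1)" by simp
  also have "\<dots> \<le> (\<Sum>g\<in>?A. W * walk_weight g)" by (rule sum_mono) (use low in auto)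
  also have "\<dots> \<le> (\<Sum>g\<in>exts T [v]. W * walk_weight g)" using wt0 W0 by (intro sum_mono2) auto
  also have "\<dots> = W * ext_weight T [v]" by (simp add: sum_walk_weight flip: sum_distrib_left)
  also have "\<dots> \<le> W * Q ^ (T div per)" using ext_weight_bound W0 by (intro mult_left_mono) auto
  finally show ?thesis by (simp add: W_def q_def p_def mult_ac)
qed

end

subsection \<open>Growth of the nonbacktracking eigenvalues\<close>

text \<open>The scalar version of \<open>nb_poly\<close>, a sequence of Chebyshev type. With
  \<open>Y = \<Lambda> - (c - 1) - (d - 1)\<close>, the recurrence beyond its irregular start has
  the characteristic polynomial z^2 - Y z + (c - 1)(d - 1).\<close>

fun nb_eigenvalue :: "real \<Rightarrow> real \<Rightarrow> real \<Rightarrow> nat \<Rightarrow> real" where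
  "nb_eigenvalue c d \<Lambda> 0 = 1"
| "nb_eigenvalue c d \<Lambda> (Suc 0) = \<Lambda> - d"
| "nb_eigenvalue c d \<Lambda> (Suc (Suc k)) = \<Lambda> * nb_eigenvalue c d \<Lambda> (Suc k) - (c - 1 + (d - 1)) * nb_eigenvalue c d \<Lambda> (Suc k)
      - (c - 1) * (if k = 0 then d else d - 1) * nb_eigenvalue c d \<Lambda> k"

text \<open>All conditions hold strictly at \<eta> = 0, hence by continuity for small \<eta> > 0.
  The second and third serve the start of the recurrence, for eigenvalues above and below the
  interval respectively. The assumption \<open>2 <= q\<close> is what \<open>d \<noteq> 2\<close>
  provides.\<close>

lemma growth_parameter:
  fixes p q \<delta> :: real
  assumes p: "1 \<le> p" and pq: "p \<le> q" and q: "2 \<le> q" and \<delta>: "0 < \<delta>"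
  defines "s \<equiv> sqrt (p * q)"
  obtains \<eta> where "0 < \<eta>" "s * (1 + \<eta>) + s / (1 + \<eta>) \<le> 2 * s + \<delta>" "(1 + \<eta>)\<^sup>2 \<le> q"
    "p < q \<Longrightarrow> s * (1 + \<eta>) \<le> q * (s / (1 + \<eta>) - p + 1)"
proof -
  have 1: "\<forall>\<^sub>F \<eta> in at_right 0. s * (1 + \<eta>) + s / (1 + \<eta>) < 2 * s + \<delta>"
  proof (rule order_tendstoD(2))
    show "((\<lambda>\<eta>. s * (1 + \<eta>) + s / (1 + \<eta>)) \<longlongrightarrow> s * (1 + 0) + s / (1 + 0)) (at_right 0)"
      by (intro tendsto_intros) auto
  qed (use \<delta> in auto)
  have 2: "\<forall>\<^sub>F \<eta> in at_right 0. (1 + \<eta>)\<^sup>2 < q"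
  proof (rule order_tendstoD(2))
    show "((\<lambda>\<eta>::real. (1 + \<eta>)\<^sup>2) \<longlongrightarrow> (1 + 0)\<^sup>2) (at_right 0)" by (intro tendsto_intros)
  qed (use q in auto)
  have 3: "\<forall>\<^sub>F \<eta> in at_right 0. p < q \<longrightarrow> s * (1 + \<eta>) < q * (s / (1 + \<eta>) - p + 1)"
  proof (cases "p < q")
    case True
    have "p = sqrt (p * p)" using p by simp
    also have "\<dots> < s" unfolding s_def using True p by (intro real_sqrt_less_mono) auto
    finally have "p < s" .
    hence "(q - 1) * p < (q - 1) * s" using q by (intro mult_strict_left_mono) auto
    moreover have "q * (p - 1) \<le> (q - 1) * p" using pq by (simp add: algebra_simps)
    ultimately have gap: "0 < q * (s / (1 + 0) - p + 1) - s * (1 + 0)" by (simp add: algebra_simps)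
    have "\<forall>\<^sub>F \<eta> in at_right 0. 0 < q * (s / (1 + \<eta>) - p + 1) - s * (1 + \<eta>)"
    proof (rule order_tendstoD(1))
      show "((\<lambda>\<eta>. q * (s / (1 + \<eta>) - p + 1) - s * (1 + \<eta>)) \<longlongrightarrow> q * (s / (1 + 0) - p + 1) - s * (1 + 0)) (at_right 0)"
        by (intro tendsto_intros) auto
    qed (rule gap)
    thus ?thesis by eventually_elim simp
  qed simp
  have 4: "\<forall>\<^sub>F \<eta> in at_right 0. (0 :: real) < \<eta>" by (rule eventually_at_right_less)
  have "\<forall>\<^sub>F \<eta> in at_right 0. 0 < \<eta> \<and> s * (1 + \<eta>) + s / (1 + \<eta>) < 2 * s + \<delta> \<and> (1 + \<eta>)\<^sup>2 < q \<and>
      (p < q \<longrightarrow> s * (1 + \<eta>) < q * (s / (1 + \<eta>) - p + 1))"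
    using 1 2 3 4 by eventually_elim simp
  moreover have "at_right (0 :: real) \<noteq> bot" by (rule trivial_limit_at_right_real)
  ultimately obtain \<eta> where "0 < \<eta>" "s * (1 + \<eta>) + s / (1 + \<eta>) < 2 * s + \<delta>" "(1 + \<eta>)\<^sup>2 < q"
      "p < q \<longrightarrow> s * (1 + \<eta>) < q * (s / (1 + \<eta>) - p + 1)"
    using eventually_happens' by blast
  thus ?thesis by (intro that[of \<eta>]) auto
qed

text \<open>Let \<rho> = s (1 + \<eta>) and t = s / (1 + \<eta>), so that \<rho> t = p q and |Y| >=
  \<rho> + t. If |a| >= \<rho> |b|, then |Y a - p q b| >= (\<rho> + t) |a| - t \<rho> |b| >= \<rho>
  |a|. So growth by the factor \<rho> sustains itself, and the work lies in starting it.\<close>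

lemma nb_eigenvalue_growth:
  fixes c d \<Lambda> \<eta> \<delta> :: real
  assumes c: "2 \<le> c" and cd: "c \<le> d"
  defines "s \<equiv> sqrt ((c - 1) * (d - 1))"
  assumes \<eta>: "0 < \<eta>" "s * (1 + \<eta>) + s / (1 + \<eta>) \<le> 2 * s + \<delta>" "(1 + \<eta>)\<^sup>2 \<le> d - 1"
      "c < d \<Longrightarrow> s * (1 + \<eta>) \<le> (d - 1) * (s / (1 + \<eta>) - (c - 1) + 1)"
    and \<Lambda>: "0 \<le> \<Lambda>" and \<delta>: "0 < \<delta>" and out: "2 * s + \<delta> \<le> \<bar>\<Lambda> - (c - 1 + (d - 1))\<bar>"
  shows "(s * (1 + \<eta>)) ^ k \<le> \<bar>nb_eigenvalue c d \<Lambda> k\<bar>"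
proof -
  define p where "p = c - 1"
  define q where "q = d - 1"
  define Y where "Y = \<Lambda> - (p + q)"
  define \<rho> where "\<rho> = s * (1 + \<eta>)"
  define t where "t = s / (1 + \<eta>)"
  have pq: "1 \<le> p" "p \<le> q" using c cd by (auto simp: p_def q_def)
  have s2: "s * s = p * q" using pq unfolding s_def p_def[symmetric] q_def[symmetric] by simp
  have sp: "p \<le> s"
  proof -
    have "sqrt (p * p) \<le> s" unfolding s_def p_def[symmetric] q_def[symmetric]
      using pq by (intro real_sqrt_le_mono mult_left_mono) auto
    thus ?thesis using pq by simp
  qed
  have s1: "1 \<le> s" using sp pq by simp
  have rt: "\<rho> * t = p * q" using \<eta>(1) s2 by (simp add: \<rho>_def t_def)
  have rho: "1 \<le> \<rho>" using mult_mono[of 1 s 1 "1 + \<eta>"] s1 \<eta>(1) by (simp add: \<rho>_def)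
  have t0: "0 < t" using s1 \<eta>(1) by (simp add: t_def)
  have Yge: "\<rho> + t \<le> \<bar>Y\<bar>" using \<eta>(2) out by (simp add: \<rho>_def t_def Y_def p_def q_def)
  have z1: "nb_eigenvalue c d \<Lambda> (Suc 0) = Y + p - 1" by (simp add: Y_def p_def q_def)
  \<comment> \<open>The first step of the recurrence has the coefficient p (q + 1) in place of p q,
    so the value at index 1 must exceed \<rho> by the factor (q + 1) / q.\<close>
  have base: "(q + 1) * \<rho> \<le> q * \<bar>nb_eigenvalue c d \<Lambda> (Suc 0)\<bar>"
  proof (cases "0 \<le> Y")
    case True
    have "\<rho> \<le> q * t"
    proof -
      have "\<rho> = t * (1 + \<eta>)\<^sup>2" using \<eta>(1) by (simp add: \<rho>_def t_def power2_eq_square)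
      also have "\<dots> \<le> t * q" using \<eta>(3) t0 by (intro mult_left_mono) (auto simp: q_def)
      finally show ?thesis by (simp add: mult.commute)
    qed
    moreover have "q * (\<rho> + t) \<le> q * \<bar>nb_eigenvalue c d \<Lambda> (Suc 0)\<bar>"
      using Yge True pq z1 by (intro mult_left_mono) auto
    ultimately show ?thesis by (simp add: algebra_simps)
  next
    case False
    \<comment> \<open>For p = q the lower end p + q - 2 s of the interval is 0, and \<Lambda> >= 0
      cannot lie below it.\<close>
    have "p < q"
    proof (rule ccontr)
      assume "\<not> p < q"
      hence "p = q" using pq by simp
      hence "s = p" using s2 pq s1
        by (metis abs_of_nonneg abs_square_eq_1 order.trans power2_eq_iff_nonneg power2_eq_square zero_le_one)
      hence "2 * p + \<delta> \<le> - Y" using out False by (simp add: Y_def p_def q_def)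
      moreover have "- Y \<le> 2 * p" using \<Lambda> \<open>p = q\<close> by (simp add: Y_def)
      ultimately show False using \<delta> by simp
    qed
    hence "\<rho> \<le> q * (t - p + 1)" using \<eta>(4) by (simp add: \<rho>_def t_def p_def q_def)
    moreover have "q * (\<rho> + t - p + 1) \<le> q * \<bar>nb_eigenvalue c d \<Lambda> (Suc 0)\<bar>"
      using Yge False pq z1 by (intro mult_left_mono) auto
    ultimately show ?thesis by (simp add: algebra_simps)
  qed
  have z1ge: "\<rho> \<le> \<bar>nb_eigenvalue c d \<Lambda> (Suc 0)\<bar>"
  proof -
    have "q * \<rho> \<le> (q + 1) * \<rho>" using rho by (intro mult_right_mono) auto
    hence "q * \<rho> \<le> q * \<bar>nb_eigenvalue c d \<Lambda> (Suc 0)\<bar>" using base by linarith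
    thus ?thesis using pq by simp
  qed
  have tri: "\<bar>Y\<bar> * \<bar>a\<bar> - e * \<bar>b\<bar> \<le> \<bar>Y * a - e * b\<bar>" if "0 \<le> e" for a b e
    using that abs_triangle_ineq2[of "Y * a" "e * b"] by (simp add: abs_mult)
  have step: "\<rho> * \<bar>nb_eigenvalue c d \<Lambda> (Suc k)\<bar> \<le> \<bar>nb_eigenvalue c d \<Lambda> (Suc (Suc k))\<bar>" for k
  proof (induction k)
    case 0
    have eq: "nb_eigenvalue c d \<Lambda> (Suc (Suc 0)) = Y * nb_eigenvalue c d \<Lambda> (Suc 0) - (p * (q + 1)) * 1"
      by (simp add: Y_def p_def q_def algebra_simps)
    have "p * (q + 1) * \<rho> \<le> t * \<bar>nb_eigenvalue c d \<Lambda> (Suc 0)\<bar> * \<rho>"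
    proof -
      have "p * (q + 1) * \<rho> \<le> p * (q * \<bar>nb_eigenvalue c d \<Lambda> (Suc 0)\<bar>)" using base pq
        by (simp add: mult.assoc)
      also have "\<dots> = \<rho> * t * \<bar>nb_eigenvalue c d \<Lambda> (Suc 0)\<bar>" unfolding rt by (simp only: mult.assoc)
      finally show ?thesis by (simp only: mult_ac)
    qed
    hence "p * (q + 1) \<le> t * \<bar>nb_eigenvalue c d \<Lambda> (Suc 0)\<bar>" using rho by simp
    moreover have "(\<rho> + t) * \<bar>nb_eigenvalue c d \<Lambda> (Suc 0)\<bar> \<le> \<bar>Y\<bar> * \<bar>nb_eigenvalue c d \<Lambda> (Suc 0)\<bar>"
      using Yge by (intro mult_right_mono) auto
    moreover have "\<bar>Y\<bar> * \<bar>nb_eigenvalue c d \<Lambda> (Suc 0)\<bar> - (p * (q + 1)) * \<bar>1\<bar> \<le> \<bar>nb_eigenvalue c d \<Lambda> (Suc (Suc 0))\<bar>"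
      unfolding eq using pq by (intro tri) auto
    ultimately show ?case by (simp only: distrib_right abs_one mult_1_right)
  next
    case (Suc k)
    let ?a = "nb_eigenvalue c d \<Lambda> (Suc (Suc k))" and ?b = "nb_eigenvalue c d \<Lambda> (Suc k)"
    have eq: "nb_eigenvalue c d \<Lambda> (Suc (Suc (Suc k))) = Y * ?a - (p * q) * ?b"
      by (subst nb_eigenvalue.simps(3)) (simp add: Y_def p_def q_def algebra_simps del: nb_eigenvalue.simps)
    have "p * q * \<bar>?b\<bar> = t * (\<rho> * \<bar>?b\<bar>)" unfolding rt[symmetric] by (simp only: mult_ac)
    also have "\<dots> \<le> t * \<bar>?a\<bar>" using Suc t0 by (intro mult_left_mono) auto
    finally have "p * q * \<bar>?b\<bar> \<le> t * \<bar>?a\<bar>" .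
    moreover have "(\<rho> + t) * \<bar>?a\<bar> \<le> \<bar>Y\<bar> * \<bar>?a\<bar>" using Yge by (intro mult_right_mono) auto
    moreover have "\<bar>Y\<bar> * \<bar>?a\<bar> - (p * q) * \<bar>?b\<bar> \<le> \<bar>nb_eigenvalue c d \<Lambda> (Suc (Suc (Suc k)))\<bar>"
      unfolding eq using pq by (intro tri) auto
    ultimately show ?case by (simp only: distrib_right)
  qed
  have "\<rho> ^ Suc j \<le> \<bar>nb_eigenvalue c d \<Lambda> (Suc j)\<bar>" for j
  proof (induction j)
    case 0 thus ?case using z1ge by simp
  next
    case (Suc j)
    have "\<rho> ^ Suc (Suc j) \<le> \<rho> * \<bar>nb_eigenvalue c d \<Lambda> (Suc j)\<bar>"
      using Suc rho by (simp del: nb_eigenvalue.simps)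
    thus ?case using step[of j] by linarith
  qed
  thus ?thesis unfolding \<rho>_def[symmetric] by (cases k) auto
qed

text \<open>The squares of sqrt q + sqrt p and sqrt q - sqrt p are p + q + 2 sqrt (p q) and p + q -
  2 sqrt (p q). Below the interval, \<open>0 <= x\<close> forces \<epsilon> < sqrt q - sqrt p, so on
  either side a distance \<epsilon> becomes at least \<epsilon>^2 on squaring.\<close>

lemma outside_interval:
  fixes p q x \<epsilon> :: real
  assumes p: "0 \<le> p" "p \<le> q" and \<epsilon>: "0 < \<epsilon>" and x: "0 \<le> x"
    and out: "x \<notin> {sqrt q - sqrt p - \<epsilon> .. sqrt q + sqrt p + \<epsilon>}"
  shows "2 * sqrt (p * q) + \<epsilon>\<^sup>2 \<le> \<bar>x\<^sup>2 - (p + q)\<bar>"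
proof -
  have sq: "(sqrt q)\<^sup>2 = q" "(sqrt p)\<^sup>2 = p" using p by auto
  have s: "sqrt (p * q) = sqrt q * sqrt p" by (simp add: real_sqrt_mult)
  from out consider "x < sqrt q - sqrt p - \<epsilon>" | "x > sqrt q + sqrt p + \<epsilon>" by fastforce
  thus ?thesis
  proof cases
    case 1
    define a where "a = sqrt q - sqrt p"
    have a: "\<epsilon> < a" using 1 x by (simp add: a_def)
    have "x\<^sup>2 \<le> (a - \<epsilon>)\<^sup>2" using 1 x by (intro power_mono) (auto simp: a_def)
    also have "\<dots> = a\<^sup>2 - 2 * a * \<epsilon> + \<epsilon>\<^sup>2" by (simp add: power2_diff)
    also have "\<dots> \<le> a\<^sup>2 - \<epsilon>\<^sup>2"
    proof -
      have "\<epsilon> * \<epsilon> \<le> a * \<epsilon>" using a \<epsilon> by (intro mult_right_mono) auto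
      thus ?thesis by (simp add: power2_eq_square)
    qed
    also have "a\<^sup>2 = p + q - 2 * sqrt (p * q)" unfolding a_def s power2_diff sq by simp
    finally show ?thesis by simp
  next
    case 2
    have "(sqrt q + sqrt p)\<^sup>2 + \<epsilon>\<^sup>2 \<le> (sqrt q + sqrt p + \<epsilon>)\<^sup>2"
      using \<epsilon> p by (simp add: power2_sum)
    also have "\<dots> \<le> x\<^sup>2" using 2 \<epsilon> p by (intro power_mono) auto
    finally have "(sqrt q + sqrt p)\<^sup>2 + \<epsilon>\<^sup>2 \<le> x\<^sup>2" .
    moreover have "(sqrt q + sqrt p)\<^sup>2 = p + q + 2 * sqrt (p * q)" unfolding s power2_sum sq by simp
    ultimately show ?thesis by simp
  qed
qed

subsection \<open>Nonbacktracking operators and the trace bound\<close>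

locale signed_biregular = biregular F R L c d for F :: "'v set set" and R L c d +
  fixes \<sigma> :: "'v set \<Rightarrow> real"
  assumes sign: "\<And>e. e \<in> F \<Longrightarrow> \<sigma> e * \<sigma> e = 1"
begin

definition Adj :: "('v \<Rightarrow> real) \<Rightarrow> 'v \<Rightarrow> real" where
  "Adj f x = (\<Sum>y\<in>N x. \<sigma> {x, y} * f y)"

text \<open>\<open>nb_op s\<close> sums a function over the end points of the signed nonbacktracking walks of \<open>s\<close> steps;
  \<open>nb_tail s\<close> does so for the walks whose first step avoids a given vertex.\<close>

fun nb_tail :: "nat \<Rightarrow> ('v \<Rightarrow> real) \<Rightarrow> 'v \<Rightarrow> 'v \<Rightarrow> real" where
  "nb_tail 0 f x z = f x"
| "nb_tail (Suc s) f x z = (\<Sum>y\<in>N x - {z}. \<sigma> {x, y} * nb_tail s f y x)"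

fun nb_op :: "nat \<Rightarrow> ('v \<Rightarrow> real) \<Rightarrow> 'v \<Rightarrow> real" where
  "nb_op 0 f x = f x"
| "nb_op (Suc s) f x = (\<Sum>y\<in>N x. \<sigma> {x, y} * nb_tail s f y x)"

text \<open>Degree minus one at the place where a walk from \<open>x\<close> is after
  \<open>k\<close> steps; the parity of \<open>k\<close> tells the side.\<close>

definition branching :: "'v \<Rightarrow> nat \<Rightarrow> real" where
  "branching x k = (if (x \<in> R) = even k then real d - 1 else real c - 1)"

lemma branching_0: "branching x 0 = r x"
  by (simp add: branching_def r_def)

lemma branching_N: "y \<in> N x \<Longrightarrow> branching y k = branching x (Suc k)"
  using N_side[of y x] by (auto simp: branching_def)

lemma card_N_diff: "z \<in> N x \<Longrightarrow> real (card (N x - {z})) = r x"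
proof -
  assume z: "z \<in> N x"
  hence "Suc (card (N x - {z})) = card (N x)" by (intro card_Suc_Diff1) auto
  moreover have "x \<in> R \<union> L" using N_side[OF z] by auto
  ultimately show ?thesis using card_N[of x] by linarith
qed

lemma sign_N: "y \<in> N x \<Longrightarrow> \<sigma> {x, y} * \<sigma> {x, y} = 1"
  by (rule sign) (simp add: N_def)

lemma Adj_split: "x \<in> N y \<Longrightarrow> Adj f y = \<sigma> {x, y} * f x + nb_tail (Suc 0) f y x"
  unfolding Adj_def by (subst sum.remove[of _ x]) (auto simp: insert_commute)

text \<open>A further arbitrary step either prolongs the walk without backtracking or takes back its
  last step. In the second case the two signs cancel, and the step taken back could have been chosen
  in \<open>branching x t\<close> ways.\<close>

lemma nb_tail_Adj: "z \<in> N x \<Longrightarrow> nb_tail (Suc t) (Adj f) x z = nb_tail (Suc (Suc t)) f x z + branching x t * nb_tail t f x z"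
proof (induction t arbitrary: x z)
  case 0
  have "nb_tail (Suc 0) (Adj f) x z = (\<Sum>y\<in>N x - {z}. f x + \<sigma> {x, y} * nb_tail (Suc 0) f y x)"
    unfolding nb_tail.simps
  proof (rule sum.cong[OF refl])
    fix y assume y: "y \<in> N x - {z}"
    hence "Adj f y = \<sigma> {x, y} * f x + nb_tail (Suc 0) f y x" using N_sym by (intro Adj_split) auto
    thus "\<sigma> {x, y} * Adj f y = f x + \<sigma> {x, y} * (\<Sum>ya\<in>N y - {x}. \<sigma> {y, ya} * f ya)"
      using sign_N[of y x] y by (simp add: distrib_left mult.assoc[symmetric])
  qed
  also have "\<dots> = real (card (N x - {z})) * f x + nb_tail (Suc (Suc 0)) f x z" by (simp add: sum.distrib)
  finally show ?case using card_N_diff[OF 0] by (simp add: branching_0)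
next
  case (Suc t)
  have "nb_tail (Suc (Suc t)) (Adj f) x z = (\<Sum>y\<in>N x - {z}. \<sigma> {x, y} * (nb_tail (Suc (Suc t)) f y x + branching x (Suc t) * nb_tail t f y x))"
    by (subst nb_tail.simps(2), rule sum.cong[OF refl]) (use Suc.IH N_sym branching_N in auto)
  also have "\<dots> = nb_tail (Suc (Suc (Suc t))) f x z + branching x (Suc t) * nb_tail (Suc t) f x z"
    by (simp add: distrib_left sum.distrib sum_distrib_left mult_ac del: nb_tail.simps(2))
       (simp add: sum_distrib_left mult_ac)
  finally show ?case .
qed

lemma nb_op_Adj: "nb_op (Suc (Suc t)) (Adj f) x = nb_op (Suc (Suc (Suc t))) f x + branching x (Suc t) * nb_op (Suc t) f x"
proof -
  have "nb_op (Suc (Suc t)) (Adj f) x = (\<Sum>y\<in>N x. \<sigma> {x, y} * (nb_tail (Suc (Suc t)) f y x + branching x (Suc t) * nb_tail t f y x))"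
    by (subst nb_op.simps(2), rule sum.cong[OF refl]) (use nb_tail_Adj N_sym branching_N in auto)
  also have "\<dots> = nb_op (Suc (Suc (Suc t))) f x + branching x (Suc t) * nb_op (Suc t) f x"
    by (simp add: distrib_left sum.distrib sum_distrib_left mult_ac del: nb_tail.simps(2))
  finally show ?thesis .
qed

lemma nb_op_1: "nb_op (Suc 0) f x = Adj f x"
  by (simp add: Adj_def)

lemma nb_op_1_Adj: "nb_op (Suc 0) (Adj f) x = nb_op (Suc (Suc 0)) f x + real (card (N x)) * f x"
proof -
  have "nb_op (Suc 0) (Adj f) x = (\<Sum>y\<in>N x. f x + \<sigma> {x, y} * nb_tail (Suc 0) f y x)"
    unfolding nb_op.simps nb_tail.simps(1)
  proof (rule sum.cong[OF refl])
    fix y assume y: "y \<in> N x"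
    hence "Adj f y = \<sigma> {x, y} * f x + nb_tail (Suc 0) f y x" using N_sym by (intro Adj_split) auto
    thus "\<sigma> {x, y} * Adj f y = f x + \<sigma> {x, y} * nb_tail (Suc 0) f y x"
      using sign_N[of y x] y by (simp add: distrib_left mult.assoc[symmetric] del: nb_tail.simps)
  qed
  also have "\<dots> = real (card (N x)) * f x + nb_op (Suc (Suc 0)) f x" by (simp add: sum.distrib)
  finally show ?thesis by simp
qed

definition Adj2 :: "('v \<Rightarrow> real) \<Rightarrow> 'v \<Rightarrow> real" where "Adj2 f = Adj (Adj f)"

text \<open>The case distinction comes from the first step of a walk, which has \<open>d\<close> instead of \<open>d - 1\<close> choices.\<close>

fun nb_poly :: "nat \<Rightarrow> ('v \<Rightarrow> real) \<Rightarrow> 'v \<Rightarrow> real" where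
  "nb_poly 0 f = f"
| "nb_poly (Suc 0) f = (\<lambda>x. Adj2 f x - real d * f x)"
| "nb_poly (Suc (Suc k)) f = (\<lambda>x. nb_poly (Suc k) (Adj2 f) x - (real c - 1 + (real d - 1)) * nb_poly (Suc k) f x
      - (real c - 1) * (if k = 0 then real d else real d - 1) * nb_poly k f x)"

text \<open>Eliminates the odd lengths from three consecutive one-step relations. The recurrence is
  that of walks from \<open>R\<close>; for walks from \<open>L\<close> the two degrees would change
  places.\<close>

lemma nb_op_nb_poly: "x \<in> R \<Longrightarrow> nb_op (2 * k) f x = nb_poly k f x"
proof (induction k f rule: nb_poly.induct)
  case (2 f)
  have "real (card (N x)) = real d" using degR[OF 2] by (simp add: N_def)
  moreover have e: "2 * Suc 0 = Suc (Suc 0)" by simp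
  ultimately show ?case unfolding e using nb_op_1_Adj[of f x] nb_op_1[of "Adj f" x]
    by (simp add: Adj2_def del: nb_op.simps nb_tail.simps)
next
  case (3 k f)
  have "real (card (N x)) = real d" using degR[OF 3(4)] by (simp add: N_def)
  hence w1: "nb_op (Suc (2 * k)) (Adj f) x = nb_op (Suc (Suc (2 * k))) f x + (if k = 0 then real d else real d - 1) * nb_op (2 * k) f x"
    using nb_op_1_Adj[of f x] nb_op_Adj[of "2 * k - 1" f x] 3(4)
    by (cases k) (auto simp: branching_def simp del: nb_op.simps(2) nb_tail.simps)
  have w2: "nb_op (Suc (Suc (Suc (2 * k)))) (Adj f) x = nb_op (Suc (Suc (Suc (Suc (2 * k))))) f x + (real d - 1) * nb_op (Suc (Suc (2 * k))) f x"
    using nb_op_Adj[of "Suc (2 * k)" f x] 3(4)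
    by (simp add: branching_def del: nb_op.simps nb_tail.simps)
  have w3: "nb_op (Suc (Suc (2 * k))) (Adj (Adj f)) x = nb_op (Suc (Suc (Suc (2 * k)))) (Adj f) x + (real c - 1) * nb_op (Suc (2 * k)) (Adj f) x"
    using nb_op_Adj[of "2 * k" "Adj f" x] 3(4)
    by (simp add: branching_def del: nb_op.simps nb_tail.simps)
  have e: "2 * Suc k = Suc (Suc (2 * k))" "2 * Suc (Suc k) = Suc (Suc (Suc (Suc (2 * k))))" by simp_all
  show ?case
    unfolding nb_poly.simps using 3 w1 w2 w3 unfolding e Adj2_def[symmetric]
    by (simp add: algebra_simps Adj2_def del: nb_op.simps nb_tail.simps)
qed simp

lemma nb_tail_cong: "(\<And>y. y \<in> R \<Longrightarrow> f y = g y) \<Longrightarrow> (x \<in> R \<longleftrightarrow> even s) \<Longrightarrow> nb_tail s f x z = nb_tail s g x z"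
proof (induction s arbitrary: x z)
  case (Suc s)
  show ?case unfolding nb_tail.simps
  proof (rule sum.cong[OF refl])
    fix y assume "y \<in> N x - {z}"
    hence "y \<in> R \<longleftrightarrow> even s" using Suc.prems(2) N_side[of y x] by auto
    thus "\<sigma> {x, y} * nb_tail s f y x = \<sigma> {x, y} * nb_tail s g y x" using Suc by simp
  qed
qed auto

text \<open>Walks of even length from \<open>R\<close> end in \<open>R\<close>. Since
  \<open>nb_op\<close> and \<open>nb_poly\<close> are known to agree on \<open>R\<close> only, their
  iterates can be compared only because the values elsewhere do not enter.\<close>

lemma nb_op_cong: "(\<And>y. y \<in> R \<Longrightarrow> f y = g y) \<Longrightarrow> x \<in> R \<Longrightarrow> nb_op (2 * k) f x = nb_op (2 * k) g x"
proof (cases k)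
  case (Suc j)
  assume fg: "\<And>y. y \<in> R \<Longrightarrow> f y = g y" and x: "x \<in> R"
  have "2 * k = Suc (Suc (2 * j))" using Suc by simp
  moreover have "nb_tail (Suc (2 * j)) f y x = nb_tail (Suc (2 * j)) g y x" if "y \<in> N x" for y
    by (rule nb_tail_cong[OF fg]) (use N_side[OF that] x in auto)
  ultimately show ?thesis by (simp del: nb_tail.simps)
qed auto

lemma nb_op_nb_poly_funpow: "x \<in> R \<Longrightarrow> (nb_op (2 * k) ^^ a) f x = (nb_poly k ^^ a) f x"
proof (induction a arbitrary: x)
  case (Suc a)
  have "(nb_op (2 * k) ^^ Suc a) f x = nb_op (2 * k) ((nb_op (2 * k) ^^ a) f) x" by simp
  also have "\<dots> = nb_op (2 * k) ((nb_poly k ^^ a) f) x" by (rule nb_op_cong) (use Suc in auto)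
  finally show ?case using nb_op_nb_poly[OF Suc.prems] by simp
qed auto

section \<open>Self-adjointness of the nonbacktracking operators\<close>

definition ip :: "('v \<Rightarrow> real) \<Rightarrow> ('v \<Rightarrow> real) \<Rightarrow> real" where
  "ip f g = (\<Sum>x\<in>R \<union> L. f x * g x)"

lemma Adj_ip: "ip g (Adj f) = ip (Adj g) f"
proof -
  define a where "a x y = (if y \<in> N x then \<sigma> {x, y} else 0)" for x y
  have sym: "a x y = a y x" for x y using N_sym[of x y] by (auto simp: a_def insert_commute)
  have A: "Adj h x = (\<Sum>y\<in>R \<union> L. a x y * h y)" for h x
    unfolding Adj_def by (rule sum.mono_neutral_cong_left) (use finR finL N_RL in \<open>auto simp: a_def\<close>)
  have "ip g (Adj f) = (\<Sum>x\<in>R \<union> L. \<Sum>y\<in>R \<union> L. g x * (a x y * f y))"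
    by (simp add: ip_def A sum_distrib_left)
  also have "\<dots> = (\<Sum>y\<in>R \<union> L. \<Sum>x\<in>R \<union> L. g x * (a x y * f y))" by (rule sum.swap)
  also have "\<dots> = (\<Sum>y\<in>R \<union> L. \<Sum>x\<in>R \<union> L. (a y x * g x) * f y)"
    using sym by (intro sum.cong refl) (simp add: mult_ac)
  also have "\<dots> = ip (Adj g) f" by (simp add: ip_def A sum_distrib_right)
  finally show ?thesis .
qed

lemma Adj2_ip: "ip g (Adj2 f) = ip (Adj2 g) f"
  by (simp add: Adj2_def Adj_ip)

lemma Adj_linear: "Adj (\<lambda>x. f x - a * g x - b * h x) = (\<lambda>x. Adj f x - a * Adj g x - b * Adj h x)"
  unfolding Adj_def sum_distrib_left sum_subtractf[symmetric]
  by (intro ext sum.cong refl) (simp add: algebra_simps)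

lemma Adj2_linear: "Adj2 (\<lambda>x. f x - a * g x - b * h x) = (\<lambda>x. Adj2 f x - a * Adj2 g x - b * Adj2 h x)"
  by (simp add: Adj2_def Adj_linear)

lemma Adj2_nb_poly: "Adj2 (nb_poly k f) = nb_poly k (Adj2 f)"
proof (induction k f rule: nb_poly.induct)
  case (2 f)
  show ?case using Adj2_linear[of "Adj2 f" "real d" f 0 f] by simp
next
  case (3 k f)
  show ?case unfolding nb_poly.simps Adj2_linear 3 ..
qed simp

lemma ip_linear: "ip g (\<lambda>x. f x - a * f' x - b * h x) = ip g f - a * ip g f' - b * ip g h"
  unfolding ip_def sum_distrib_left sum_subtractf[symmetric]
  by (intro sum.cong refl) (simp add: algebra_simps)

lemma ip_commute: "ip f g = ip g f"
  by (simp add: ip_def mult.commute)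

lemma nb_poly_ip: "ip g (nb_poly k f) = ip (nb_poly k g) f"
proof (induction k f arbitrary: g rule: nb_poly.induct)
  case (2 f)
  show ?case using ip_linear[of g "Adj2 f" "real d" f 0 f] ip_linear[of f "Adj2 g" "real d" g 0 g]
    by (simp add: Adj2_ip ip_commute[of _ f])
next
  case (3 k f)
  let ?b = "real c - 1 + (real d - 1)" and ?e = "(real c - 1) * (if k = 0 then real d else real d - 1)"
  have "ip g (nb_poly (Suc (Suc k)) f) = ip g (nb_poly (Suc k) (Adj2 f)) - ?b * ip g (nb_poly (Suc k) f) - ?e * ip g (nb_poly k f)"
    unfolding nb_poly.simps by (rule ip_linear)
  also have "ip g (nb_poly (Suc k) (Adj2 f)) = ip (nb_poly (Suc k) (Adj2 g)) f"
    unfolding 3 Adj2_ip Adj2_nb_poly ..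
  also have "\<dots> - ?b * ip g (nb_poly (Suc k) f) - ?e * ip g (nb_poly k f)
     = ip f (nb_poly (Suc k) (Adj2 g)) - ?b * ip f (nb_poly (Suc k) g) - ?e * ip f (nb_poly k g)"
    unfolding 3 by (simp only: ip_commute)
  also have "\<dots> = ip f (nb_poly (Suc (Suc k)) g)"
    unfolding nb_poly.simps by (rule ip_linear[symmetric])
  finally show ?case by (simp only: ip_commute)
qed simp

lemma nb_poly_funpow_ip: "ip g ((nb_poly k ^^ a) f) = ip ((nb_poly k ^^ a) g) f"
proof (induction a arbitrary: f g)
  case (Suc a)
  have "ip g ((nb_poly k ^^ Suc a) f) = ip (nb_poly k g) ((nb_poly k ^^ a) f)" by (simp add: nb_poly_ip)
  also have "\<dots> = ip ((nb_poly k ^^ a) (nb_poly k g)) f" by (rule Suc)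
  finally show ?case by (simp add: funpow_swap1)
qed simp

end

section \<open>Eigenvalues of the nonbacktracking operators and the trace\<close>

context signed_biregular
begin

lemma Adj_scale: "Adj (\<lambda>x. a * f x) = (\<lambda>x. a * Adj f x)"
  by (auto simp: Adj_def sum_distrib_left mult_ac)

lemma Adj2_scale: "Adj2 (\<lambda>x. a * f x) = (\<lambda>x. a * Adj2 f x)"
  by (simp add: Adj2_def Adj_scale)

lemma nb_poly_scale: "nb_poly k (\<lambda>x. a * f x) = (\<lambda>x. a * nb_poly k f x)"
proof (induction k f rule: nb_poly.induct)
  case (3 k f)
  show ?case unfolding nb_poly.simps Adj2_scale 3 by (auto simp: algebra_simps)
qed (auto simp: Adj2_scale algebra_simps)

lemma nb_poly_eigen: "Adj2 f = (\<lambda>x. \<Lambda> * f x) \<Longrightarrow> nb_poly k f = (\<lambda>x. nb_eigenvalue (real c) (real d) \<Lambda> k * f x)"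
proof (induction "real c" "real d" \<Lambda> k rule: nb_eigenvalue.induct)
  case (3 \<Lambda> k)
  show ?case unfolding nb_poly.simps "3.prems" nb_poly_scale 3(1)[OF "3.prems"] 3(3)[OF "3.prems"]
    by (auto simp: algebra_simps)
qed (auto simp: algebra_simps)

lemma nb_poly_funpow_eigen:
  "Adj2 f = (\<lambda>x. \<Lambda> * f x) \<Longrightarrow> (nb_poly k ^^ a) f = (\<lambda>x. nb_eigenvalue (real c) (real d) \<Lambda> k ^ a * f x)"
proof (induction a)
  case (Suc a)
  show ?case
    unfolding funpow.simps o_apply Suc.IH[OF Suc.prems] nb_poly_scale nb_poly_eigen[OF Suc.prems]
    by (simp add: mult_ac)
qed auto

lemma ip_delta: "v \<in> R \<Longrightarrow> ip (\<lambda>x. if x = v then 1 else 0) g = g v"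
  using finR finL by (simp add: ip_def sum.delta if_distrib[of "\<lambda>x. x * _"] cong: if_cong)

lemma ip_nonneg: "0 \<le> ip g g"
  by (simp add: ip_def sum_nonneg)

text \<open>Cutting the even power in the middle makes the diagonal entry a squared norm. This also
  gives the nonnegativity that Markov's inequality requires.\<close>

lemma trace_entry:
  assumes v: "v \<in> R"
  defines "\<delta> \<equiv> \<lambda>x. if x = v then 1 else 0 :: real"
  shows "(nb_op (2 * k) ^^ (2 * m)) \<delta> v = ip ((nb_poly k ^^ m) \<delta>) ((nb_poly k ^^ m) \<delta>)"
proof -
  have "(nb_op (2 * k) ^^ (2 * m)) \<delta> v = ip \<delta> ((nb_poly k ^^ (2 * m)) \<delta>)"
    using nb_op_nb_poly_funpow[OF v] ip_delta[OF v] by (simp add: \<delta>_def)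
  also have "\<dots> = ip \<delta> ((nb_poly k ^^ m) ((nb_poly k ^^ m) \<delta>))"
    by (simp add: mult_2 funpow_add)
  also have "\<dots> = ip ((nb_poly k ^^ m) \<delta>) ((nb_poly k ^^ m) \<delta>)" by (rule nb_poly_funpow_ip)
  finally show ?thesis .
qed

text \<open>Takes the place of a diagonalisation. With P = \<open>nb_poly k\<close>, the inner
  product of P^m \<delta>_v and f is \<mu>^m f(v), so by Cauchy-Schwarz the diagonal entry at v is
  at least \<mu>^(2m) f(v)^2 / |f|^2, and these bounds add up to \<mu>^(2m).\<close>

lemma trace_ge:
  assumes eig: "\<And>x. x \<in> R \<Longrightarrow> Adj2 f x = \<Lambda> * f x" and supp: "\<And>x. x \<notin> R \<Longrightarrow> f x = 0" and ne: "\<exists>x\<in>R. f x \<noteq> 0"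
  shows "nb_eigenvalue (real c) (real d) \<Lambda> k ^ (2 * m) \<le> (\<Sum>v\<in>R. (nb_op (2 * k) ^^ (2 * m)) (\<lambda>x. if x = v then 1 else 0) v)"
proof -
  define \<mu> where "\<mu> = nb_eigenvalue (real c) (real d) \<Lambda> k"
  define \<delta> where "\<delta> v = (\<lambda>x. if x = v then 1 else 0 :: real)" for v :: 'v
  have fin: "finite (R \<union> L)" using finR finL by simp
  have ipd: "ip (\<delta> v) g = g v" if "v \<in> R" for v g
    using ip_delta[OF that] by (simp add: \<delta>_def)
  have "Adj2 f = (\<lambda>x. \<Lambda> * f x)"
  proof
    fix x show "Adj2 f x = \<Lambda> * f x"
    proof (cases "x \<in> R")
      case False
      have "Adj f y = 0" if "y \<in> N x" for y
        unfolding Adj_def using N_side[OF that] False N_side supp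
        by (intro sum.neutral) (metis mult_zero_right)
      hence "Adj2 f x = 0" unfolding Adj2_def by (subst Adj_def) simp
      thus ?thesis using supp[OF False] by simp
    qed (rule eig)
  qed
  note eigP = nb_poly_funpow_eigen[OF this, where k = k and a = m, folded \<mu>_def]
  have f0: "0 < ip f f"
  proof -
    obtain x where "x \<in> R" "f x \<noteq> 0" using ne by auto
    moreover from this have "0 < f x * f x" by (metis not_real_square_gt_zero)
    ultimately have "0 < (\<Sum>x\<in>R \<union> L. f x * f x)" using fin by (intro sum_pos2[of _ x]) auto
    thus ?thesis by (simp add: ip_def)
  qed
  have CS: "(ip g h)\<^sup>2 \<le> ip g g * ip h h" for g h
    unfolding ip_def using Cauchy_Schwarz_ineq_sum[of g h "R \<union> L"] by (simp add: power2_eq_square)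
  have entry: "\<mu> ^ (2 * m) * (f v)\<^sup>2 \<le> (nb_op (2 * k) ^^ (2 * m)) (\<delta> v) v * ip f f" if v: "v \<in> R" for v
  proof -
    have w: "(nb_op (2 * k) ^^ (2 * m)) (\<delta> v) v = ip ((nb_poly k ^^ m) (\<delta> v)) ((nb_poly k ^^ m) (\<delta> v))"
      unfolding \<delta>_def by (rule trace_entry[OF v])
    have "ip ((nb_poly k ^^ m) (\<delta> v)) f = \<mu> ^ m * f v"
      using nb_poly_funpow_ip[where g = "\<delta> v" and k = k and a = m and f = f] ipd[OF v]
      by (simp add: eigP)
    thus ?thesis using CS[of "(nb_poly k ^^ m) (\<delta> v)" f] w
      by (simp add: power_mult_distrib mult.commute[of 2] power_mult)
  qed
  have "ip f f = (\<Sum>v\<in>R. (f v)\<^sup>2)"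
    unfolding ip_def by (rule sum.mono_neutral_cong_right) (use fin supp in \<open>auto simp: power2_eq_square\<close>)
  hence "\<mu> ^ (2 * m) * ip f f = (\<Sum>v\<in>R. \<mu> ^ (2 * m) * (f v)\<^sup>2)" by (simp add: sum_distrib_left)
  also have "\<dots> \<le> (\<Sum>v\<in>R. (nb_op (2 * k) ^^ (2 * m)) (\<delta> v) v * ip f f)" by (rule sum_mono) (rule entry)
  also have "\<dots> = (\<Sum>v\<in>R. (nb_op (2 * k) ^^ (2 * m)) (\<delta> v) v) * ip f f" by (simp add: sum_distrib_right)
  finally show ?thesis using f0 unfolding \<mu>_def \<delta>_def by simp
qed

end

section \<open>The trace as a signed count of closed segmented walks\<close>

definition sgn_walk :: "('v set \<Rightarrow> real) \<Rightarrow> 'v list \<Rightarrow> real" where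
  "sgn_walk \<sigma> g = prod_list (map \<sigma> (edge_list g))"

lemma sgn_walk_Cons: "h \<noteq> [] \<Longrightarrow> sgn_walk \<sigma> (y # h) = \<sigma> {hd h, y} * sgn_walk \<sigma> h"
  by (cases h) (auto simp: sgn_walk_def)

locale signed_walks = segmented_walks F R L c d per T + signed_biregular F R L c d \<sigma>
  for F :: "'v set set" and R L c d per T \<sigma>
begin

text \<open>\<open>j\<close> steps remain in the current segment and \<open>s\<close> steps after
  it, whose effect is summarised by \<open>\<phi>\<close>. The vertex that the next step must avoid
  is \<open>h ! 1\<close>; for \<open>j = 0\<close> its value does not enter.\<close>

lemma exts_segment:
  assumes \<phi>: "\<And>g. g \<noteq> [] \<Longrightarrow> per dvd (length g - 1) \<Longrightarrow> (\<Sum>k\<in>exts s g. \<psi> k) = sgn_walk \<sigma> g * \<phi> (hd g)"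
  shows "j < per \<Longrightarrow> h \<noteq> [] \<Longrightarrow> per dvd (length h - 1 + j) \<Longrightarrow>
    (\<Sum>k\<in>exts (j + s) h. \<psi> k) = sgn_walk \<sigma> h * nb_tail j \<phi> (hd h) (h ! 1)"
proof (induction j arbitrary: h)
  case 0
  thus ?case using \<phi> by simp
next
  case (Suc j)
  have "\<not> per dvd (length h - 1)"
  proof
    assume "per dvd (length h - 1)"
    hence "per dvd Suc j" using Suc.prems(3) by (simp only: dvd_add_right_iff)
    thus False using Suc.prems(1) by (simp add: nat_dvd_not_less)
  qed
  hence al: "allowed h = N (hd h) - {h ! 1}" by (auto simp: allowed_def)
  have "(\<Sum>k\<in>exts (Suc j + s) h. \<psi> k) = (\<Sum>y\<in>allowed h. \<Sum>k\<in>exts (j + s) (y # h). \<psi> k)"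
    using sum_exts_Suc[of \<psi> "j + s" h] by simp
  also have "\<dots> = (\<Sum>y\<in>allowed h. sgn_walk \<sigma> (y # h) * nb_tail j \<phi> y (hd h))"
  proof (rule sum.cong[OF refl])
    fix y
    have "h ! 0 = hd h" using Suc.prems(2) by (simp add: hd_conv_nth)
    moreover have "per dvd (length (y # h) - 1 + j)" using Suc.prems by (cases h) auto
    ultimately show "(\<Sum>k\<in>exts (j + s) (y # h). \<psi> k) = sgn_walk \<sigma> (y # h) * nb_tail j \<phi> y (hd h)"
      using Suc.IH[of "y # h"] Suc.prems by simp
  qed
  also have "\<dots> = sgn_walk \<sigma> h * nb_tail (Suc j) \<phi> (hd h) (h ! 1)"
    using sgn_walk_Cons[OF Suc.prems(2)] by (simp add: al sum_distrib_left mult_ac)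
  finally show ?case .
qed

lemma exts_boundary:
  "h \<noteq> [] \<Longrightarrow> per dvd (length h - 1) \<Longrightarrow>
    (\<Sum>g\<in>exts (a * per) h. sgn_walk \<sigma> g * f (hd g)) = sgn_walk \<sigma> h * (nb_op per ^^ a) f (hd h)"
proof (induction a arbitrary: h)
  case (Suc a)
  obtain p where p: "per = Suc p" using per by (cases per) auto
  have al: "allowed h = N (hd h)" using Suc.prems by (auto simp: allowed_def)
  have "(\<Sum>g\<in>exts (Suc a * per) h. sgn_walk \<sigma> g * f (hd g))
      = (\<Sum>y\<in>allowed h. \<Sum>g\<in>exts (p + a * per) (y # h). sgn_walk \<sigma> g * f (hd g))"
  proof -
    have "Suc a * per = Suc (p + a * per)" using p by simp
    thus ?thesis by (simp only: sum_exts_Suc)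
  qed
  also have "\<dots> = (\<Sum>y\<in>allowed h. sgn_walk \<sigma> (y # h) * nb_tail p ((nb_op per ^^ a) f) y (hd h))"
  proof (rule sum.cong[OF refl])
    fix y
    have "h ! 0 = hd h" using Suc.prems(1) by (simp add: hd_conv_nth)
    moreover have "per dvd (length (y # h) - 1 + p)"
    proof -
      have "length (y # h) - 1 + p = (length h - 1) + per" using Suc.prems(1) p by (cases h) auto
      thus ?thesis using Suc.prems(2) by simp
    qed
    ultimately show "(\<Sum>g\<in>exts (p + a * per) (y # h). sgn_walk \<sigma> g * f (hd g)) = sgn_walk \<sigma> (y # h) * nb_tail p ((nb_op per ^^ a) f) y (hd h)"
      using exts_segment[where s = "a * per" and \<psi> = "\<lambda>g. sgn_walk \<sigma> g * f (hd g)" and \<phi> = "(nb_op per ^^ a) f", OF Suc.IH, of p "y # h"] p by simp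
  qed
  also have "\<dots> = sgn_walk \<sigma> h * nb_op per ((nb_op per ^^ a) f) (hd h)"
  proof -
    have "nb_op per \<phi> x = (\<Sum>y\<in>N x. \<sigma> {x, y} * nb_tail p \<phi> y x)" for \<phi> x by (simp add: p)
    thus ?thesis using sgn_walk_Cons[OF Suc.prems(1)] by (simp add: al sum_distrib_left mult_ac)
  qed
  finally show ?case by simp
qed simp

definition hike_trace :: real where
  "hike_trace = (\<Sum>v\<in>R. \<Sum>g\<in>{g \<in> exts T [v]. hd g = v}. sgn_walk \<sigma> g)"

lemma hike_trace_eq:
  assumes "T = 2 * m * per"
  shows "hike_trace = (\<Sum>v\<in>R. (nb_op per ^^ (2 * m)) (\<lambda>x. if x = v then 1 else 0) v)"
  unfolding hike_trace_def
proof (rule sum.cong[OF refl])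
  fix v
  have "(\<Sum>g\<in>{g \<in> exts T [v]. hd g = v}. sgn_walk \<sigma> g) = (\<Sum>g\<in>exts T [v]. sgn_walk \<sigma> g * (if hd g = v then 1 else 0))"
    by (simp add: sum.inter_filter if_distrib cong: if_cong)
  also have "\<dots> = (nb_op per ^^ (2 * m)) (\<lambda>x. if x = v then 1 else 0) v"
    using exts_boundary[of "[v]" "\<lambda>x. if x = v then 1 else 0" "2 * m"] assms by (simp add: sgn_walk_def)
  finally show "(\<Sum>g\<in>{g \<in> exts T [v]. hd g = v}. sgn_walk \<sigma> g) = (nb_op per ^^ (2 * m)) (\<lambda>x. if x = v then 1 else 0) v" .
qed

lemma hike_trace_nonneg:
  assumes "per = 2 * k" "T = 2 * m * per"
  shows "0 \<le> hike_trace"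
  unfolding hike_trace_eq[OF assms(2)]
  by (intro sum_nonneg) (simp add: assms(1) trace_entry ip_nonneg)

lemma hike_trace_ge:
  assumes "per = 2 * k" "T = 2 * m * per"
    and "\<And>x. x \<in> R \<Longrightarrow> Adj2 f x = \<Lambda> * f x" "\<And>x. x \<notin> R \<Longrightarrow> f x = 0" "\<exists>x\<in>R. f x \<noteq> 0"
  shows "nb_eigenvalue (real c) (real d) \<Lambda> k ^ (2 * m) \<le> hike_trace"
  using hike_trace_eq[OF assms(2)] trace_ge[OF assms(3-5), of k m] assms(1) by simp

end

subsection \<open>Random signings\<close>

lemma random_signing_eq:
  "finite F \<Longrightarrow> random_signing F = pmf_of_set (PiE_dflt F 0 (\<lambda>_. {-1, 1}))"
  unfolding random_signing_def by (rule Pi_pmf_of_set) auto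

lemma signings_finite:
  assumes "finite F"
  shows "finite (PiE_dflt F 0 (\<lambda>_. {-1, 1 :: real}))" "PiE_dflt F 0 (\<lambda>_. {-1, 1 :: real}) \<noteq> {}"
  using assms by auto

lemma prod_list_flip:
  "prod_list (map (\<sigma>(e := - \<sigma> e)) es) = (- 1) ^ count_list es e * prod_list (map \<sigma> es)" for \<sigma> :: "'v \<Rightarrow> real"
  by (induction es) auto

text \<open>Reversing the sign of \<open>e\<close> permutes the signings and negates the
  product.\<close>

lemma expectation_sign_odd:
  assumes F: "finite F" and e: "e \<in> F" and odd: "odd (count_list es e)"
  shows "measure_pmf.expectation (random_signing F) (\<lambda>\<sigma>. prod_list (map \<sigma> es)) = 0"
proof -
  let ?S = "PiE_dflt F 0 (\<lambda>_. {-1, 1 :: real})"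
  define \<phi> where "\<phi> \<sigma> = \<sigma>(e := - \<sigma> e)" for \<sigma> :: "'a set \<Rightarrow> real"
  have inv: "\<phi> (\<phi> \<sigma>) = \<sigma>" for \<sigma> by (simp add: \<phi>_def)
  have mem: "\<phi> \<sigma> \<in> ?S" if "\<sigma> \<in> ?S" for \<sigma>
    using that e by (auto simp: \<phi>_def PiE_dflt_def)
  have "(\<Sum>\<sigma>\<in>?S. prod_list (map \<sigma> es)) = (\<Sum>\<sigma>\<in>?S. prod_list (map (\<phi> \<sigma>) es))"
    by (rule sum.reindex_bij_witness[of _ \<phi> \<phi>]) (auto simp: inv mem)
  also have "\<dots> = - (\<Sum>\<sigma>\<in>?S. prod_list (map \<sigma> es))"
    unfolding \<phi>_def prod_list_flip using odd by (simp add: sum_negf)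
  finally have "(\<Sum>\<sigma>\<in>?S. prod_list (map \<sigma> es)) = 0" by simp
  thus ?thesis using signings_finite[OF F] by (simp add: random_signing_eq[OF F] integral_pmf_of_set)
qed

lemma prod_list_sign:
  fixes \<sigma> :: "'v \<Rightarrow> real"
  shows "(\<And>e. e \<in> set es \<Longrightarrow> \<sigma> e = -1 \<or> \<sigma> e = 1) \<Longrightarrow> prod_list (map \<sigma> es) = -1 \<or> prod_list (map \<sigma> es) = 1"
proof (induction es)
  case (Cons e es)
  have "prod_list (map \<sigma> es) = -1 \<or> prod_list (map \<sigma> es) = 1" by (rule Cons.IH) (use Cons.prems in auto)
  thus ?case using Cons.prems[of e] by auto
qed auto

lemma set_random_signing:
  "finite F \<Longrightarrow> \<sigma> \<in> set_pmf (random_signing F) \<Longrightarrow> e \<in> F \<Longrightarrow> \<sigma> e = -1 \<or> \<sigma> e = 1"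
  using signings_finite[of F] by (auto simp: random_signing_eq PiE_dflt_def)

lemma integrable_signing: "finite F \<Longrightarrow> integrable (measure_pmf (random_signing F)) (f :: _ \<Rightarrow> real)"
  using signings_finite[of F] by (intro integrable_measure_pmf_finite) (simp add: random_signing_eq)

context segmented_walks
begin

lemma expectation_sgn_walk:
  assumes g: "wedges g \<subseteq> F"
  shows "measure_pmf.expectation (random_signing F) (\<lambda>\<sigma>. sgn_walk \<sigma> g)
    \<le> (if \<forall>e\<in>wedges g. 2 \<le> count_list (edge_list g) e then 1 else 0)"
proof (cases "\<forall>e\<in>wedges g. 2 \<le> count_list (edge_list g) e")
  case True
  have "measure_pmf.expectation (random_signing F) (\<lambda>\<sigma>. sgn_walk \<sigma> g) \<le> 1"
  proof (rule measure_pmf.integral_le_const[OF integrable_signing[OF finF]], rule AE_pmfI)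
    fix \<sigma> assume "\<sigma> \<in> set_pmf (random_signing F)"
    hence "sgn_walk \<sigma> g = -1 \<or> sgn_walk \<sigma> g = 1"
      unfolding sgn_walk_def by (intro prod_list_sign set_random_signing[OF finF]) (use g in auto)
    thus "sgn_walk \<sigma> g \<le> 1" by auto
  qed
  thus ?thesis using True by simp
next
  case False
  then obtain e where e: "e \<in> wedges g" "\<not> 2 \<le> count_list (edge_list g) e" by auto
  have "count_list (edge_list g) e \<noteq> 0" using e(1) by (simp add: count_list_0_iff)
  hence "count_list (edge_list g) e = 1" using e(2) by linarith
  hence "odd (count_list (edge_list g) e)" by simp
  hence "measure_pmf.expectation (random_signing F) (\<lambda>\<sigma>. sgn_walk \<sigma> g) = 0"
    unfolding sgn_walk_def using e g by (intro expectation_sign_odd[OF finF]) auto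
  thus ?thesis by simp
qed

text \<open>Markov's inequality for the trace, which is at least \<rho>^(2km) whenever an outlier
  exists. The outlier is expressed by an eigenfunction supported on \<open>R\<close>, so that no
  matrix enters here.\<close>

lemma prob_outlier:
  assumes perk: "per = 2 * k" and T: "T = 2 * m * per" and \<rho>: "0 < \<rho>"
    and excX: "\<And>g. wedges g \<subseteq> F \<Longrightarrow> length g \<le> T + 1 \<Longrightarrow> excess g \<le> X"
  shows "measure_pmf.prob (random_signing F) {\<sigma>. \<exists>\<Lambda> f. (\<forall>x\<in>R. signed_biregular.Adj2 F \<sigma> f x = \<Lambda> * f x) \<and>
      (\<forall>x. x \<notin> R \<longrightarrow> f x = 0) \<and> (\<exists>x\<in>R. f x \<noteq> 0) \<and> \<rho> ^ k \<le> \<bar>nb_eigenvalue (real c) (real d) \<Lambda> k\<bar>}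
    \<le> real (card R) * (Q ^ (2 * m) * ((real d - 1) * (real c - 1)) ^ (k * m) * ((real d - 1) * Q) ^ X) / \<rho> ^ (k * (2 * m))"
    (is "measure_pmf.prob _ ?A \<le> real (card R) * ?B / _")
proof -
  let ?M = "random_signing F"
  define Z where "Z \<sigma> = (\<Sum>v\<in>R. \<Sum>g\<in>{g \<in> exts T [v]. hd g = v}. sgn_walk \<sigma> g)" for \<sigma>
  have sw: "signed_walks F R L c d per T \<sigma>" if "\<sigma> \<in> set_pmf ?M" for \<sigma>
  proof unfold_locales
    fix e assume "e \<in> F"
    thus "\<sigma> e * \<sigma> e = 1" using set_random_signing[OF finF that] by fastforce
  qed
  have Z0: "0 \<le> Z \<sigma>" if "\<sigma> \<in> set_pmf ?M" for \<sigma>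
    using signed_walks.hike_trace_nonneg[OF sw[OF that] perk T]
    unfolding signed_walks.hike_trace_def[OF sw[OF that]] Z_def .
  have ZA: "\<rho> ^ (k * (2 * m)) \<le> Z \<sigma>" if \<sigma>: "\<sigma> \<in> set_pmf ?M" "\<sigma> \<in> ?A" for \<sigma>
  proof -
    obtain \<Lambda> f where f: "\<And>x. x \<in> R \<Longrightarrow> signed_biregular.Adj2 F \<sigma> f x = \<Lambda> * f x" "\<And>x. x \<notin> R \<Longrightarrow> f x = 0"
      "\<exists>x\<in>R. f x \<noteq> 0" "\<rho> ^ k \<le> \<bar>nb_eigenvalue (real c) (real d) \<Lambda> k\<bar>"
      using \<sigma>(2) by blast
    have "\<rho> ^ (k * (2 * m)) = (\<rho> ^ k) ^ (2 * m)" by (rule power_mult)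
    also have "\<dots> \<le> \<bar>nb_eigenvalue (real c) (real d) \<Lambda> k\<bar> ^ (2 * m)" using f(4) \<rho>
      by (intro power_mono) auto
    also have "\<dots> = nb_eigenvalue (real c) (real d) \<Lambda> k ^ (2 * m)" by (simp add: power_even_abs)
    also have "\<dots> \<le> Z \<sigma>"
      using signed_walks.hike_trace_ge[OF sw[OF \<sigma>(1)] perk T f(1-3)]
      unfolding signed_walks.hike_trace_def[OF sw[OF \<sigma>(1)]] Z_def .
    finally show ?thesis .
  qed
  have Tk: "T = 4 * (k * m)" using T perk by simp
  have Tp: "T div per = 2 * m" using T per by simp
  have EZ: "measure_pmf.expectation ?M Z \<le> real (card R) * ?B"
  proof -
    have "measure_pmf.expectation ?M Z
        = (\<Sum>v\<in>R. \<Sum>g\<in>{g \<in> exts T [v]. hd g = v}. measure_pmf.expectation ?M (\<lambda>\<sigma>. sgn_walk \<sigma> g))"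
      unfolding Z_def by (simp add: integrable_signing[OF finF] Bochner_Integration.integral_sum)
    also have "\<dots> \<le> (\<Sum>v\<in>R. ?B)"
    proof (rule sum_mono)
      fix v assume v: "v \<in> R"
      let ?good = "\<lambda>g. \<forall>e\<in>wedges g. 2 \<le> count_list (edge_list g) e"
      have hk: "wedges g \<subseteq> F" if "g \<in> exts T [v]" for g
        using exts_hike[OF hike_start[OF v] that] hike_F by blast
      have "(\<Sum>g\<in>{g \<in> exts T [v]. hd g = v}. measure_pmf.expectation ?M (\<lambda>\<sigma>. sgn_walk \<sigma> g))
          \<le> (\<Sum>g\<in>{g \<in> exts T [v]. hd g = v}. if ?good g then 1 else 0)"
        by (intro sum_mono expectation_sgn_walk hk) auto
      also have "\<dots> \<le> (\<Sum>g\<in>exts T [v]. if ?good g then 1 else 0)"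
        by (intro sum_mono2) auto
      also have "\<dots> = real (card {g \<in> exts T [v]. ?good g})"
        by (simp add: sum.inter_filter[symmetric])
      also have "\<dots> \<le> ?B"
        using card_good_hikes[OF _ Tk v excX] perk unfolding Tp by simp
      finally show "(\<Sum>g\<in>{g \<in> exts T [v]. hd g = v}. measure_pmf.expectation ?M (\<lambda>\<sigma>. sgn_walk \<sigma> g)) \<le> ?B" .
    qed
    finally show ?thesis by simp
  qed
  have "measure_pmf.prob ?M ?A \<le> measure_pmf.prob ?M {\<sigma> \<in> space ?M. \<rho> ^ (k * (2 * m)) \<le> Z \<sigma>}"
  proof (rule measure_pmf.finite_measure_mono_AE)
    show "AE \<sigma> in measure_pmf ?M. \<sigma> \<in> ?A \<longrightarrow> \<sigma> \<in> {\<sigma> \<in> space ?M. \<rho> ^ (k * (2 * m)) \<le> Z \<sigma>}"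
      using ZA by (intro AE_pmfI) auto
  qed simp
  also have "\<dots> \<le> measure_pmf.expectation ?M Z / \<rho> ^ (k * (2 * m))"
    using \<rho> Z0 by (intro integral_Markov_inequality_measure[where A = UNIV] integrable_signing[OF finF] AE_pmfI) auto
  also have "\<dots> \<le> real (card R) * ?B / \<rho> ^ (k * (2 * m))"
    using EZ \<rho> by (intro divide_right_mono) auto
  finally show ?thesis .
qed

end

subsection \<open>Random lifts have few cycles\<close>

lemma fibre_matchings_elim:
  assumes "M \<in> fibre_matchings n e" "f \<in> M"
  obtains u v k l where "f = {(u, k), (v, l)}" "e = {u, v}" "u \<noteq> v" "k < n" "l < n"
  using assms unfolding fibre_matchings_def by blast

lemma fibre_matchings_fst: "M \<in> fibre_matchings n e \<Longrightarrow> f \<in> M \<Longrightarrow> fst ` f = e"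
  by (erule fibre_matchings_elim) auto

lemma fibre_matchings_unique:
  "M \<in> fibre_matchings n e \<Longrightarrow> x \<in> e \<times> {..<n} \<Longrightarrow> \<exists>!f. f \<in> M \<and> x \<in> f"
proof -
  assume "M \<in> fibre_matchings n e" "x \<in> e \<times> {..<n}"
  from this(1) have "\<forall>x \<in> e \<times> {..<n}. \<exists>!f. f \<in> M \<and> x \<in> f" by (simp add: fibre_matchings_def)
  thus ?thesis using \<open>x \<in> e \<times> {..<n}\<close> by (rule bspec)
qed

lemma fibre_matchings_transpose:
  assumes M: "M \<in> fibre_matchings n e" and v: "v \<in> e" "l < n" "l' < n"
  defines "\<sigma> \<equiv> Transposition.transpose (v, l) (v, l')"
  shows "(`) \<sigma> ` M \<in> fibre_matchings n e"
proof -
  have fst: "fst (\<sigma> x) = fst x" for x by (auto simp: \<sigma>_def Transposition.transpose_def)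
  have snd: "snd x < n \<Longrightarrow> snd (\<sigma> x) < n" for x using v by (auto simp: \<sigma>_def Transposition.transpose_def)
  have inv: "\<sigma> (\<sigma> x) = x" for x by (simp add: \<sigma>_def)
  have e: "\<sigma> x \<in> e \<times> {..<n}" if "x \<in> e \<times> {..<n}" for x
    using that fst[of x] snd[of x] by (cases "\<sigma> x"; cases x) auto
  have "\<exists>u v k l. \<sigma> ` f = {(u, k), (v, l)} \<and> e = {u, v} \<and> u \<noteq> v \<and> k < n \<and> l < n" if f: "f \<in> M" for f
  proof -
    obtain u v k l where f: "f = {(u, k), (v, l)}" "e = {u, v}" "u \<noteq> v" "k < n" "l < n"
      using fibre_matchings_elim[OF M f] by metis
    have "\<sigma> ` f = {(u, snd (\<sigma> (u, k))), (v, snd (\<sigma> (v, l)))}"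
      using fst[of "(u, k)"] fst[of "(v, l)"] f(1)
      by (metis fst_conv image_empty image_insert prod.collapse)
    thus ?thesis using f snd[of "(u, k)"] snd[of "(v, l)"] by (metis snd_conv)
  qed
  moreover have "\<exists>!f. f \<in> (`) \<sigma> ` M \<and> x \<in> f" if x: "x \<in> e \<times> {..<n}" for x
  proof -
    obtain f where f: "f \<in> M" "\<sigma> x \<in> f" "\<And>f'. f' \<in> M \<Longrightarrow> \<sigma> x \<in> f' \<Longrightarrow> f' = f"
      using fibre_matchings_unique[OF M e[OF x]] by blast
    have mem: "x \<in> \<sigma> ` f' \<longleftrightarrow> \<sigma> x \<in> f'" for f' using inv by (metis image_iff)
    show ?thesis
    proof (rule ex1I[of _ "\<sigma> ` f"])
      show "\<sigma> ` f \<in> (`) \<sigma> ` M \<and> x \<in> \<sigma> ` f" using f(1,2) mem[of f] by (intro conjI imageI) simp_all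
      fix g assume "g \<in> (`) \<sigma> ` M \<and> x \<in> g"
      then obtain f' where f': "f' \<in> M" "g = \<sigma> ` f'" "x \<in> \<sigma> ` f'" by blast
      hence "f' = f" using f(3) mem by blast
      thus "g = \<sigma> ` f" using f' by simp
    qed
  qed
  ultimately show ?thesis
    unfolding fibre_matchings_def by (intro CollectI conjI subsetI ballI) auto
qed

section \<open>The uniform distribution on lifts and the probability of containing given
  edges\<close>

locale lift_space =
  fixes E :: "'a set set" and n :: nat
  assumes finE: "finite E" and E2: "\<And>e. e \<in> E \<Longrightarrow> card e = 2"
begin

definition \<Omega> :: "('a set \<Rightarrow> ('a \<times> nat) set set) set" where
  "\<Omega> = PiE_dflt E {} (fibre_matchings n)"

definition lift_of :: "('a set \<Rightarrow> ('a \<times> nat) set set) \<Rightarrow> ('a \<times> nat) set set" where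
  "lift_of M = (\<Union>e\<in>E. M e)"

definition num_lifts :: "('a \<times> nat) set set \<Rightarrow> nat" where
  "num_lifts T = card {M \<in> \<Omega>. T \<subseteq> lift_of M}"

lemma E_cases: "e \<in> E \<Longrightarrow> \<exists>u v. e = {u, v} \<and> u \<noteq> v"
  using E2 by (metis card_2_iff)

lemma fm_wf: "e \<in> E \<Longrightarrow> finite (fibre_matchings n e) \<and> fibre_matchings n e \<noteq> {}"
  using E_cases fibre_matchings_wf by metis

lemma finite_Omega [simp]: "finite \<Omega>"
  unfolding \<Omega>_def using finE fm_wf by (intro finite_PiE_dflt) auto

lemma Omega_ne: "\<Omega> \<noteq> {}"
  unfolding \<Omega>_def using fm_wf by (subst PiE_dflt_empty_iff) auto

lemma random_lift_eq: "random_lift E n = map_pmf lift_of (pmf_of_set \<Omega>)"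
  unfolding random_lift_def lift_of_def \<Omega>_def
  using Pi_pmf_of_set[OF finE, of "fibre_matchings n" "{}"] fm_wf by (simp add: o_def)

lemma set_random_lift: "set_pmf (random_lift E n) = lift_of ` \<Omega>"
  unfolding random_lift_eq using Omega_ne by simp

lemma OmegaD: "M \<in> \<Omega> \<Longrightarrow> e \<in> E \<Longrightarrow> M e \<in> fibre_matchings n e"
  by (auto simp: \<Omega>_def PiE_dflt_def)

lemma lift_of_iff: "M \<in> \<Omega> \<Longrightarrow> f \<in> lift_of M \<longleftrightarrow> fst ` f \<in> E \<and> f \<in> M (fst ` f)"
  unfolding lift_of_def using fibre_matchings_fst[OF OmegaD] by (metis UN_iff)

lemma lift_of_elim:
  assumes "M \<in> \<Omega>" "f \<in> lift_of M"
  obtains u v k l where "f = {(u, k), (v, l)}" "{u, v} \<in> E" "u \<noteq> v" "k < n" "l < n"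
proof -
  have "fst ` f \<in> E" "f \<in> M (fst ` f)" using assms lift_of_iff by auto
  thus ?thesis using fibre_matchings_elim[OF OmegaD[OF assms(1)]] that by metis
qed

lemma lift_of_ex1:
  assumes M: "M \<in> \<Omega>" and e: "{u, v} \<in> E" and k: "k < n"
  shows "\<exists>!l. l < n \<and> {(u, k), (v, l)} \<in> lift_of M"
proof -
  have uv: "u \<noteq> v" using E2[OF e] by auto
  have fm: "M {u, v} \<in> fibre_matchings n {u, v}" using OmegaD[OF M e] .
  obtain f where f: "f \<in> M {u, v}" "(u, k) \<in> f" "\<And>f'. f' \<in> M {u, v} \<Longrightarrow> (u, k) \<in> f' \<Longrightarrow> f' = f"
    using fibre_matchings_unique[OF fm, of "(u, k)"] k by auto
  obtain u' v' k' l' where f': "f = {(u', k'), (v', l')}" "{u, v} = {u', v'}" "u' \<noteq> v'" "k' < n" "l' < n"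
    using fibre_matchings_elim[OF fm f(1)] by metis
  have "\<exists>l<n. f = {(u, k), (v, l)}"
    using f' f(2) by (auto simp: doubleton_eq_iff insert_commute)
  then obtain l where l: "l < n" "f = {(u, k), (v, l)}" by auto
  have iff: "{(u, k), (v, j)} \<in> lift_of M \<longleftrightarrow> {(u, k), (v, j)} \<in> M {u, v}" for j
    using lift_of_iff[OF M, of "{(u, k), (v, j)}"] e by simp
  show ?thesis
  proof (rule ex1I[of _ l])
    show "l < n \<and> {(u, k), (v, l)} \<in> lift_of M" using l f(1) iff[of l] by simp
    fix j assume "j < n \<and> {(u, k), (v, j)} \<in> lift_of M"
    hence "{(u, k), (v, j)} = f" using iff[of j] by (intro f(3)) auto
    thus "j = l" using l uv by (auto simp: doubleton_eq_iff)
  qed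
qed

text \<open>Exchanging the labels \<open>l\<close> and \<open>l'\<close> over \<open>v\<close>, in
  the matching over \<open>{u, v}\<close> alone, is an involution on lifts that replaces one new
  edge by the other. By \<open>free\<close> it moves no edge of \<open>T\<close>.\<close>

lemma num_lifts_swap_le:
  assumes e: "{u, v} \<in> E" and l: "l < n" "l' < n"
    and free: "\<And>f. f \<in> T \<Longrightarrow> fst ` f = {u, v} \<Longrightarrow> (v, l) \<notin> f \<and> (v, l') \<notin> f"
  shows "num_lifts (insert {(u, k), (v, l)} T) \<le> num_lifts (insert {(u, k), (v, l')} T)"
proof -
  define \<sigma> where "\<sigma> = Transposition.transpose (v, l) (v, l')"
  define \<Phi> where "\<Phi> M = M({u, v} := (`) \<sigma> ` M {u, v})" for M :: "'a set \<Rightarrow> ('a \<times> nat) set set"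
  have uv: "u \<noteq> v" using E2[OF e] by auto
  have inv: "\<sigma> (\<sigma> x) = x" for x by (simp add: \<sigma>_def)
  have PhiPhi: "\<Phi> (\<Phi> M) = M" for M by (simp add: \<Phi>_def image_image inv)
  have Phi: "\<Phi> M \<in> \<Omega>" if "M \<in> \<Omega>" for M
  proof -
    have "(`) \<sigma> ` M {u, v} \<in> fibre_matchings n {u, v}"
      unfolding \<sigma>_def by (rule fibre_matchings_transpose[OF OmegaD[OF that e]]) (use l in auto)
    thus ?thesis using that e by (auto simp: \<Omega>_def PiE_dflt_def \<Phi>_def)
  qed
  have "card {M \<in> \<Omega>. insert {(u, k), (v, l)} T \<subseteq> lift_of M} \<le> card {M \<in> \<Omega>. insert {(u, k), (v, l')} T \<subseteq> lift_of M}"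
  proof (rule card_inj_on_le[of \<Phi>])
    show "inj_on \<Phi> {M \<in> \<Omega>. insert {(u, k), (v, l)} T \<subseteq> lift_of M}"
      by (rule inj_on_inverseI[of _ \<Phi>]) (rule PhiPhi)
    show "\<Phi> ` {M \<in> \<Omega>. insert {(u, k), (v, l)} T \<subseteq> lift_of M} \<subseteq> {M \<in> \<Omega>. insert {(u, k), (v, l')} T \<subseteq> lift_of M}"
    proof
      fix M' assume "M' \<in> \<Phi> ` {M \<in> \<Omega>. insert {(u, k), (v, l)} T \<subseteq> lift_of M}"
      then obtain M where M: "M \<in> \<Omega>" "insert {(u, k), (v, l)} T \<subseteq> lift_of M" "M' = \<Phi> M" by blast
      have "f \<in> lift_of (\<Phi> M)" if f: "f \<in> insert {(u, k), (v, l')} T" for f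
      proof (cases "f \<in> T \<and> fst ` f \<noteq> {u, v}")
        case True
        hence "f \<in> lift_of M" using M by auto
        thus ?thesis using True lift_of_iff[OF M(1)] lift_of_iff[OF Phi[OF M(1)]] by (auto simp: \<Phi>_def)
      next
        case False
        have ff: "fst ` f = {u, v}" using False f by auto
        have "\<sigma> ` f \<in> M {u, v}"
        proof (cases "f \<in> T")
          case True
          hence "\<sigma> ` f = id ` f" using free[OF True ff]
            by (intro image_cong) (auto simp: \<sigma>_def Transposition.transpose_def)
          moreover have "f \<in> M {u, v}" using M True ff lift_of_iff[OF M(1), of f] by auto
          ultimately show ?thesis by simp
        next
          case False
          hence "f = {(u, k), (v, l')}" using f by auto
          hence "\<sigma> ` f = {(u, k), (v, l)}" using uv by (auto simp: \<sigma>_def Transposition.transpose_def)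
          moreover have "{(u, k), (v, l)} \<in> lift_of M" using M by auto
          ultimately show ?thesis using lift_of_iff[OF M(1), of "{(u, k), (v, l)}"] by auto
        qed
        moreover have "f = \<sigma> ` (image \<sigma> f)" by (simp add: image_image inv)
        ultimately have "f \<in> \<Phi> M {u, v}" by (auto simp: \<Phi>_def)
        thus ?thesis using lift_of_iff[OF Phi[OF M(1)]] ff e by auto
      qed
      thus "M' \<in> {M \<in> \<Omega>. insert {(u, k), (v, l')} T \<subseteq> lift_of M}" using Phi[OF M(1)] M(3) by blast
    qed
  qed simp
  thus ?thesis by (simp add: num_lifts_def)
qed

lemma sum_num_lifts:
  assumes e: "{u, v} \<in> E" and k: "k < n"
  shows "(\<Sum>l<n. num_lifts (insert {(u, k), (v, l)} T)) = num_lifts T"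
proof -
  have "{M \<in> \<Omega>. T \<subseteq> lift_of M} = (\<Union>l\<in>{..<n}. {M \<in> \<Omega>. insert {(u, k), (v, l)} T \<subseteq> lift_of M})"
  proof (intro equalityI subsetI)
    fix M assume M: "M \<in> {M \<in> \<Omega>. T \<subseteq> lift_of M}"
    then obtain l where "l < n" "{(u, k), (v, l)} \<in> lift_of M" using lift_of_ex1[OF _ e k, of M] by auto
    thus "M \<in> (\<Union>l\<in>{..<n}. {M \<in> \<Omega>. insert {(u, k), (v, l)} T \<subseteq> lift_of M})" using M by auto
  qed auto
  moreover have "card \<dots> = (\<Sum>l<n. card {M \<in> \<Omega>. insert {(u, k), (v, l)} T \<subseteq> lift_of M})"
    by (rule card_UN_disjoint) (use lift_of_ex1[OF _ e k] in auto)
  ultimately show ?thesis by (simp add: num_lifts_def)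
qed

text \<open>Given that the lift contains \<open>T\<close>, a further edge has probability at most 1
  / (n - card T). All end points over \<open>v\<close> not yet matched over \<open>{u, v}\<close>
  are equally likely by the exchange of labels, and at most \<open>card T\<close> are already
  matched; such an end point is impossible for a new edge.\<close>

lemma num_lifts_insert_le:
  assumes e: "{u, v} \<in> E" and k: "k < n" and l: "l < n" and T: "finite T" "\<And>f. f \<in> T \<Longrightarrow> card f = 2"
    and fresh: "{(u, k), (v, l)} \<notin> T"
  shows "num_lifts (insert {(u, k), (v, l)} T) * (n - card T) \<le> num_lifts T"
proof -
  have uv: "u \<noteq> v" using E2[OF e] by auto
  define T' where "T' = {f \<in> T. fst ` f = {u, v}}"
  define free where "free = {j. j < n \<and> (\<forall>f\<in>T'. (v, j) \<notin> f)}"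
  have finfree: "finite free" by (auto simp: free_def)
  have form: "\<exists>i j. f = {(u, i), (v, j)}" if f: "f \<in> T'" for f
  proof -
    obtain i j where ij: "(u, i) \<in> f" "(v, j) \<in> f" using f unfolding T'_def by force
    have f2: "card f = 2" using f T(2) by (simp add: T'_def)
    have "{(u, i), (v, j)} = f"
      by (rule card_subset_eq) (use ij f2 uv card_ge_0_finite[of f] in auto)
    thus ?thesis by metis
  qed
  show ?thesis
  proof (cases "l \<in> free")
    case True
    have sub: "{..<n} - free \<subseteq> (\<lambda>f. THE j. (v, j) \<in> f) ` T'"
    proof
      fix j assume "j \<in> {..<n} - free"
      then obtain f where f: "f \<in> T'" "(v, j) \<in> f" by (auto simp: free_def)
      obtain i j' where "f = {(u, i), (v, j')}" using form[OF f(1)] by auto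
      hence "(THE j. (v, j) \<in> f) = j" using f uv by (intro the_equality) auto
      thus "j \<in> (\<lambda>f. THE j. (v, j) \<in> f) ` T'" using f by auto
    qed
    have "card ({..<n} - free) \<le> card ((\<lambda>f. THE j. (v, j) \<in> f) ` T')"
      by (rule card_mono[OF _ sub]) (use T in \<open>auto simp: T'_def\<close>)
    also have "\<dots> \<le> card T'" by (rule card_image_le) (use T in \<open>auto simp: T'_def\<close>)
    also have "\<dots> \<le> card T" by (rule card_mono) (use T in \<open>auto simp: T'_def\<close>)
    finally have "n - card free \<le> card T"
      by (subst (asm) card_Diff_subset) (auto simp: finfree free_def)
    hence "n - card T \<le> card free" by linarith
    hence "num_lifts (insert {(u, k), (v, l)} T) * (n - card T) \<le> (\<Sum>j\<in>free. num_lifts (insert {(u, k), (v, l)} T))"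
      by simp
    also have "\<dots> \<le> (\<Sum>j\<in>free. num_lifts (insert {(u, k), (v, j)} T))"
      by (intro sum_mono num_lifts_swap_le e) (use True in \<open>auto simp: free_def T'_def\<close>)
    also have "\<dots> \<le> (\<Sum>j<n. num_lifts (insert {(u, k), (v, j)} T))"
      by (rule sum_mono2) (auto simp: free_def)
    finally show ?thesis using sum_num_lifts[OF e k] by simp
  next
    case False
    then obtain f where f: "f \<in> T'" "(v, l) \<in> f" using l by (auto simp: free_def)
    have "{M \<in> \<Omega>. insert {(u, k), (v, l)} T \<subseteq> lift_of M} = {}"
    proof (rule ccontr)
      assume "\<not> ?thesis"
      then obtain M where M: "M \<in> \<Omega>" "insert {(u, k), (v, l)} T \<subseteq> lift_of M" by auto
      obtain i where i: "f = {(u, i), (v, l)}" using form[OF f(1)] f(2) uv by auto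
      have "f \<in> lift_of M" using M f by (auto simp: T'_def)
      then obtain a b ka la where "f = {(a, ka), (b, la)}" "ka < n" "la < n" using lift_of_elim[OF M(1)]
        by metis
      hence "i < n" using i by (auto simp: doubleton_eq_iff)
      have e': "{v, u} \<in> E" using e by (simp add: insert_commute)
      have "{(v, l), (u, i)} \<in> lift_of M" "{(v, l), (u, k)} \<in> lift_of M"
        using \<open>f \<in> lift_of M\<close> i M(2) by (auto simp: insert_commute)
      hence "i = k" using lift_of_ex1[OF M(1) e' l] k \<open>i < n\<close> by blast
      thus False using fresh f i by (auto simp: T'_def)
    qed
    hence "num_lifts (insert {(u, k), (v, l)} T) = 0" unfolding num_lifts_def by (metis card.empty)
    thus ?thesis by simp
  qed
qed

text \<open>A walk in a lift is determined by its first vertex and its projection to the base graph. The list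
  \<open>bs\<close> is the projection of the steps that are still to be made after the history \<open>h\<close>.\<close>

fun excessive :: "('a \<times> nat) set set \<Rightarrow> 'a list \<Rightarrow> ('a \<times> nat) list \<Rightarrow> nat \<Rightarrow> bool" where
  "excessive F [] h X \<longleftrightarrow> wedges h \<subseteq> F \<and> X \<le> excess h"
| "excessive F (b # bs) h X \<longleftrightarrow> (\<exists>l<n. excessive F bs ((b, l) # h) X)"

lemma excessive_wedges: "excessive F bs h X \<Longrightarrow> wedges h \<subseteq> F"
proof (induction bs arbitrary: h)
  case (Cons b bs)
  then obtain l where "wedges ((b, l) # h) \<subseteq> F" by auto
  thus ?case by (cases h) auto
qed auto

lemma excessiveI:
  "wedges (g @ h) \<subseteq> F \<Longrightarrow> X \<le> excess (g @ h) \<Longrightarrow> (\<And>x. x \<in> set g \<Longrightarrow> snd x < n) \<Longrightarrow> excessive F (rev (map fst g)) h X"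
proof (induction g arbitrary: h rule: rev_induct)
  case (snoc x g)
  have "excessive F (rev (map fst g)) (x # h) X" using snoc.prems by (intro snoc.IH) auto
  thus ?case using snoc.prems(3)[of x] by (cases x) auto
qed auto

text \<open>The lift is revealed along the walk. A step along an edge of the history is forced; a
  fresh step leads to one of at most \<open>s\<close> old vertices with conditional probability at
  most \<rho>. So with t + 1 steps left, Y + 1 closures cost at most (\<rho> t)^(Y+1) + \<rho>
  (\<rho> t)^Y <= (\<rho> (t + 1))^(Y+1), in effect a union bound over the times of the
  closures.\<close>

lemma card_excessive:
  assumes s: "s < n"
  defines "\<rho> \<equiv> real s / real (n - s)"
  shows "h \<noteq> [] \<Longrightarrow> snd (hd h) < n \<Longrightarrow> length h + length bs \<le> s \<Longrightarrow> (\<And>f. f \<in> wedges h \<Longrightarrow> card f = 2) \<Longrightarrow>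
    real (card {M \<in> \<Omega>. excessive (lift_of M) bs h X}) \<le> real (num_lifts (wedges h)) * (\<rho> * real (length bs)) ^ (X - excess h)"
proof (induction bs arbitrary: h)
  case Nil
  show ?case
  proof (cases "X \<le> excess h")
    case True
    thus ?thesis by (simp add: num_lifts_def)
  qed auto
next
  case (Cons b bs)
  have rho: "0 \<le> \<rho>" by (simp add: \<rho>_def)
  obtain u k h' where h: "h = (u, k) # h'" using Cons.prems(1) by (cases h) auto
  have k: "k < n" using Cons.prems h by simp
  let ?W = "wedges h" and ?t = "real (length bs)"
  have finW: "finite ?W" by simp
  show ?case
  proof (cases "X \<le> excess h")
    case True
    have "card {M \<in> \<Omega>. excessive (lift_of M) (b # bs) h X} \<le> num_lifts ?W"
      unfolding num_lifts_def using excessive_wedges[of _ "b # bs" h X]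
      by (intro card_mono) (auto simp del: excessive.simps)
    thus ?thesis using True by simp
  next
    case X: False
    show ?thesis
    proof (cases "{u, b} \<in> E")
      case False
      have "{M \<in> \<Omega>. excessive (lift_of M) (b # bs) h X} = {}"
      proof (rule ccontr)
        assume "\<not> ?thesis"
        then obtain M l where M: "M \<in> \<Omega>" "excessive (lift_of M) bs ((b, l) # h) X" by auto
        hence "{(u, k), (b, l)} \<in> lift_of M" using excessive_wedges[OF M(2)] h by auto
        hence "fst ` {(u, k), (b, l)} \<in> E" using lift_of_iff[OF M(1)] by blast
        thus False using False by simp
      qed
      thus ?thesis using rho by (metis card.empty mult_nonneg_nonneg of_nat_0 of_nat_0_le_iff zero_le_power)
    next
      case e: True
      have c2: "card f = 2" if "f \<in> wedges ((b, l) # h)" for f l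
        using that Cons.prems(4)[of f] h E2[OF e] by (auto simp: card_insert_if split: if_splits)
      show ?thesis
      proof (cases "\<exists>l0<n. {(u, k), (b, l0)} \<in> ?W")
        case True
        then obtain l0 where l0: "l0 < n" "{(u, k), (b, l0)} \<in> ?W" by auto
        have "{M \<in> \<Omega>. excessive (lift_of M) (b # bs) h X} \<subseteq> {M \<in> \<Omega>. excessive (lift_of M) bs ((b, l0) # h) X}"
        proof safe
          fix M assume M: "M \<in> \<Omega>" "excessive (lift_of M) (b # bs) h X"
          then obtain l where l: "l < n" "excessive (lift_of M) bs ((b, l) # h) X" by auto
          have "wedges ((b, l) # h) \<subseteq> lift_of M" using excessive_wedges[OF l(2)] .
          hence "{(u, k), (b, l)} \<in> lift_of M" "{(u, k), (b, l0)} \<in> lift_of M" using l0 h by auto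
          hence "l = l0" using lift_of_ex1[OF M(1) e k] l l0 by blast
          thus "excessive (lift_of M) bs ((b, l0) # h) X" using l by simp
        qed
        hence "card {M \<in> \<Omega>. excessive (lift_of M) (b # bs) h X} \<le> card {M \<in> \<Omega>. excessive (lift_of M) bs ((b, l0) # h) X}"
          by (intro card_mono) auto
        also have "real \<dots> \<le> real (num_lifts (wedges ((b, l0) # h))) * (\<rho> * ?t) ^ (X - excess ((b, l0) # h))"
          by (rule Cons.IH) (use Cons.prems c2 l0 in auto)
        also have "wedges ((b, l0) # h) = ?W" using h l0 by auto
        also have "excess ((b, l0) # h) = excess h" using h l0 by auto
        also have "(\<rho> * ?t) ^ (X - excess h) \<le> (\<rho> * real (length (b # bs))) ^ (X - excess h)"
          using rho by (intro power_mono mult_left_mono) auto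
        finally show ?thesis by (simp add: mult_left_mono)
      next
        case fresh: False
        obtain Y where Y: "X - excess h = Suc Y" using X by (cases "X - excess h") auto
        define O' where "O' = {l. l < n \<and> (b, l) \<in> set h}"
        have "card O' \<le> card (set h)"
          by (rule card_inj_on_le[of "\<lambda>l. (b, l)"]) (auto simp: O'_def inj_on_def)
        hence cO: "card O' \<le> s" using card_length[of h] Cons.prems by simp
        have "card ?W \<le> length (edge_list h)" by (rule card_length)
        hence cW: "card ?W \<le> s" using Cons.prems by (simp add: length_edge_list)
        let ?c = "\<lambda>l. real (num_lifts (insert {(u, k), (b, l)} ?W))"
        have cnt_le: "?c l \<le> real (num_lifts ?W) / real (n - s)" if "l < n" for l
        proof -
          have "num_lifts (insert {(u, k), (b, l)} ?W) * (n - card ?W) \<le> num_lifts ?W"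
          proof (rule num_lifts_insert_le[OF e k that finW])
            show "{(u, k), (b, l)} \<notin> ?W" using fresh that by blast
          qed (use Cons.prems in auto)
          hence "num_lifts (insert {(u, k), (b, l)} ?W) * (n - s) \<le> num_lifts ?W"
            using cW by (meson diff_le_mono2 le_trans mult_le_mono2)
          hence "?c l * real (n - s) \<le> real (num_lifts ?W)"
            unfolding of_nat_mult[symmetric] of_nat_le_iff .
          thus ?thesis using s by (simp add: field_simps)
        qed
        have step: "real (card {M \<in> \<Omega>. excessive (lift_of M) bs ((b, l) # h) X}) \<le>
            ?c l * (\<rho> * ?t) ^ (if l \<in> O' then Y else Suc Y)" if l: "l < n" for l
        proof -
          have "{(u, k), (b, l)} \<notin> ?W" using fresh l by blast
          hence "excess ((b, l) # h) = excess h + (if l \<in> O' then 1 else 0)" using h l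
            by (auto simp: O'_def)
          hence X1: "X - excess ((b, l) # h) = (if l \<in> O' then Y else Suc Y)" using Y by auto
          have X2: "wedges ((b, l) # h) = insert {(u, k), (b, l)} ?W" using h by auto
          have "real (card {M \<in> \<Omega>. excessive (lift_of M) bs ((b, l) # h) X})
              \<le> real (num_lifts (wedges ((b, l) # h))) * (\<rho> * ?t) ^ (X - excess ((b, l) # h))"
            by (rule Cons.IH) (use Cons.prems c2 l in auto)
          thus ?thesis unfolding X1 X2 .
        qed
        have "{M \<in> \<Omega>. excessive (lift_of M) (b # bs) h X} = (\<Union>l\<in>{..<n}. {M \<in> \<Omega>. excessive (lift_of M) bs ((b, l) # h) X})"
          by auto
        hence "card {M \<in> \<Omega>. excessive (lift_of M) (b # bs) h X} \<le> (\<Sum>l<n. card {M \<in> \<Omega>. excessive (lift_of M) bs ((b, l) # h) X})"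
          using card_UN_le[of "{..<n}" "\<lambda>l. {M \<in> \<Omega>. excessive (lift_of M) bs ((b, l) # h) X}"] by simp
        hence "real (card {M \<in> \<Omega>. excessive (lift_of M) (b # bs) h X}) \<le> (\<Sum>l<n. real (card {M \<in> \<Omega>. excessive (lift_of M) bs ((b, l) # h) X}))"
          unfolding of_nat_sum[symmetric] of_nat_le_iff .
        also have "\<dots> \<le> (\<Sum>l<n. ?c l * (\<rho> * ?t) ^ (if l \<in> O' then Y else Suc Y))"
          by (intro sum_mono step) auto
        also have "\<dots> \<le> (\<Sum>l<n. ?c l * (\<rho> * ?t) ^ Suc Y + (if l \<in> O' then ?c l * (\<rho> * ?t) ^ Y else 0))"
          using rho by (intro sum_mono) auto
        also have "\<dots> = (\<Sum>l<n. ?c l) * (\<rho> * ?t) ^ Suc Y + (\<Sum>l\<in>O'. ?c l) * (\<rho> * ?t) ^ Y"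
        proof -
          have "(\<Sum>l<n. if l \<in> O' then ?c l * (\<rho> * ?t) ^ Y else 0) = (\<Sum>l\<in>O'. ?c l * (\<rho> * ?t) ^ Y)"
            by (rule sum.mono_neutral_cong_right) (auto simp: O'_def)
          thus ?thesis by (simp add: sum.distrib sum_distrib_right)
        qed
        also have "\<dots> \<le> real (num_lifts ?W) * (\<rho> * ?t) ^ Suc Y + real (num_lifts ?W) * \<rho> * (\<rho> * ?t) ^ Y"
        proof -
          have sum_c: "(\<Sum>l<n. ?c l) = real (num_lifts ?W)"
            unfolding of_nat_sum[symmetric] sum_num_lifts[OF e k, of ?W] ..
          have "(\<Sum>l\<in>O'. ?c l) \<le> (\<Sum>l\<in>O'. real (num_lifts ?W) / real (n - s))"
            by (intro sum_mono cnt_le) (auto simp: O'_def)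
          also have "\<dots> = real (card O') * (real (num_lifts ?W) / real (n - s))" by simp
          also have "\<dots> \<le> real s * (real (num_lifts ?W) / real (n - s))" using cO
            by (intro mult_right_mono) auto
          finally have "(\<Sum>l\<in>O'. ?c l) \<le> real (num_lifts ?W) * \<rho>" by (simp add: \<rho>_def mult_ac)
          thus ?thesis using rho sum_c by (intro add_mono mult_right_mono) auto
        qed
        also have "\<dots>
           = real (num_lifts ?W) * (\<rho> * real (length (b # bs))) * (\<rho> * ?t) ^ Y" by (simp add: algebra_simps)
        also have "\<dots> \<le> real (num_lifts ?W) * (\<rho> * real (length (b # bs))) * (\<rho> * real (length (b # bs))) ^ Y"
          using rho by (intro mult_left_mono power_mono) auto
        finally show ?thesis unfolding Y power_Suc by (simp only: mult.assoc add_mono)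
      qed
    qed
  qed
qed

text \<open>Union bound over the label of the first vertex and over the projection of the walk, a
  word of length at most \<open>s\<close> over \<open>B\<close>.\<close>

lemma prob_excess:
  assumes s: "s < n" and X: "1 \<le> X" and B: "finite B" "\<Union>E \<subseteq> B" "1 \<le> card B"
  shows "measure_pmf.prob (random_lift E n) {F. \<exists>g. wedges g \<subseteq> F \<and> length g \<le> s \<and> X \<le> excess g}
    \<le> real n * ((real s + 1) * real (card B) ^ s) * (real s / real (n - s) * real s) ^ X"
proof -
  let ?P = "\<lambda>F. \<exists>g. wedges g \<subseteq> F \<and> length g \<le> s \<and> X \<le> excess g"
  define Ws where "Ws = {w. set w \<subseteq> B \<and> length w \<le> s}"
  define D where "D = (real s / real (n - s) * real s) ^ X"
  let ?S = "\<lambda>k w. {M \<in> \<Omega>. w \<noteq> [] \<and> excessive (lift_of M) (tl w) [(hd w, k)] X}"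
  have finW: "finite Ws" unfolding Ws_def using B finite_lists_length_le by auto
  have "card Ws = (\<Sum>i\<le>s. card B ^ i)" unfolding Ws_def by (rule card_lists_length_le[OF B(1)])
  also have "\<dots> \<le> (\<Sum>i\<le>s. card B ^ s)" using B by (intro sum_mono power_increasing) auto
  finally have cW: "card Ws \<le> (s + 1) * card B ^ s" by simp
  have each: "real (card (?S k w)) \<le> real (card \<Omega>) * D" if k: "k < n" and w: "w \<in> Ws" for k w
  proof (cases w)
    case (Cons b bs)
    have "real (card {M \<in> \<Omega>. excessive (lift_of M) bs [(b, k)] X}) \<le>
       real (num_lifts (wedges [(b, k)])) * (real s / real (n - s) * real (length bs)) ^ (X - excess [(b, k)])"
      by (rule card_excessive[OF s]) (use k w Cons in \<open>auto simp: Ws_def\<close>)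
    also have "\<dots> = real (card \<Omega>) * (real s / real (n - s) * real (length bs)) ^ X"
      by (simp add: num_lifts_def)
    also have "\<dots> \<le> real (card \<Omega>) * D" unfolding D_def
      using w Cons by (intro mult_left_mono power_mono) (auto simp: Ws_def)
    finally show ?thesis using Cons by simp
  qed (simp add: D_def)
  have sub: "{M \<in> \<Omega>. ?P (lift_of M)} \<subseteq> (\<Union>k\<in>{..<n}. \<Union>w\<in>Ws. ?S k w)"
  proof
    fix M assume "M \<in> {M \<in> \<Omega>. ?P (lift_of M)}"
    then obtain g where M: "M \<in> \<Omega>" and g: "wedges g \<subseteq> lift_of M" "length g \<le> s" "X \<le> excess g" by auto
    \<comment> \<open>\<open>1 <= X\<close> forces at least one step, so every vertex of
      \<open>g\<close> lies on an edge of the lift. Only this confines the labels to those below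
      \<open>n\<close> and the projections to \<open>B\<close>.\<close>
    have snd: "snd x < n \<and> fst x \<in> B" if x: "x \<in> set g" for x
    proof -
      obtain i where i: "x = g ! i" "i < length g" using x by (metis in_set_conv_nth)
      have "2 \<le> length g"
      proof (rule ccontr)
        assume "\<not> ?thesis"
        hence "excess g = 0" by (cases g; cases "tl g") auto
        thus False using g X by simp
      qed
      hence "\<exists>e\<in>wedges g. x \<in> e"
      proof (cases i)
        case 0
        thus ?thesis using i \<open>2 \<le> length g\<close> by (cases g rule: edge_list.cases) auto
      next
        case (Suc j)
        have "i < length h \<Longrightarrow> 0 < i \<Longrightarrow> \<exists>e\<in>wedges h. h ! i \<in> e" for h :: "('a \<times> nat) list"
        proof (induction h arbitrary: i rule: edge_list.induct)
          case (1 y x xs)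
          thus ?case
          proof (cases "i = 1")
            case False
            then obtain i' where "i = Suc i'" "0 < i'" using 1 by (cases i) auto
            thus ?thesis using "1.IH"[of i'] "1.prems" by auto
          qed auto
        qed auto
        thus ?thesis using i Suc by auto
      qed
      then obtain e where e: "e \<in> lift_of M" "x \<in> e" using g by auto
      from lift_of_elim[OF M e(1)] obtain u v k l
        where e': "e = {(u, k), (v, l)}" "{u, v} \<in> E" "k < n" "l < n" by metis
      have "x = (u, k) \<or> x = (v, l)" using e(2) unfolding e'(1) by blast
      moreover have "{u, v} \<subseteq> B" using e'(2) B(2) by blast
      ultimately show ?thesis using e'(3,4) by fastforce
    qed
    have "g \<noteq> []" using g X by auto
    then obtain g' x where g': "g = g' @ [x]" by (metis append_butlast_last_id)
    have "excessive (lift_of M) (rev (map fst g')) [x] X" by (rule excessiveI) (use g g' snd in auto)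
    moreover define w where "w = fst x # rev (map fst g')"
    moreover have "w \<in> Ws" using snd g g' by (auto simp: Ws_def w_def)
    moreover have "snd x < n" using snd[of x] g' by simp
    ultimately have "snd x \<in> {..<n} \<and> w \<in> Ws \<and> M \<in> ?S (snd x) w" using M by simp
    thus "M \<in> (\<Union>k\<in>{..<n}. \<Union>w\<in>Ws. ?S k w)" by blast
  qed
  have "card {M \<in> \<Omega>. ?P (lift_of M)} \<le> card (\<Union>k\<in>{..<n}. \<Union>w\<in>Ws. ?S k w)"
    by (rule card_mono[OF _ sub]) (use finW in auto)
  also have "\<dots> \<le> (\<Sum>k<n. card (\<Union>w\<in>Ws. ?S k w))" by (rule card_UN_le) auto
  also have "\<dots> \<le> (\<Sum>k<n. \<Sum>w\<in>Ws. card (?S k w))" by (intro sum_mono card_UN_le finW)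
  finally have "real (card {M \<in> \<Omega>. ?P (lift_of M)}) \<le> (\<Sum>k<n. \<Sum>w\<in>Ws. real (card (?S k w)))"
    unfolding of_nat_sum[symmetric] of_nat_le_iff .
  also have "\<dots> \<le> (\<Sum>k<n. \<Sum>w\<in>Ws. real (card \<Omega>) * D)" by (intro sum_mono each) auto
  also have "\<dots> = real n * real (card Ws) * (real (card \<Omega>) * D)" by simp
  also have "\<dots> \<le> real n * ((real s + 1) * real (card B) ^ s) * (real (card \<Omega>) * D)"
  proof -
    have "real (card Ws) \<le> real ((s + 1) * card B ^ s)" using cW unfolding of_nat_le_iff .
    hence "real (card Ws) \<le> (real s + 1) * real (card B) ^ s" by (simp add: algebra_simps)
    thus ?thesis by (intro mult_right_mono mult_left_mono) (auto simp: D_def)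
  qed
  also have "\<dots> = real n * ((real s + 1) * real (card B) ^ s) * D * real (card \<Omega>)" by (simp only: mult_ac)
  finally have main: "real (card {M \<in> \<Omega>. ?P (lift_of M)})
      \<le> real n * ((real s + 1) * real (card B) ^ s) * D * real (card \<Omega>)" .
  have pos: "0 < real (card \<Omega>)" using Omega_ne by (simp add: card_gt_0_iff)
  have "measure_pmf.prob (random_lift E n) {F. ?P F} = real (card {M \<in> \<Omega>. ?P (lift_of M)}) / real (card \<Omega>)"
    unfolding random_lift_eq measure_map_pmf vimage_def
    using Omega_ne by (subst measure_pmf_of_set) (auto simp: Int_def)
  also have "\<dots> \<le> real n * ((real s + 1) * real (card B) ^ s) * D"
    unfolding pos_divide_le_eq[OF pos] by (rule main)
  finally show ?thesis unfolding D_def .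
qed

end

subsection \<open>Spectra of signed lifts of complete bipartite graphs\<close>

lemma prob_bind_le:
  assumes le: "\<And>x. x \<in> set_pmf p \<Longrightarrow> x \<notin> Bad \<Longrightarrow> measure_pmf.prob (f x) A \<le> b" and b: "0 \<le> b"
  shows "measure_pmf.prob (bind_pmf p f) A \<le> measure_pmf.prob p Bad + b"
proof -
  have "emeasure (measure_pmf (bind_pmf p f)) A \<le> (\<integral>\<^sup>+x. indicator Bad x + ennreal b \<partial>measure_pmf p)"
    unfolding emeasure_bind_pmf
  proof (rule nn_integral_mono_AE, rule AE_pmfI)
    fix x assume x: "x \<in> set_pmf p"
    show "emeasure (measure_pmf (f x)) A \<le> indicator Bad x + ennreal b"
    proof (cases "x \<in> Bad")
      case True
      have "emeasure (measure_pmf (f x)) A \<le> 1" by (rule measure_pmf.emeasure_le_1)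
      also have "\<dots> \<le> indicator Bad x + ennreal b" using True by simp
      finally show ?thesis .
    next
      case False
      thus ?thesis using le[OF x] by (simp add: measure_pmf.emeasure_eq_measure ennreal_leI)
    qed
  qed
  also have "\<dots> = emeasure (measure_pmf p) Bad + ennreal b"
    by (subst nn_integral_add) (auto simp: measure_pmf.emeasure_space_1)
  also have "\<dots> = ennreal (measure_pmf.prob p Bad + b)"
    using b by (simp add: measure_pmf.emeasure_eq_measure ennreal_plus)
  finally have "ennreal (measure_pmf.prob (bind_pmf p f) A) \<le> ennreal (measure_pmf.prob p Bad + b)"
    unfolding measure_pmf.emeasure_eq_measure .
  thus ?thesis by (subst (asm) ennreal_le_iff) (use b in auto)
qed

context lift_space
begin

text \<open>A lift is a covering, so the projection is a bijection between neighbourhoods.\<close>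

lemma card_lift_neighbours:
  assumes M: "M \<in> \<Omega>" and k: "k < n"
  shows "card {y. {(u, k), y} \<in> lift_of M} = card {v. {u, v} \<in> E}"
proof (rule bij_betw_same_card[of fst], rule bij_betw_imageI)
  have mem: "snd y < n \<and> {u, fst y} \<in> E" if y: "{(u, k), y} \<in> lift_of M" for y
  proof -
    from lift_of_elim[OF M y] obtain a b i j where
      ab: "{(u, k), y} = {(a, i), (b, j)}" "{a, b} \<in> E" "i < n" "j < n" by metis
    from ab(1) have "y = (a, i) \<and> (u, k) = (b, j) \<or> y = (b, j) \<and> (u, k) = (a, i)"
      by (auto simp: doubleton_eq_iff)
    thus ?thesis using ab(2-4) by (auto simp: insert_commute)
  qed
  show "inj_on fst {y. {(u, k), y} \<in> lift_of M}"
  proof (rule inj_onI)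
    fix y z assume y: "y \<in> {y. {(u, k), y} \<in> lift_of M}" and z: "z \<in> {y. {(u, k), y} \<in> lift_of M}" and eq: "fst y = fst z"
    have "\<exists>!l. l < n \<and> {(u, k), (fst y, l)} \<in> lift_of M"
      using lift_of_ex1[OF M _ k] mem y by blast
    moreover have "snd y < n \<and> {(u, k), (fst y, snd y)} \<in> lift_of M" using mem y by simp
    moreover have "snd z < n \<and> {(u, k), (fst y, snd z)} \<in> lift_of M" using mem z eq by simp
    ultimately have "snd y = snd z" by blast
    thus "y = z" using eq by (simp add: prod_eq_iff)
  qed
  show "fst ` {y. {(u, k), y} \<in> lift_of M} = {v. {u, v} \<in> E}"
  proof (intro equalityI subsetI)
    fix v assume "v \<in> {v. {u, v} \<in> E}"
    then obtain l where "{(u, k), (v, l)} \<in> lift_of M" using lift_of_ex1[OF M _ k, of u v] by blast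
    thus "v \<in> fst ` {y. {(u, k), y} \<in> lift_of M}" by force
  qed (use mem in auto)
qed

end

section \<open>Lifts of complete bipartite graphs and the eigenfunctions given by PS\<close>

lemma complete_bipartite_lift_space: "lift_space (complete_bipartite_edges d c)"
proof
  show "finite (complete_bipartite_edges d c)"
    by (rule finite_subset[of _ "Pow (Inl ` {..<d} \<union> Inr ` {..<c})"])
      (auto simp: complete_bipartite_edges_def)
  show "card e = 2" if "e \<in> complete_bipartite_edges d c" for e
    using that by (auto simp: complete_bipartite_edges_def)
qed

text \<open>This set serves as \<open>R\<close>: it lies over the part of size \<open>c\<close>, and
  so its vertices have degree \<open>d\<close>.\<close>

definition right_fibres :: "nat \<Rightarrow> nat \<Rightarrow> ((nat + nat) \<times> nat) set" where
  "right_fibres c n = Inr ` {..<c} \<times> {..<n}"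

definition left_fibres :: "nat \<Rightarrow> nat \<Rightarrow> ((nat + nat) \<times> nat) set" where
  "left_fibres d n = Inl ` {..<d} \<times> {..<n}"

lemma complete_bipartite_lift_biregular:
  assumes cd: "2 \<le> c" "c \<le> d" and F: "F \<in> set_pmf (random_lift (complete_bipartite_edges d c) n)"
  shows "biregular F (right_fibres c n) (left_fibres d n) c d"
proof -
  interpret lift_space "complete_bipartite_edges d c" n by (rule complete_bipartite_lift_space)
  obtain M where M: "M \<in> \<Omega>" "F = lift_of M" using F set_random_lift by auto
  show ?thesis
  proof
    show "finite (right_fibres c n)" "finite (left_fibres d n)"
      by (auto simp: right_fibres_def left_fibres_def)
    show "right_fibres c n \<inter> left_fibres d n = {}" by (auto simp: right_fibres_def left_fibres_def)
    show "\<exists>x\<in>right_fibres c n. \<exists>y\<in>left_fibres d n. e = {x, y}" if e: "e \<in> F" for e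
    proof -
      from lift_of_elim[OF M(1)] e M(2) obtain u v k l where
        uv: "e = {(u, k), (v, l)}" "{u, v} \<in> complete_bipartite_edges d c" "k < n" "l < n" by metis
      then obtain i j where ij: "{u, v} = {Inl i, Inr j}" "i < d" "j < c"
        by (auto simp: complete_bipartite_edges_def)
      from ij(1) consider "u = Inl i" "v = Inr j" | "v = Inl i" "u = Inr j"
        by (auto simp: doubleton_eq_iff)
      thus ?thesis
      proof cases
        case 1
        hence "(v, l) \<in> right_fibres c n" "(u, k) \<in> left_fibres d n"
          using uv(3,4) ij(2,3) by (simp_all add: right_fibres_def left_fibres_def)
        thus ?thesis using uv(1) by blast
      next
        case 2
        hence "(u, k) \<in> right_fibres c n" "(v, l) \<in> left_fibres d n"
          using uv(3,4) ij(2,3) by (simp_all add: right_fibres_def left_fibres_def)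
        thus ?thesis using uv(1) by blast
      qed
    qed
    show "card {y. {x, y} \<in> F} = d" if x: "x \<in> right_fibres c n" for x
    proof -
      obtain j k where jk: "x = (Inr j, k)" "j < c" "k < n" using x by (auto simp: right_fibres_def)
      have "{v. {Inr j, v} \<in> complete_bipartite_edges d c} = Inl ` {..<d}"
        using jk(2) by (auto simp: complete_bipartite_edges_def doubleton_eq_iff)
      thus ?thesis using card_lift_neighbours[OF M(1) jk(3), of "Inr j"] jk(1) M(2)
        by (simp add: card_image)
    qed
    show "card {y. {x, y} \<in> F} = c" if x: "x \<in> left_fibres d n" for x
    proof -
      obtain j k where jk: "x = (Inl j, k)" "j < d" "k < n" using x by (auto simp: left_fibres_def)
      have "{v. {Inl j, v} \<in> complete_bipartite_edges d c} = Inr ` {..<c}"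
        using jk(2) by (auto simp: complete_bipartite_edges_def doubleton_eq_iff)
      thus ?thesis using card_lift_neighbours[OF M(1) jk(3), of "Inl j"] jk(1) M(2)
        by (simp add: card_image)
    qed
  qed (use cd in auto)
qed

lemma four_block_adjacency:
  fixes s :: "'v set \<Rightarrow> real"
  assumes "length us = m" "length vs = k"
    and F: "\<And>e. e \<in> F \<Longrightarrow> \<exists>u v. u \<in> set us \<and> v \<in> set vs \<and> e = {u, v}"
    and disj: "set us \<inter> set vs = {}"
  defines "B \<equiv> Matrix.mat m k (\<lambda>(a, b). if {us ! a, vs ! b} \<in> F then s {us ! a, vs ! b} else 0)"
  shows "signed_adjacency_matrix (us @ vs) F s = four_block_mat (0\<^sub>m m m) B (transpose_mat B) (0\<^sub>m k k)"
proof -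
  have sum: "(\<Sum>e \<in> {e \<in> F. e = e'}. s e) = (if e' \<in> F then s e' else 0)" for e'
  proof -
    have "{e \<in> F. e = e'} = (if e' \<in> F then {e'} else {})" by auto
    thus ?thesis by simp
  qed
  have uu: "{us ! a, us ! b} \<notin> F" if "a < m" "b < m" for a b
  proof
    assume "{us ! a, us ! b} \<in> F"
    then obtain u v where uv: "v \<in> set vs" "{us ! a, us ! b} = {u, v}" using F by blast
    hence "v = us ! a \<or> v = us ! b" by (auto simp: doubleton_eq_iff)
    moreover have "us ! a \<in> set us" "us ! b \<in> set us" using that assms(1) by simp_all
    ultimately show False using uv(1) disj by blast
  qed
  have vv: "{vs ! a, vs ! b} \<notin> F" if "a < k" "b < k" for a b
  proof
    assume "{vs ! a, vs ! b} \<in> F"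
    then obtain u v where uv: "u \<in> set us" "{vs ! a, vs ! b} = {u, v}" using F by blast
    hence "u = vs ! a \<or> u = vs ! b" by (auto simp: doubleton_eq_iff)
    moreover have "vs ! a \<in> set vs" "vs ! b \<in> set vs" using that assms(2) by simp_all
    ultimately show False using uv(1) disj by blast
  qed
  show ?thesis
    unfolding signed_adjacency_matrix_def B_def sum using assms(1,2) uu vv
    by (intro eq_matI) (auto simp: nth_append insert_commute)
qed

context signed_biregular
begin

text \<open>The squares of PS are the eigenvalues of the Gram matrix of the block, and this matrix
  represents \<open>Adj2\<close> on functions supported in \<open>R\<close>. So an eigenvector,
  extended by zero, is the eigenfunction sought.\<close>

lemma PS_eigenfunction:
  assumes us: "distinct us" "set us = L" "length us = m" and vs: "distinct vs" "set vs = R" "length vs = k"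
    and km: "k \<le> m" and x: "x \<in># PS m k (signed_adjacency_matrix (us @ vs) F \<sigma>)"
  obtains f where "0 \<le> x" "\<And>z. z \<in> R \<Longrightarrow> Adj2 f z = x\<^sup>2 * f z" "\<And>z. z \<notin> R \<Longrightarrow> f z = 0" "\<exists>z\<in>R. f z \<noteq> 0"
proof -
  define B where "B = Matrix.mat m k (\<lambda>(a, b). if {us ! a, vs ! b} \<in> F then \<sigma> {us ! a, vs ! b} else 0)"
  have Bc: "B \<in> carrier_mat m k" by (simp add: B_def)
  define G where "G = transpose_mat B * B"
  have G: "G \<in> carrier_mat k k" using Bc by (simp add: G_def)
  have "signed_adjacency_matrix (us @ vs) F \<sigma> = four_block_mat (0\<^sub>m m m) B (transpose_mat B) (0\<^sub>m k k)"
    unfolding B_def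
  proof (rule four_block_adjacency[OF us(3) vs(3)])
    show "\<exists>u v. u \<in> set us \<and> v \<in> set vs \<and> e = {u, v}" if "e \<in> F" for e
      using F_cases[OF that] us(2) vs(2) by (metis insert_commute)
    show "set us \<inter> set vs = {}" using RL us(2) vs(2) by auto
  qed
  hence isps: "is_PS m k (signed_adjacency_matrix (us @ vs) F \<sigma>) (image_mset sqrt (proots (char_poly G)))"
    using PS_bipartite[OF Bc km] by (simp add: G_def)
  have "x \<in># image_mset sqrt (proots (char_poly G))" using x unfolding PS_eq[OF isps] .
  moreover from this have "0 \<le> x" using isps unfolding is_PS_def by blast
  ultimately have ps: "0 \<le> x" "x \<in> sqrt ` set_mset (proots (char_poly G))" by auto
  then obtain t where t: "t \<in># proots (char_poly G)" "x = sqrt t" by auto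
  have tx: "t = x\<^sup>2" using ps(1) t(2) by simp
  have "char_poly G \<noteq> 0" using degree_monic_char_poly[OF G] by auto
  hence "poly (char_poly G) (x\<^sup>2) = 0" using t(1) tx by simp
  hence "eigenvalue G (x\<^sup>2)" using eigenvalue_root_char_poly[OF G] by simp
  then obtain w where w: "w \<in> carrier_vec k" "w \<noteq> 0\<^sub>v k" "G *\<^sub>v w = x\<^sup>2 \<cdot>\<^sub>v w"
    using G by (auto simp: eigenvalue_def eigenvector_def)
  define f where "f z = (\<Sum>b<k. if vs ! b = z then w $ b else 0)" for z
  have f_vs: "f (vs ! b) = w $ b" if b: "b < k" for b
  proof -
    have "(if vs ! b' = vs ! b then w $ b' else 0) = (if b' = b then w $ b' else 0)" if "b' < k" for b'
      using vs(1,3) b that by (simp add: nth_eq_iff_index_eq)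
    hence "f (vs ! b) = (\<Sum>b'<k. if b' = b then w $ b' else 0)"
      unfolding f_def by (intro sum.cong refl) auto
    thus ?thesis using b by simp
  qed
  have f_out: "f z = 0" if "z \<notin> R" for z
    unfolding f_def using that vs(2,3) by (intro sum.neutral) auto
  have bij_us: "bij_betw ((!) us) {..<m} L" using us by (intro bij_betw_nth) auto
  have bij_vs: "bij_betw ((!) vs) {..<k} R" using vs by (intro bij_betw_nth) auto
  have AL: "Adj g (us ! a) = (\<Sum>b<k. B $$ (a, b) * g (vs ! b))" if a: "a < m" for a g
  proof -
    have aL: "us ! a \<in> L" using us a by auto
    have "Adj g (us ! a) = (\<Sum>z\<in>R. (if z \<in> N (us ! a) then \<sigma> {us ! a, z} else 0) * g z)"
      unfolding Adj_def by (rule sum.mono_neutral_cong_left)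
        (use finR N_side[of _ "us ! a"] aL RL in auto)
    also have "\<dots> = (\<Sum>b<k. (if vs ! b \<in> N (us ! a) then \<sigma> {us ! a, vs ! b} else 0) * g (vs ! b))"
      by (rule sum.reindex_bij_betw[OF bij_vs, symmetric])
    also have "\<dots> = (\<Sum>b<k. B $$ (a, b) * g (vs ! b))"
      using a by (intro sum.cong) (auto simp: B_def N_def)
    finally show ?thesis .
  qed
  have AR: "Adj g (vs ! b) = (\<Sum>a<m. B $$ (a, b) * g (us ! a))" if b: "b < k" for b g
  proof -
    have bR: "vs ! b \<in> R" using vs b by auto
    have "Adj g (vs ! b) = (\<Sum>z\<in>L. (if z \<in> N (vs ! b) then \<sigma> {vs ! b, z} else 0) * g z)"
      unfolding Adj_def by (rule sum.mono_neutral_cong_left)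
        (use finL N_side[of _ "vs ! b"] bR RL in auto)
    also have "\<dots> = (\<Sum>a<m. (if us ! a \<in> N (vs ! b) then \<sigma> {vs ! b, us ! a} else 0) * g (us ! a))"
      by (rule sum.reindex_bij_betw[OF bij_us, symmetric])
    also have "\<dots> = (\<Sum>a<m. B $$ (a, b) * g (us ! a))"
      using b by (intro sum.cong) (auto simp: B_def N_def insert_commute)
    finally show ?thesis .
  qed
  have "Adj2 f z = x\<^sup>2 * f z" if z: "z \<in> R" for z
  proof -
    obtain b where b: "b < k" "z = vs ! b" using z bij_vs by (auto simp: bij_betw_def)
    have "Adj2 f z = (\<Sum>a<m. B $$ (a, b) * (\<Sum>b'<k. B $$ (a, b') * w $ b'))"
      unfolding Adj2_def b(2) AR[OF b(1)] using AL f_vs by simp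
    also have "\<dots> = (transpose_mat B *\<^sub>v (B *\<^sub>v w)) $ b"
      using Bc w(1) b(1) by (simp add: scalar_prod_def lessThan_atLeast0)
    also have "transpose_mat B *\<^sub>v (B *\<^sub>v w) = G *\<^sub>v w"
      unfolding G_def using Bc w(1) by (subst assoc_mult_mat_vec[of _ k m _ k]) auto
    also have "(G *\<^sub>v w) $ b = x\<^sup>2 * f z" using w b f_vs by simp
    finally show ?thesis .
  qed
  moreover have "\<exists>z\<in>R. f z \<noteq> 0"
  proof -
    obtain b where b: "b < k" "w $ b \<noteq> 0"
    proof (rule ccontr)
      assume "\<not> thesis"
      hence "w $ b = 0" if "b < k" for b using that \<open>\<And>b. b < k \<Longrightarrow> w $ b \<noteq> 0 \<Longrightarrow> thesis\<close> by blast
      hence "w = 0\<^sub>v k" using w(1) by (intro eq_vecI) auto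
      thus False using w(2) by simp
    qed
    have "vs ! b \<in> R" using b vs by auto
    thus ?thesis using f_vs[OF b(1)] b(2) by (intro bexI[of _ "vs ! b"]) simp_all
  qed
  ultimately show ?thesis using that ps(1) f_out by blast
qed

end

lemma PS_lift_eigenfunction:
  assumes "signed_biregular F (right_fibres c n) (left_fibres d n) c d \<sigma>" and "c \<le> d"
    and x: "x \<in># PS (d * n) (c * n) (signed_adjacency_matrix (lift_vertices (complete_bipartite_vertices d c) n) F \<sigma>)"
  obtains f where "0 \<le> x" "\<And>z. z \<in> right_fibres c n \<Longrightarrow> signed_biregular.Adj2 F \<sigma> f z = x\<^sup>2 * f z"
    "\<And>z. z \<notin> right_fibres c n \<Longrightarrow> f z = 0" "\<exists>z\<in>right_fibres c n. f z \<noteq> 0"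
proof -
  let ?us = "List.product (map Inl [0..<d]) [0..<n] :: ((nat + nat) \<times> nat) list"
  let ?vs = "List.product (map Inr [0..<c]) [0..<n] :: ((nat + nat) \<times> nat) list"
  have app: "List.product (xs @ ys) zs = List.product xs zs @ List.product ys zs"
    for xs ys :: "(nat + nat) list" and zs :: "nat list"
    by (induction xs) auto
  have lv: "lift_vertices (complete_bipartite_vertices d c) n = ?us @ ?vs"
    by (simp add: lift_vertices_def complete_bipartite_vertices_def app)
  have "distinct ?us" "distinct ?vs" by (auto intro!: distinct_product simp: distinct_map)
  moreover have "set ?us = left_fibres d n" "set ?vs = right_fibres c n"
    by (auto simp: left_fibres_def right_fibres_def)
  moreover have "c * n \<le> d * n" using assms(2) by simp
  ultimately show ?thesis
    using signed_biregular.PS_eigenfunction[OF assms(1), of ?us "d * n" ?vs "c * n" x] x that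
    unfolding lv by (metis length_map length_product length_upt diff_zero)
qed

subsection \<open>Asymptotics\<close>

text \<open>Of the \<open>Suc Y\<close> factors 1 / n, one is spent on the choice of the first
  vertex, so excess 2 is the least that is improbable.\<close>

lemma complete_bipartite_prob_excess:
  assumes d: "1 \<le> d" and s: "2 * s \<le> n" "0 < n" and en: "exp a \<le> real n"
  shows "measure_pmf.prob (random_lift (complete_bipartite_edges d c) n)
      {F. \<exists>g. wedges g \<subseteq> F \<and> length g \<le> s \<and> Suc Y \<le> excess g}
    \<le> (real s + 1) * real (c + d) ^ s * (2 * (real s)\<^sup>2) ^ Suc Y * exp (- a) ^ Y"
proof -
  interpret lift_space "complete_bipartite_edges d c" n by (rule complete_bipartite_lift_space)
  define B where "B = Inl ` {..<d} \<union> (Inr ` {..<c} :: (nat + nat) set)"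
  have B: "finite B" "\<Union> (complete_bipartite_edges d c) \<subseteq> B"
    by (auto simp: B_def complete_bipartite_edges_def)
  have cB: "card B = c + d" unfolding B_def by (subst card_Un_disjoint) (auto simp: card_image)
  let ?D = "real (c + d) ^ s"
  have sn: "s < n" using s by linarith
  have rat: "real s / real (n - s) * real s \<le> 2 * (real s)\<^sup>2 / real n"
  proof -
    have "real n / 2 \<le> real (n - s)" using s by (simp add: of_nat_diff)
    hence "real s / real (n - s) \<le> real s / (real n / 2)" using s by (intro divide_left_mono) auto
    hence "real s / real (n - s) * real s \<le> real s / (real n / 2) * real s"
      by (intro mult_right_mono) auto
    also have "real s / (real n / 2) * real s = 2 * (real s)\<^sup>2 / real n" by (simp add: power2_eq_square)
    finally show ?thesis .
  qed
  have "measure_pmf.prob (random_lift (complete_bipartite_edges d c) n)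
      {F. \<exists>g. wedges g \<subseteq> F \<and> length g \<le> s \<and> Suc Y \<le> excess g}
    \<le> real n * ((real s + 1) * ?D) * (real s / real (n - s) * real s) ^ Suc Y"
    using prob_excess[OF sn _ B, of "Suc Y"] d by (simp add: cB del: power_Suc)
  also have "\<dots> \<le> real n * ((real s + 1) * ?D) * (2 * (real s)\<^sup>2 / real n) ^ Suc Y"
    by (intro mult_left_mono power_mono rat) auto
  also have "\<dots> = (real s + 1) * ?D * (2 * (real s)\<^sup>2) ^ Suc Y * (1 / real n) ^ Y"
    using s(2) by (simp add: power_divide field_simps)
  also have "\<dots> \<le> (real s + 1) * ?D * (2 * (real s)\<^sup>2) ^ Suc Y * exp (- a) ^ Y"
  proof -
    have "1 / real n \<le> exp (- a)" using en s(2) by (simp add: exp_minus field_simps)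
    thus ?thesis by (intro mult_left_mono power_mono) auto
  qed
  finally show ?thesis .
qed

text \<open>Conditions on the lift. The first two terms are for lifts with too much excess at the
  full length or at three segments; for all others, \<open>prob_outlier\<close> with
  \<open>m = K * l\<close> bounds the probability over the signs.\<close>

lemma signed_lift_bound:
  fixes c d n l K X :: nat and \<epsilon> \<eta> :: real
  defines "s \<equiv> sqrt ((real c - 1) * (real d - 1))"
  defines "per \<equiv> 2 * l" and "T \<equiv> 2 * (K * l) * (2 * l)"
  defines Q_eq: "Q \<equiv> 4 * real (per + 1) * real (T + 1)"
  assumes cd: "2 \<le> c" "c \<le> d" and \<epsilon>: "0 < \<epsilon>" and l: "1 \<le> l"
    and \<eta>: "0 < \<eta>" "s * (1 + \<eta>) + s / (1 + \<eta>) \<le> 2 * s + \<epsilon>\<^sup>2" "(1 + \<eta>)\<^sup>2 \<le> real d - 1"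
      "real c < real d \<Longrightarrow> s * (1 + \<eta>) \<le> (real d - 1) * (s / (1 + \<eta>) - (real c - 1) + 1)"
  shows "measure_pmf.prob (random_signed_lift (complete_bipartite_edges d c) n)
            {(F, s). \<not> set_mset (PS (d * n) (c * n)
                 (signed_adjacency_matrix (lift_vertices (complete_bipartite_vertices d c) n) F s))
               \<subseteq> {sqrt (real d - 1) - sqrt (real c - 1) - \<epsilon> ..
                   sqrt (real d - 1) + sqrt (real c - 1) + \<epsilon>}}
   \<le> measure_pmf.prob (random_lift (complete_bipartite_edges d c) n)
        {F. \<exists>g. wedges g \<subseteq> F \<and> length g \<le> T + 1 \<and> Suc X \<le> excess g}
    + measure_pmf.prob (random_lift (complete_bipartite_edges d c) n)
        {F. \<exists>g. wedges g \<subseteq> F \<and> length g \<le> 3 * per + 1 \<and> Suc 1 \<le> excess g}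
    + real (c * n) * (Q ^ (2 * (K * l)) * ((real d - 1) * (real c - 1)) ^ (l * (K * l)) * ((real d - 1) * Q) ^ X)
        / (s * (1 + \<eta>)) ^ (l * (2 * (K * l)))" (is "measure_pmf.prob _ ?A \<le> measure_pmf.prob ?L ?B1 + measure_pmf.prob ?L ?B2 + ?b")
proof -
  define \<rho> where "\<rho> = s * (1 + \<eta>)"
  have s0: "0 < s" using cd by (simp add: s_def)
  have rho: "0 < \<rho>" using s0 \<eta>(1) by (simp add: \<rho>_def)
  have Q0: "0 \<le> Q" by (simp add: Q_eq)
  have b0: "0 \<le> ?b"
    using cd s0 \<eta>(1) Q0 by (intro divide_nonneg_nonneg mult_nonneg_nonneg zero_le_power) auto
  have each: "measure_pmf.prob (map_pmf (\<lambda>s. (F, s)) (random_signing F)) ?A \<le> ?b"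
    if F: "F \<in> set_pmf ?L" and good: "F \<notin> ?B1 \<union> ?B2" for F
  proof -
    interpret biregular F "right_fibres c n" "left_fibres d n" c d
      by (rule complete_bipartite_lift_biregular[OF cd F])
    interpret segmented_walks F "right_fibres c n" "left_fibres d n" c d per T
    proof
      show "0 < per" "per dvd T" using l by (auto simp: per_def T_def)
      show "excess g \<le> 1" if "wedges g \<subseteq> F" "length g \<le> 3 * per + 1" for g
      proof (rule ccontr)
        assume "\<not> excess g \<le> 1"
        hence "F \<in> ?B2" using that by auto
        thus False using good by blast
      qed
    qed
    have excX: "excess g \<le> X" if "wedges g \<subseteq> F" "length g \<le> T + 1" for g
    proof (rule ccontr)
      assume "\<not> excess g \<le> X"
      hence "F \<in> ?B1" using that by auto
      thus False using good by blast
    qed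
    let ?bad = "{\<sigma>. \<exists>\<Lambda> f. (\<forall>x\<in>right_fibres c n. signed_biregular.Adj2 F \<sigma> f x = \<Lambda> * f x) \<and>
      (\<forall>x. x \<notin> right_fibres c n \<longrightarrow> f x = 0) \<and> (\<exists>x\<in>right_fibres c n. f x \<noteq> 0) \<and> \<rho> ^ l \<le> \<bar>nb_eigenvalue (real c) (real d) \<Lambda> l\<bar>}"
    have cR: "card (right_fibres c n) = c * n" by (simp add: right_fibres_def card_image)
    have QQ: "segmented_walks.Q per T = Q" unfolding Q_eq by (rule Q_def)
    have "measure_pmf.prob (map_pmf (\<lambda>s. (F, s)) (random_signing F)) ?A \<le> measure_pmf.prob (random_signing F) ?bad"
      unfolding measure_map_pmf
    proof (rule measure_pmf.finite_measure_mono_AE)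
      show "AE \<sigma> in measure_pmf (random_signing F). \<sigma> \<in> (\<lambda>s. (F, s)) -` ?A \<longrightarrow> \<sigma> \<in> ?bad"
      proof (intro AE_pmfI impI)
        fix \<sigma> assume \<sigma>: "\<sigma> \<in> set_pmf (random_signing F)" and A: "\<sigma> \<in> (\<lambda>s. (F, s)) -` ?A"
        interpret signed_biregular F "right_fibres c n" "left_fibres d n" c d \<sigma>
        proof unfold_locales
          fix e assume "e \<in> F"
          thus "\<sigma> e * \<sigma> e = 1" using set_random_signing[OF finF \<sigma>] by fastforce
        qed
        obtain x where x: "x \<in># PS (d * n) (c * n) (signed_adjacency_matrix (lift_vertices (complete_bipartite_vertices d c) n) F \<sigma>)"
          and out: "x \<notin> {sqrt (real d - 1) - sqrt (real c - 1) - \<epsilon> .. sqrt (real d - 1) + sqrt (real c - 1) + \<epsilon>}"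
          using A by blast
        obtain f where f: "0 \<le> x" "\<And>z. z \<in> right_fibres c n \<Longrightarrow> Adj2 f z = x\<^sup>2 * f z"
          "\<And>z. z \<notin> right_fibres c n \<Longrightarrow> f z = 0" "\<exists>z\<in>right_fibres c n. f z \<noteq> 0"
          using PS_lift_eigenfunction[OF signed_biregular_axioms cd(2) x] by metis
        have "2 * s + \<epsilon>\<^sup>2 \<le> \<bar>x\<^sup>2 - (real c - 1 + (real d - 1))\<bar>"
          unfolding s_def using cd \<epsilon> f(1) out by (intro outside_interval) auto
        hence "\<rho> ^ l \<le> \<bar>nb_eigenvalue (real c) (real d) (x\<^sup>2) l\<bar>"
          unfolding \<rho>_def s_def using cd \<eta>[unfolded s_def] \<epsilon>
          by (intro nb_eigenvalue_growth[where \<delta> = "\<epsilon>\<^sup>2"]) auto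
        thus "\<sigma> \<in> ?bad" using f(2-4) by blast
      qed
    qed simp
    also have "\<dots> \<le> ?b"
      using prob_outlier[of l "K * l" \<rho> X] rho excX
      unfolding QQ cR \<rho>_def[symmetric] by (simp add: per_def T_def)
    finally show ?thesis .
  qed
  have "measure_pmf.prob (random_signed_lift (complete_bipartite_edges d c) n) ?A \<le> measure_pmf.prob ?L (?B1 \<union> ?B2) + ?b"
    unfolding random_signed_lift_def by (rule prob_bind_le[OF each b0])
  also have "measure_pmf.prob ?L (?B1 \<union> ?B2) \<le> measure_pmf.prob ?L ?B1 + measure_pmf.prob ?L ?B2"
    by (rule measure_Un_le) auto
  finally show ?thesis by simp
qed

text \<open>The choice of \<open>K\<close> gives (1 + \<eta>)^(2 K x^2) >= exp (2 x^2), which beats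
  n <= exp ((x + 1)^2) with a margin of order x^2; the cost of the segments is only exp (O(x ln x)).
  The choice of \<open>X\<close> lets exp (- X x^2) outweigh the D^T = exp (4 K x^2 ln D)
  projections of long walks, with exp (- x^2) to spare. For three segments there are only exp (O(x))
  projections, so a single factor exp (- x^2) is enough.\<close>

lemma signed_lift_rate:
  fixes c d n l K X :: nat and \<epsilon> \<eta> :: real
  defines "s \<equiv> sqrt ((real c - 1) * (real d - 1))"
  defines "q \<equiv> real d - 1" and "D \<equiv> real (c + d)" and "x \<equiv> real l"
  defines "Q \<equiv> 4 * (2 * x + 1) * (4 * real K * x\<^sup>2 + 1)"
  assumes cd: "2 \<le> c" "c \<le> d" and \<epsilon>: "0 < \<epsilon>" and l: "1 \<le> l"
    and \<eta>: "0 < \<eta>" "s * (1 + \<eta>) + s / (1 + \<eta>) \<le> 2 * s + \<epsilon>\<^sup>2" "(1 + \<eta>)\<^sup>2 \<le> real d - 1"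
      "real c < real d \<Longrightarrow> s * (1 + \<eta>) \<le> (real d - 1) * (s / (1 + \<eta>) - (real c - 1) + 1)"
    and K: "1 \<le> real K * ln (1 + \<eta>)" and X: "4 * real K * ln D + 1 \<le> real X"
    and n: "exp (x\<^sup>2) \<le> real n" "real n \<le> exp ((x + 1)\<^sup>2)"
    and large: "2 * (4 * real K * x\<^sup>2 + 2) \<le> exp (x\<^sup>2)" "2 * (6 * x + 2) \<le> exp (x\<^sup>2)"
  shows "measure_pmf.prob (random_signed_lift (complete_bipartite_edges d c) n)
            {(F, s). \<not> set_mset (PS (d * n) (c * n)
                 (signed_adjacency_matrix (lift_vertices (complete_bipartite_vertices d c) n) F s))
               \<subseteq> {sqrt (real d - 1) - sqrt (real c - 1) - \<epsilon> ..
                   sqrt (real d - 1) + sqrt (real c - 1) + \<epsilon>}}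
   \<le> (4 * real K * x\<^sup>2 + 2) * D * (2 * (4 * real K * x\<^sup>2 + 1)\<^sup>2) ^ (X + 1) * exp (- x\<^sup>2)
     + (6 * x + 2) * exp ((6 * x + 1) * ln D) * (2 * (6 * x + 1)\<^sup>2) ^ 2 * exp (- x\<^sup>2)
     + real c * exp ((x + 1)\<^sup>2 - 2 * x\<^sup>2 + 2 * real K * x * ln Q) * (q * Q) ^ X"
proof -
  define T where "T = 2 * (K * l) * (2 * l)"
  let ?L = "random_lift (complete_bipartite_edges d c) n"
  have D: "1 < D" using cd by (simp add: D_def)
  have Tx: "real T = 4 * real K * x\<^sup>2" by (simp add: T_def x_def power2_eq_square)
  have n0: "0 < n" using n(1) by (metis exp_gt_zero gr0I linorder_not_le of_nat_0)
  have Dpow: "D ^ j = exp (real j * ln D)" for j using D by (simp add: exp_of_nat_mult)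
  have "real (2 * (T + 1)) \<le> real n" using large(1) n(1) Tx by simp
  hence T1: "2 * (T + 1) \<le> n" unfolding of_nat_le_iff .
  have "real (2 * (3 * (2 * l) + 1)) \<le> real n" using large(2) n(1) by (simp add: x_def)
  hence T2: "2 * (3 * (2 * l) + 1) \<le> n" unfolding of_nat_le_iff .
  have b1: "measure_pmf.prob ?L {F. \<exists>g. wedges g \<subseteq> F \<and> length g \<le> T + 1 \<and> Suc X \<le> excess g}
      \<le> (4 * real K * x\<^sup>2 + 2) * D * (2 * (4 * real K * x\<^sup>2 + 1)\<^sup>2) ^ (X + 1) * exp (- x\<^sup>2)"
  proof -
    have "measure_pmf.prob ?L {F. \<exists>g. wedges g \<subseteq> F \<and> length g \<le> T + 1 \<and> Suc X \<le> excess g}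
       \<le> (real (T + 1) + 1) * D ^ (T + 1) * (2 * (real (T + 1))\<^sup>2) ^ Suc X * exp (- x\<^sup>2) ^ X"
      unfolding D_def by (rule complete_bipartite_prob_excess[OF _ T1 n0 n(1)]) (use cd in auto)
    also have "\<dots> = (real T + 2) * (2 * (real T + 1)\<^sup>2) ^ (X + 1) * D * (D ^ T * exp (- x\<^sup>2) ^ X)"
      by (simp add: mult_ac add_ac)
    also have "D ^ T * exp (- x\<^sup>2) ^ X = exp (x\<^sup>2 * (4 * real K * ln D - real X))"
      unfolding Dpow exp_of_nat_mult[symmetric] Tx by (simp add: exp_add[symmetric] algebra_simps)
    also have "\<dots> \<le> exp (x\<^sup>2 * (- 1))"
      unfolding exp_le_cancel_iff using X by (intro mult_left_mono) auto
    finally have "measure_pmf.prob ?L {F. \<exists>g. wedges g \<subseteq> F \<and> length g \<le> T + 1 \<and> Suc X \<le> excess g}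
      \<le> (real T + 2) * (2 * (real T + 1)\<^sup>2) ^ (X + 1) * D * exp (- x\<^sup>2)"
      using D by (simp add: mult_left_mono)
    thus ?thesis unfolding Tx by (simp add: mult_ac)
  qed
  have b2: "measure_pmf.prob ?L {F. \<exists>g. wedges g \<subseteq> F \<and> length g \<le> 3 * (2 * l) + 1 \<and> Suc 1 \<le> excess g}
      \<le> (6 * x + 2) * exp ((6 * x + 1) * ln D) * (2 * (6 * x + 1)\<^sup>2) ^ 2 * exp (- x\<^sup>2)"
  proof -
    have "measure_pmf.prob ?L {F. \<exists>g. wedges g \<subseteq> F \<and> length g \<le> 3 * (2 * l) + 1 \<and> Suc 1 \<le> excess g}
       \<le> (real (3 * (2 * l) + 1) + 1) * D ^ (3 * (2 * l) + 1) * (2 * (real (3 * (2 * l) + 1))\<^sup>2) ^ Suc 1 * exp (- x\<^sup>2) ^ 1"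
      unfolding D_def by (rule complete_bipartite_prob_excess[OF _ T2 n0 n(1)]) (use cd in auto)
    moreover have "real (3 * (2 * l) + 1) = 6 * x + 1" by (simp add: x_def)
    moreover have "6 * x + 1 + 1 = 6 * x + 2" by simp
    ultimately show ?thesis unfolding Dpow by (simp only: Suc_1 power_one_right)
  qed
  have Qeq: "4 * real (2 * l + 1) * real (T + 1) = Q"
    by (simp add: Q_def x_def[symmetric] Tx algebra_simps)
  have Q: "0 < Q" unfolding Q_def x_def by (intro mult_pos_pos add_nonneg_pos) auto
  have s0: "0 < s" using cd by (simp add: s_def)
  have q0: "0 < q" using cd by (simp add: q_def)
  have b3: "real (c * n) * (Q ^ (2 * (K * l)) * ((real d - 1) * (real c - 1)) ^ (l * (K * l)) * (q * Q) ^ X)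
        / (s * (1 + \<eta>)) ^ (l * (2 * (K * l))) \<le> real c * exp ((x + 1)\<^sup>2 - 2 * x\<^sup>2 + 2 * real K * x * ln Q) * (q * Q) ^ X"
  proof -
    define j where "j = l * (K * l)"
    have jx: "real j = real K * x\<^sup>2" by (simp add: j_def x_def power2_eq_square)
    have e: "l * (2 * (K * l)) = 2 * j" by (simp add: j_def)
    have ss: "(real d - 1) * (real c - 1) = s\<^sup>2" using cd by (simp add: s_def mult.commute)
    have rat: "(s\<^sup>2) ^ j / (s * (1 + \<eta>)) ^ (2 * j) = exp (- (2 * real j * ln (1 + \<eta>)))"
    proof -
      have "exp (2 * real j * ln (1 + \<eta>)) = (1 + \<eta>) ^ (2 * j)"
        using \<eta>(1) exp_of_nat_mult[of "2 * j" "ln (1 + \<eta>)"] by simp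
      moreover have "(s * (1 + \<eta>)) ^ (2 * j) = (s\<^sup>2) ^ j * (1 + \<eta>) ^ (2 * j)"
        by (simp add: power_mult_distrib power_mult)
      moreover have "(s\<^sup>2) ^ j \<noteq> 0" using s0 by simp
      ultimately show ?thesis by (simp add: exp_minus inverse_eq_divide)
    qed
    have Qp: "Q ^ (2 * (K * l)) = exp (2 * real K * x * ln Q)"
      using Q exp_of_nat_mult[of "2 * (K * l)" "ln Q"] by (simp add: x_def mult_ac)
    have "real (c * n) * (Q ^ (2 * (K * l)) * ((real d - 1) * (real c - 1)) ^ (l * (K * l)) * (q * Q) ^ X)
        / (s * (1 + \<eta>)) ^ (l * (2 * (K * l)))
      = real c * (q * Q) ^ X * (exp (2 * real K * x * ln Q) * (real n * ((s\<^sup>2) ^ j / (s * (1 + \<eta>)) ^ (2 * j))))"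
      unfolding ss e Qp j_def[symmetric] by simp
    also have "\<dots> \<le> real c * (q * Q) ^ X * (exp (2 * real K * x * ln Q) * (exp ((x + 1)\<^sup>2) * exp (- (2 * x\<^sup>2))))"
    proof -
      have "x\<^sup>2 * 1 \<le> x\<^sup>2 * (real K * ln (1 + \<eta>))" using K by (intro mult_left_mono) auto
      hence "exp (- (2 * real j * ln (1 + \<eta>))) \<le> exp (- (2 * x\<^sup>2))" unfolding jx by (simp add: mult_ac)
      hence "real n * exp (- (2 * real j * ln (1 + \<eta>))) \<le> exp ((x + 1)\<^sup>2) * exp (- (2 * x\<^sup>2))"
        using n(2) by (intro mult_mono) auto
      thus ?thesis unfolding rat using q0 Q by (intro mult_left_mono) auto
    qed
    also have "\<dots> = real c * exp ((x + 1)\<^sup>2 - 2 * x\<^sup>2 + 2 * real K * x * ln Q) * (q * Q) ^ X"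
      by (simp add: exp_add exp_diff exp_minus divide_inverse mult_ac)
    finally show ?thesis .
  qed
  show ?thesis
    using signed_lift_bound[OF cd \<epsilon> l \<eta>[unfolded s_def], of n K X] b1 b2 b3
    unfolding T_def[symmetric] Qeq s_def[symmetric] unfolding q_def[symmetric] by linarith
qed

theorem theorem4p9:
  fixes d c :: nat and \<epsilon> :: real
  assumes "2 \<le> c" and "c \<le> d" and "d \<noteq> 2" and "\<epsilon> > 0"
  shows "(\<lambda>n. measure_pmf.prob (random_signed_lift (complete_bipartite_edges d c) n)
            {(F, s). \<not> set_mset (PS (d * n) (c * n)
                 (signed_adjacency_matrix (lift_vertices (complete_bipartite_vertices d c) n) F s))
               \<subseteq> {sqrt (real d - 1) - sqrt (real c - 1) - \<epsilon> ..
                   sqrt (real d - 1) + sqrt (real c - 1) + \<epsilon>}})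
         \<in> o(\<lambda>_. 1)"
proof -
  define s where "s = sqrt ((real c - 1) * (real d - 1))"
  have "1 \<le> real c - 1" "real c - 1 \<le> real d - 1" "2 \<le> real d - 1" "0 < \<epsilon>\<^sup>2" using assms by auto
  from growth_parameter[OF this] obtain \<eta> where \<eta>: "0 < \<eta>" "s * (1 + \<eta>) + s / (1 + \<eta>) \<le> 2 * s + \<epsilon>\<^sup>2"
      "(1 + \<eta>)\<^sup>2 \<le> real d - 1" "real c < real d \<Longrightarrow> s * (1 + \<eta>) \<le> (real d - 1) * (s / (1 + \<eta>) - (real c - 1) + 1)"
    unfolding s_def by (metis diff_strict_right_mono)
  have ln: "0 < ln (1 + \<eta>)" using \<eta>(1) by simp
  obtain K :: nat where K0: "1 / ln (1 + \<eta>) < real K" using reals_Archimedean2 by blast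
  hence K: "1 \<le> real K * ln (1 + \<eta>)" using ln by (simp add: field_simps)
  have "0 < 1 / ln (1 + \<eta>)" using ln by simp
  hence K1: "0 < real K" using K0 by linarith
  define D where "D = real (c + d)"
  have D: "1 < D" using assms by (simp add: D_def)
  obtain X :: nat where X0: "4 * real K * ln D + 1 < real X" using reals_Archimedean2 by blast
  define q where "q = real d - 1"
  have q: "0 < q" using assms by (simp add: q_def)
  \<comment> \<open>The bound of \<open>signed_lift_rate\<close>, in which \<open>n\<close> occurs
    only through \<open>l\<close>, as a function of a real variable.\<close>
  define h where "h x = (4 * real K * x\<^sup>2 + 2) * D * (2 * (4 * real K * x\<^sup>2 + 1)\<^sup>2) ^ (X + 1) * exp (- x\<^sup>2)
     + (6 * x + 2) * exp ((6 * x + 1) * ln D) * (2 * (6 * x + 1)\<^sup>2) ^ 2 * exp (- x\<^sup>2)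
     + real c * exp ((x + 1)\<^sup>2 - 2 * x\<^sup>2 + 2 * real K * x * ln (4 * (2 * x + 1) * (4 * real K * x\<^sup>2 + 1)))
       * (q * (4 * (2 * x + 1) * (4 * real K * x\<^sup>2 + 1))) ^ X" for x :: real
  have h: "(h \<longlongrightarrow> 0) at_top"
  proof -
    have "((\<lambda>x::real. (4 * real K * x\<^sup>2 + 2) * D * (2 * (4 * real K * x\<^sup>2 + 1)\<^sup>2) ^ (X + 1) * exp (- x\<^sup>2)) \<longlongrightarrow> 0) at_top"
      using K1 D by real_asymp
    moreover have "((\<lambda>x::real. (6 * x + 2) * exp ((6 * x + 1) * ln D) * (2 * (6 * x + 1)\<^sup>2) ^ 2 * exp (- x\<^sup>2)) \<longlongrightarrow> 0) at_top"
      using D by real_asymp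
    moreover have "((\<lambda>x::real. real c * exp ((x + 1)\<^sup>2 - 2 * x\<^sup>2 + 2 * real K * x * ln (4 * (2 * x + 1) * (4 * real K * x\<^sup>2 + 1)))
       * (q * (4 * (2 * x + 1) * (4 * real K * x\<^sup>2 + 1))) ^ X) \<longlongrightarrow> 0) at_top"
    proof -
      have "0 < real c" using assms by simp
      thus ?thesis using K1 q by real_asymp
    qed
    ultimately have "(h \<longlongrightarrow> 0 + 0 + 0) at_top" unfolding h_def by (intro tendsto_add)
    thus ?thesis by simp
  qed
  define l where "l n = nat \<lfloor>sqrt (ln (real n))\<rfloor>" for n :: nat
  have l: "filterlim l at_top at_top" unfolding l_def by real_asymp
  have rl: "filterlim (\<lambda>n. real (l n)) at_top at_top"
    by (rule filterlim_compose[OF filterlim_real_sequentially l])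
  have ev1: "\<forall>\<^sub>F n in at_top. 2 * (4 * real K * (real (l n))\<^sup>2 + 2) \<le> exp ((real (l n))\<^sup>2)"
  proof (rule eventually_compose_filterlim[OF _ rl])
    show "\<forall>\<^sub>F x::real in at_top. 2 * (4 * real K * x\<^sup>2 + 2) \<le> exp (x\<^sup>2)" using K1 by real_asymp
  qed
  have ev2: "\<forall>\<^sub>F n in at_top. 2 * (6 * real (l n) + 2) \<le> exp ((real (l n))\<^sup>2)"
  proof (rule eventually_compose_filterlim[OF _ rl])
    show "\<forall>\<^sub>F x::real in at_top. 2 * (6 * x + 2) \<le> exp (x\<^sup>2)" by real_asymp
  qed
  have ev3: "\<forall>\<^sub>F n in at_top. 1 \<le> l n" using l by (simp add: filterlim_at_top)
  have ev4: "\<forall>\<^sub>F n in at_top. exp ((real (l n))\<^sup>2) \<le> real n \<and> real n \<le> exp ((real (l n) + 1)\<^sup>2)"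
    using eventually_ge_at_top[of 1]
  proof eventually_elim
    case (elim n)
    define t where "t = sqrt (ln (real n))"
    have "0 \<le> ln (real n)" using elim by simp
    hence t: "0 \<le> t" "t\<^sup>2 = ln (real n)" by (simp_all add: t_def)
    have "real (l n) \<le> t" "t \<le> real (l n) + 1" using t(1) by (simp_all add: l_def t_def[symmetric])
    hence "(real (l n))\<^sup>2 \<le> t\<^sup>2" "t\<^sup>2 \<le> (real (l n) + 1)\<^sup>2" using t(1) by (auto intro!: power_mono)
    hence "exp ((real (l n))\<^sup>2) \<le> exp (ln (real n))" "exp (ln (real n)) \<le> exp ((real (l n) + 1)\<^sup>2)"
      unfolding t(2) by simp_all
    thus ?case using elim by simp
  qed
  show ?thesis
  proof (rule smalloI_tendsto)
    let ?P = "\<lambda>n. measure_pmf.prob (random_signed_lift (complete_bipartite_edges d c) n)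
            {(F, s). \<not> set_mset (PS (d * n) (c * n)
                 (signed_adjacency_matrix (lift_vertices (complete_bipartite_vertices d c) n) F s))
               \<subseteq> {sqrt (real d - 1) - sqrt (real c - 1) - \<epsilon> ..
                   sqrt (real d - 1) + sqrt (real c - 1) + \<epsilon>}}"
    have le: "\<forall>\<^sub>F n in at_top. ?P n \<le> h (real (l n))"
      using ev1 ev2 ev3 ev4
    proof eventually_elim
      case (elim n)
      show ?case unfolding h_def D_def q_def
        by (rule signed_lift_rate[OF assms(1,2,4) elim(3) \<eta>[unfolded s_def] K less_imp_le[OF X0[unfolded D_def]]
              conjunct1[OF elim(4)] conjunct2[OF elim(4)] elim(1,2)])
    qed
    have "(?P \<longlongrightarrow> 0) at_top"
    proof (rule tendsto_sandwich[OF _ le tendsto_const])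
      show "((\<lambda>n. h (real (l n))) \<longlongrightarrow> 0) at_top" by (rule filterlim_compose[OF h rl])
    qed simp
    thus "((\<lambda>n. ?P n / 1) \<longlongrightarrow> 0) at_top" by simp
  qed simp
qed

end
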